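(* Let $G$ be an l.c.s.c. group, $A$ a Polish $G$-module and $p\geq 0$. Then every class in $\mathrm{H}^p_{\mathrm{m}}(G,A)$ has a representative cocycle in the homogeneous measurable bar resolution, i.e. a $G$-equivariant measurable map $\sigma:G^{p+1}\to A$ with $d\sigma=0$, for which there is a dense $G_\delta$ subset $S\subseteq G^{p+1}$ of full Haar measure, containing the identity $(e,\dots,e)$, such that $\sigma$ is continuous at every point of $S$.
   Context: Measurable cohomology: for an l.c.s.c. group $G$ and a Polish $G$-module $A$ (Polish Abelian group with continuous action of $G$ by automorphisms), cochains are Haar-a.e. classes of measurable maps $G^{p+1}\to A$ with diagonal action $(g\cdot\phi)(g_1,\dots)=g\cdot\phi(g^{-1}g_1,\dots)$; $G$-equivariant means fixed by this action. The differential is $d\sigma(g_1,\dots,g_{p+1})=\sum_{i=1}^{p+1}(-1)^{p+1-i}\sigma(g_1,\dots,\widehat{g_i},\dots,g_{p+1})$, and $\mathrm{H}^p_{\mathrm{m}}(G,A)$ is the homology in degree $p$ (cochains on $G^{p+1}$) of the complex of $G$-equivariant cochains. *)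

theory Defs
  imports "HOL-Analysis.Analysis"
begin

text \<open>The l.c.s.c. group G is a type 'g of class topological_group_add (written
additively, NOT assumed commutative).  G^n is modelled as the extensional
functions {..<n} \<rightarrow> G, i.e. PiE {..<n} (\<lambda>_. UNIV), with the product topology
(subspace of the function-type topology) and the product measure.\<close>

text \<open>Left Haar measure on G (Borel, left invariant, finite on compacts,
positive on nonempty open sets; regularity is automatic for l.c.s.c. groups).\<close>
definition haar_measure :: "'g::topological_group_add measure \<Rightarrow> bool" where
  "haar_measure \<mu> \<longleftrightarrow>
     sets \<mu> = sets borel \<and>
     (\<forall>g A. A \<in> sets borel \<longrightarrow> emeasure \<mu> ((\<lambda>x. g + x) ` A) = emeasure \<mu> A) \<and>
     (\<forall>K. compact K \<longrightarrow> emeasure \<mu> K < \<infinity>) \<and>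
     (\<forall>U. open U \<and> U \<noteq> {} \<longrightarrow> emeasure \<mu> U > 0)"

definition G_module_action :: "('g::topological_group_add \<Rightarrow> 'a::topological_ab_group_add \<Rightarrow> 'a) \<Rightarrow> bool" where
  "G_module_action \<alpha> \<longleftrightarrow>
     (\<forall>a. \<alpha> 0 a = a) \<and>
     (\<forall>g h a. \<alpha> (g + h) a = \<alpha> g (\<alpha> h a)) \<and>
     (\<forall>g a b. \<alpha> g (a + b) = \<alpha> g a + \<alpha> g b) \<and>
     continuous_on UNIV (\<lambda>(g, a). \<alpha> g a)"

definition Gpow :: "nat \<Rightarrow> (nat \<Rightarrow> 'g) set" where
  "Gpow n = PiE {..<n} (\<lambda>_. UNIV)"

definition Mpow :: "'g measure \<Rightarrow> nat \<Rightarrow> (nat \<Rightarrow> 'g) measure" where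
  "Mpow \<mu> n = PiM {..<n} (\<lambda>_. \<mu>)"

definition cochain_act ::
  "('g::group_add \<Rightarrow> 'a \<Rightarrow> 'a) \<Rightarrow> nat \<Rightarrow> 'g \<Rightarrow> ((nat \<Rightarrow> 'g) \<Rightarrow> 'a) \<Rightarrow> (nat \<Rightarrow> 'g) \<Rightarrow> 'a" where
  "cochain_act \<alpha> n g \<phi> x = \<alpha> g (\<phi> (\<lambda>j\<in>{..<n}. - g + x j))"

text \<open>Measurable G-equivariant cochain on G^n: a measurable map whose a.e.-class
is fixed by the action, i.e. for every g, g.phi = phi Haar-a.e.\<close>
definition equiv_cochain ::
  "'g::topological_group_add measure \<Rightarrow> ('g \<Rightarrow> 'a::topological_ab_group_add \<Rightarrow> 'a) \<Rightarrow> nat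
    \<Rightarrow> ((nat \<Rightarrow> 'g) \<Rightarrow> 'a) \<Rightarrow> bool" where
  "equiv_cochain \<mu> \<alpha> n \<phi> \<longleftrightarrow>
     \<phi> \<in> borel_measurable (Mpow \<mu> n) \<and>
     (\<forall>g. AE x in Mpow \<mu> n. cochain_act \<alpha> n g \<phi> x = \<phi> x)"

definition omit :: "nat \<Rightarrow> nat \<Rightarrow> (nat \<Rightarrow> 'g) \<Rightarrow> (nat \<Rightarrow> 'g)" where
  "omit n i x = (\<lambda>j\<in>{..<n}. if j < i then x j else x (Suc j))"

text \<open>Differential from cochains on G^n to cochains on G^(n+1):
  d sigma(g_1..g_{n+1}) = sum_{i=1}^{n+1} (-1)^(n+1-i) sigma(g_1..^g_i..g_{n+1});
  here with 0-based index i, the sign is (-1)^(n-i).\<close>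
definition cobd :: "nat \<Rightarrow> ((nat \<Rightarrow> 'g) \<Rightarrow> 'a::ab_group_add) \<Rightarrow> (nat \<Rightarrow> 'g) \<Rightarrow> 'a" where
  "cobd n \<sigma> x = (\<Sum>i<Suc n. (if even (n - i) then \<sigma> (omit n i x) else - \<sigma> (omit n i x)))"

definition equiv_cocycle ::
  "'g::topological_group_add measure \<Rightarrow> ('g \<Rightarrow> 'a::topological_ab_group_add \<Rightarrow> 'a) \<Rightarrow> nat
    \<Rightarrow> ((nat \<Rightarrow> 'g) \<Rightarrow> 'a) \<Rightarrow> bool" where
  "equiv_cocycle \<mu> \<alpha> p \<sigma> \<longleftrightarrow>
     equiv_cochain \<mu> \<alpha> (Suc p) \<sigma> \<and>
     (AE x in Mpow \<mu> (Suc (Suc p)). cobd (Suc p) \<sigma> x = 0)"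

text \<open>Two degree-p cocycles define the same class in H^p_m(G,A): their difference is
a.e. the differential of an equivariant measurable cochain on G^p (p > 0); in
degree 0 there are no coboundaries, so they must agree a.e.\<close>
definition cohomologous ::
  "'g::topological_group_add measure \<Rightarrow> ('g \<Rightarrow> 'a::topological_ab_group_add \<Rightarrow> 'a) \<Rightarrow> nat
    \<Rightarrow> ((nat \<Rightarrow> 'g) \<Rightarrow> 'a) \<Rightarrow> ((nat \<Rightarrow> 'g) \<Rightarrow> 'a) \<Rightarrow> bool" where
  "cohomologous \<mu> \<alpha> p \<sigma> \<phi> \<longleftrightarrow>
     (if p = 0 then (AE x in Mpow \<mu> (Suc 0). \<sigma> x = \<phi> x)
      else (\<exists>\<psi>. equiv_cochain \<mu> \<alpha> p \<psi> \<and>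
              (AE x in Mpow \<mu> (Suc p). \<sigma> x - \<phi> x = cobd p \<psi> x)))"

end

theory Submission
  imports Defs "HOL-Probability.Probability"
begin

text \<open>
  A cochain on \<open>G^n\<close> is regarded, for each \<open>m\<close>, as a function of its first \<open>m\<close> variables with
  values in the Polish group of measurable functions of the remaining ones, under convergence in
  measure.  For \<open>m = 1\<close> every strictly equivariant cochain is continuous in this sense, because
  translation is continuous in measure.  To pass from \<open>m\<close> to \<open>m + 1\<close>, split the coboundary into
  the faces omitting one of the first \<open>m + 1\<close> variables and the faces omitting a later one: the
  cocycle identity says that the head coboundary of the current function is, up to sign, a tail
  coboundary.  The tail coboundary is an open surjection onto the tail cocycles (a tail cocycle is
  the coboundary of its restriction to a generic value of the last variable), so an almost
  everywhere continuous family of tail cocycles has an almost everywhere continuous family of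
  primitives, built by successive corrections that are constant on open pieces with null
  frontiers; a point mass at the identity forces continuity there.  Two primitives differ by a
  tail coboundary, so that for \<open>m = n\<close> the resulting cochain differs from the given cocycle by a
  coboundary.

  All variables are embedded in the space of sequences with an infinite product of a probability
  measure equivalent to Haar measure, so that the number of variables need not appear in types.
\<close>

section \<open>Convergence in measure\<close>

text \<open>A measurable choice of primitives would be continuous, by Lusin's theorem, only relative
  to a large closed set. Here continuity is wanted along every sequence tending to the point, also
  one running through exceptional heads. Hence the approximate choices are defined for all heads,
  are locally constant on open sets, and are corrected by amounts that are small at every head, good
  or bad. Equivariance is kept exact by normalisation: a head is translated so that its first entry
  is 0, a primitive is chosen for the normalised head, and the group action carries it back. The
  price is that normalised heads usually form a null set, on which almost everywhere statements say
  nothing. So the given class is replaced by a strictly equivariant representative at the outset,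
  equivariance transports good properties to normalised heads, and the selection is made with
  respect to the law of the normalised head. To this law an atom at the identity tuple is added,
  with mass one half.\<close>

definition meas_dist :: "'x measure \<Rightarrow> ('x \<Rightarrow> 'a::metric_space) \<Rightarrow> ('x \<Rightarrow> 'a) \<Rightarrow> real" where
  "meas_dist M u v = (\<integral>x. min 1 (dist (u x) (v x)) \<partial>M)"

text \<open>Otherwise infinitely many terms avoid some neighbourhood of \<open>l\<close>, and
  enumerating them gives a subsequence without a good further subsequence. This turns almost
  everywhere convergence along subsequences into convergence in measure of the whole
  sequence.\<close>

lemma tendsto_subseqI:
  fixes f :: "nat \<Rightarrow> 'c::topological_space"
  assumes "\<And>r::nat \<Rightarrow> nat. strict_mono r \<Longrightarrow> \<exists>s::nat \<Rightarrow> nat. strict_mono s \<and> (\<lambda>k. f (r (s k))) \<longlonglongrightarrow> l"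
  shows "f \<longlonglongrightarrow> l"
proof (rule ccontr)
  assume "\<not> f \<longlonglongrightarrow> l"
  then obtain S where S: "open S" "l \<in> S" "\<not> eventually (\<lambda>k. f k \<in> S) sequentially"
    unfolding tendsto_def by auto
  then have "\<exists>\<^sub>F k in sequentially. f k \<notin> S" by (simp add: frequently_def)
  then have inf: "infinite {k. f k \<notin> S}"
    by (simp add: frequently_cofinite[symmetric] cofinite_eq_sequentially)
  define r where "r = enumerate {k. f k \<notin> S}"
  have r: "strict_mono r" "\<And>k. f (r k) \<notin> S"
    using inf unfolding r_def by (auto simp: strict_mono_enumerate dest: enumerate_in_set)
  from assms[OF r(1)] obtain s :: "nat \<Rightarrow> nat" where "(\<lambda>k. f (r (s k))) \<longlonglongrightarrow> l" by blast
  then have "eventually (\<lambda>k. f (r (s k)) \<in> S) sequentially"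
    using S by (simp add: topological_tendstoD)
  with r(2) show False by simp
qed

context prob_space
begin

lemma integrable_min_dist:
  fixes u v :: "'a \<Rightarrow> 'b::{metric_space, second_countable_topology}"
  assumes [measurable]: "u \<in> borel_measurable M" "v \<in> borel_measurable M"
  shows "integrable M (\<lambda>x. min 1 (dist (u x) (v x)))"
  by (rule integrable_const_bound[of _ 1]) auto

lemma meas_dist_nonneg: "0 \<le> meas_dist M u v"
  unfolding meas_dist_def by (rule integral_nonneg_AE) auto

lemma meas_dist_le_1:
  fixes u v :: "'a \<Rightarrow> 'b::{metric_space, second_countable_topology}"
  assumes [measurable]: "u \<in> borel_measurable M" "v \<in> borel_measurable M"
  shows "meas_dist M u v \<le> 1"
proof -
  have "meas_dist M u v \<le> (\<integral>x. 1 \<partial>M)"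
    unfolding meas_dist_def by (intro integral_mono integrable_min_dist assms) auto
  then show ?thesis by (simp add: prob_space)
qed

lemma meas_dist_commute: "meas_dist M u v = meas_dist M v u"
  unfolding meas_dist_def by (simp add: dist_commute)

lemma meas_dist_triangle:
  fixes u v w :: "'a \<Rightarrow> 'b::{metric_space, second_countable_topology}"
  assumes [measurable]: "u \<in> borel_measurable M" "v \<in> borel_measurable M" "w \<in> borel_measurable M"
  shows "meas_dist M u w \<le> meas_dist M u v + meas_dist M v w"
proof -
  have "meas_dist M u w \<le> (\<integral>x. min 1 (dist (u x) (v x)) + min 1 (dist (v x) (w x)) \<partial>M)"
    unfolding meas_dist_def
    by (intro integral_mono integrable_min_dist Bochner_Integration.integrable_add assms)
       (smt (verit) dist_triangle zero_le_dist)
  then show ?thesis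
    unfolding meas_dist_def by (simp add: integrable_min_dist)
qed

lemma meas_dist_tendsto_AE:
  fixes u :: "'a \<Rightarrow> 'b::{metric_space, second_countable_topology}"
  assumes [measurable]: "\<And>k. U k \<in> borel_measurable M" "u \<in> borel_measurable M"
    and "AE x in M. (\<lambda>k. U k x) \<longlonglongrightarrow> u x"
  shows "(\<lambda>k. meas_dist M (U k) u) \<longlonglongrightarrow> 0"
proof -
  have "(\<lambda>k. meas_dist M (U k) u) \<longlonglongrightarrow> (\<integral>x. 0 \<partial>M)"
    unfolding meas_dist_def
  proof (rule integral_dominated_convergence[where w = "\<lambda>_. 1"])
    show "AE x in M. (\<lambda>k. min 1 (dist (U k x) (u x))) \<longlonglongrightarrow> 0"
      using assms(3)
    proof eventually_elim
      case (elim x)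
      then have "(\<lambda>k. min 1 (dist (U k x) (u x))) \<longlonglongrightarrow> min 1 0"
        by (intro tendsto_min tendsto_const) (simp add: tendsto_dist_iff[symmetric])
      then show ?case by simp
    qed
  qed auto
  then show ?thesis by simp
qed

lemma meas_dist_AE_subseq:
  fixes u :: "'a \<Rightarrow> 'b::{metric_space, second_countable_topology}"
  assumes [measurable]: "\<And>k. U k \<in> borel_measurable M" "u \<in> borel_measurable M"
    and "(\<lambda>k. meas_dist M (U k) u) \<longlonglongrightarrow> 0"
  shows "\<exists>r::nat \<Rightarrow> nat. strict_mono r \<and> (AE x in M. (\<lambda>k. U (r k) x) \<longlonglongrightarrow> u x)"
proof -
  have "(\<lambda>k. \<integral>x. norm (min 1 (dist (U k x) (u x))) \<partial>M) \<longlonglongrightarrow> 0"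
    using assms(3) by (simp add: meas_dist_def)
  then obtain r :: "nat \<Rightarrow> nat" where r: "strict_mono r"
    "AE x in M. (\<lambda>k. min 1 (dist (U (r k) x) (u x))) \<longlonglongrightarrow> 0"
    using tendsto_L1_AE_subseq[of M "\<lambda>k x. min 1 (dist (U k x) (u x))"] integrable_min_dist assms(1,2) by blast
  have "AE x in M. (\<lambda>k. U (r k) x) \<longlonglongrightarrow> u x"
    using r(2)
  proof eventually_elim
    case (elim x)
    then have "eventually (\<lambda>k. min 1 (dist (U (r k) x) (u x)) < 1) sequentially"
      by (rule order_tendstoD) simp
    then have "eventually (\<lambda>k. dist (U (r k) x) (u x) = min 1 (dist (U (r k) x) (u x))) sequentially"
      by eventually_elim auto
    with elim have "(\<lambda>k. dist (U (r k) x) (u x)) \<longlonglongrightarrow> 0"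
      by (simp cong: filterlim_cong)
    then show ?case by (simp add: tendsto_dist_iff[symmetric])
  qed
  with r show ?thesis by blast
qed

text \<open>Every subsequence has a further one along which both inputs converge almost everywhere,
  so pointwise continuity of an operation is enough for continuity in measure. The hypothesis
  \<open>step\<close> is phrased along subsequences because the operation may itself depend on the
  index, for instance through a convergent sequence of group elements.\<close>

lemma meas_dist_tendsto_map2:
  fixes u :: "'a \<Rightarrow> 'b::{metric_space, second_countable_topology}"
    and u' :: "'a \<Rightarrow> 'c::{metric_space, second_countable_topology}"
    and v :: "'a \<Rightarrow> 'd::{metric_space, second_countable_topology}"
  assumes [measurable]: "\<And>k. U k \<in> borel_measurable M" "u \<in> borel_measurable M"
    "\<And>k. U' k \<in> borel_measurable M" "u' \<in> borel_measurable M"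
    "\<And>k. V k \<in> borel_measurable M" "v \<in> borel_measurable M"
    and lim: "(\<lambda>k. meas_dist M (U k) u) \<longlonglongrightarrow> 0" "(\<lambda>k. meas_dist M (U' k) u') \<longlonglongrightarrow> 0"
    and step: "\<And>(r::nat \<Rightarrow> nat) x. strict_mono r \<Longrightarrow> (\<lambda>k. U (r k) x) \<longlonglongrightarrow> u x \<Longrightarrow>
      (\<lambda>k. U' (r k) x) \<longlonglongrightarrow> u' x \<Longrightarrow> (\<lambda>k. V (r k) x) \<longlonglongrightarrow> v x"
  shows "(\<lambda>k. meas_dist M (V k) v) \<longlonglongrightarrow> 0"
proof (rule tendsto_subseqI)
  fix r :: "nat \<Rightarrow> nat" assume r: "strict_mono r"
  have "(\<lambda>k. meas_dist M (U (r k)) u) \<longlonglongrightarrow> 0"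
    using LIMSEQ_subseq_LIMSEQ[OF lim(1) r] by (simp add: o_def)
  from meas_dist_AE_subseq[OF _ _ this] obtain s :: "nat \<Rightarrow> nat" where s: "strict_mono s"
    "AE x in M. (\<lambda>k. U (r (s k)) x) \<longlonglongrightarrow> u x" by auto
  have rs: "strict_mono (r \<circ> s)" using r s by (simp add: strict_mono_o)
  have "(\<lambda>k. meas_dist M (U' (r (s k))) u') \<longlonglongrightarrow> 0"
    using LIMSEQ_subseq_LIMSEQ[OF lim(2) rs] by (simp add: o_def)
  from meas_dist_AE_subseq[OF _ _ this] obtain t :: "nat \<Rightarrow> nat" where t: "strict_mono t"
    "AE x in M. (\<lambda>k. U' (r (s (t k))) x) \<longlonglongrightarrow> u' x" by auto
  have rst: "strict_mono (\<lambda>k. r (s (t k)))" using strict_mono_o[OF rs t(1)] by (simp add: o_def)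
  have "AE x in M. (\<lambda>k. V (r (s (t k))) x) \<longlonglongrightarrow> v x"
    using s(2) t(2)
  proof eventually_elim
    case (elim x)
    have "(\<lambda>k. U (r (s (t k))) x) \<longlonglongrightarrow> u x"
      using LIMSEQ_subseq_LIMSEQ[OF elim(1) t(1)] by (simp add: o_def)
    then show ?case by (intro step[OF rst]) (use elim in auto)
  qed
  then have "(\<lambda>k. meas_dist M (V (r (s (t k)))) v) \<longlonglongrightarrow> 0"
    by (intro meas_dist_tendsto_AE) auto
  moreover have "strict_mono (s \<circ> t)" using s(1) t(1) by (rule strict_mono_o)
  ultimately show "\<exists>s::nat \<Rightarrow> nat. strict_mono s \<and> (\<lambda>k. meas_dist M (V (r (s k))) v) \<longlonglongrightarrow> 0"
    by (intro exI[of _ "s \<circ> t"]) (simp add: o_def)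
qed

lemma meas_dist_tendsto_map:
  fixes u :: "'a \<Rightarrow> 'b::{metric_space, second_countable_topology}"
    and v :: "'a \<Rightarrow> 'd::{metric_space, second_countable_topology}"
  assumes "\<And>k. U k \<in> borel_measurable M" "u \<in> borel_measurable M"
    "\<And>k. V k \<in> borel_measurable M" "v \<in> borel_measurable M"
    and "(\<lambda>k. meas_dist M (U k) u) \<longlonglongrightarrow> 0"
    and "\<And>(r::nat \<Rightarrow> nat) x. strict_mono r \<Longrightarrow> (\<lambda>k. U (r k) x) \<longlonglongrightarrow> u x \<Longrightarrow> (\<lambda>k. V (r k) x) \<longlonglongrightarrow> v x"
  shows "(\<lambda>k. meas_dist M (V k) v) \<longlonglongrightarrow> 0"
  by (rule meas_dist_tendsto_map2[of U u U u]) (use assms in auto)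

lemma meas_dist_tendsto_unique:
  fixes u v :: "'a \<Rightarrow> 'b::{metric_space, second_countable_topology}"
  assumes m: "\<And>k. U k \<in> borel_measurable M" "u \<in> borel_measurable M" "v \<in> borel_measurable M"
    and lim: "(\<lambda>k. meas_dist M (U k) u) \<longlonglongrightarrow> 0" "(\<lambda>k. meas_dist M (U k) v) \<longlonglongrightarrow> 0"
  shows "AE x in M. u x = v x"
proof -
  obtain r :: "nat \<Rightarrow> nat" where r: "strict_mono r" "AE x in M. (\<lambda>k. U (r k) x) \<longlonglongrightarrow> u x"
    using meas_dist_AE_subseq[OF m(1,2) lim(1)] by blast
  have "(\<lambda>k. meas_dist M (U (r k)) v) \<longlonglongrightarrow> 0"
    using LIMSEQ_subseq_LIMSEQ[OF lim(2) r(1)] by (simp add: o_def)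
  then obtain s :: "nat \<Rightarrow> nat" where s: "strict_mono s" "AE x in M. (\<lambda>k. U (r (s k)) x) \<longlonglongrightarrow> v x"
    using meas_dist_AE_subseq[of "\<lambda>k. U (r k)" v] m by blast
  from r(2) s(2) show ?thesis
  proof eventually_elim
    case (elim x)
    from LIMSEQ_subseq_LIMSEQ[OF elim(1) s(1)] elim(2) show ?case
      by (auto simp: o_def dest: LIMSEQ_unique)
  qed
qed

lemma meas_dist_sum_tendsto:
  fixes u :: "'i \<Rightarrow> 'a \<Rightarrow> 'b::{metric_space, second_countable_topology, topological_ab_group_add}"
  assumes "finite I" "\<And>i k. i \<in> I \<Longrightarrow> U i k \<in> borel_measurable M" "\<And>i. i \<in> I \<Longrightarrow> u i \<in> borel_measurable M"
    and "\<And>i. i \<in> I \<Longrightarrow> (\<lambda>k. meas_dist M (U i k) (u i)) \<longlonglongrightarrow> 0"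
  shows "(\<lambda>k. meas_dist M (\<lambda>x. \<Sum>i\<in>I. U i k x) (\<lambda>x. \<Sum>i\<in>I. u i x)) \<longlonglongrightarrow> 0"
  using assms
proof (induction I rule: finite_induct)
  case empty
  then show ?case by (simp add: meas_dist_def)
next
  case (insert i I)
  have IH: "(\<lambda>k. meas_dist M (\<lambda>x. \<Sum>i\<in>I. U i k x) (\<lambda>x. \<Sum>i\<in>I. u i x)) \<longlonglongrightarrow> 0"
    using insert by simp
  show ?case
  proof (rule meas_dist_tendsto_map2[OF _ _ _ _ _ _ insert.prems(3)[of i] IH])
    fix r :: "nat \<Rightarrow> nat" and x
    assume "(\<lambda>k. U i (r k) x) \<longlonglongrightarrow> u i x" "(\<lambda>k. \<Sum>i\<in>I. U i (r k) x) \<longlonglongrightarrow> (\<Sum>i\<in>I. u i x)"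
    from tendsto_add[OF this] show "(\<lambda>k. \<Sum>i\<in>insert i I. U i (r k) x) \<longlonglongrightarrow> (\<Sum>i\<in>insert i I. u i x)"
      using insert.hyps by simp
  qed (use insert.prems in \<open>auto intro!: borel_measurable_sum\<close>)
qed

end

text \<open>The truncation at 1 is harmless: once the tail sums are below 1, every increment is
  below 1 and equals its truncation.\<close>

lemma Cauchy_if_summable_dist:
  fixes f :: "nat \<Rightarrow> 'b::metric_space"
  assumes "summable (\<lambda>k. min 1 (dist (f k) (f (Suc k))))"
  shows "Cauchy f"
proof (rule metric_CauchyI)
  fix e :: real assume e: "0 < e"
  let ?a = "\<lambda>k. min 1 (dist (f k) (f (Suc k)))"
  obtain N where N: "\<And>m n. m \<ge> N \<Longrightarrow> norm (sum ?a {m..<n}) < min 1 e"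
    using assms[unfolded summable_Cauchy] e by (meson min_less_iff_conj zero_less_one)
  have le: "dist (f m) (f (m + n)) < min 1 e" if "m \<ge> N" for m n
  proof -
    have "dist (f m) (f (m + n)) \<le> sum ?a {m..<m + n}"
    proof (induction n)
      case (Suc n)
      have "sum ?a {m + n..<Suc (m + n)} < 1" using N[of "m + n" "Suc (m + n)"] that by simp
      then have "dist (f (m + n)) (f (Suc (m + n))) = ?a (m + n)" by simp
      moreover have "dist (f m) (f (m + Suc n)) \<le> dist (f m) (f (m + n)) + dist (f (m + n)) (f (Suc (m + n)))"
        using dist_triangle by simp
      ultimately show ?case using Suc by simp
    qed simp
    also have "\<dots> < min 1 e" using N[OF that, of "m + n"] by (simp add: abs_less_iff)
    finally show ?thesis .
  qed
  show "\<exists>M. \<forall>m\<ge>M. \<forall>n\<ge>M. dist (f m) (f n) < e"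
  proof (intro exI allI impI)
    fix m n assume "m \<ge> N" "n \<ge> N"
    then show "dist (f m) (f n) < e"
      using le[of m "n - m"] le[of n "m - n"] by (cases "m \<le> n") (auto simp: dist_commute)
  qed
qed

text \<open>A total limit: a sequence that is not Cauchy is replaced by the constant 0. It is thus
  always the limit of a convergent sequence, which gives measurability, also jointly in parameters.
  Being computed pointwise it preserves dependence on finitely many variables.\<close>

definition lim0 :: "(nat \<Rightarrow> 'b::{complete_space, zero}) \<Rightarrow> 'b" where
  "lim0 f = lim (\<lambda>i. if Cauchy f then f i else 0)"

lemma lim0_tendsto: "Cauchy f \<Longrightarrow> f \<longlonglongrightarrow> lim0 f"
  by (simp add: lim0_def Cauchy_convergent_iff convergent_LIMSEQ_iff)

lemma borel_measurable_lim0: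
  fixes f :: "nat \<Rightarrow> 'x \<Rightarrow> 'b::{complete_space, second_countable_topology, zero}"
  assumes [measurable]: "\<And>i. f i \<in> borel_measurable M"
  shows "(\<lambda>x. lim0 (\<lambda>i. f i x)) \<in> borel_measurable M"
proof (rule borel_measurable_LIMSEQ_metric)
  show "(\<lambda>x. if Cauchy (\<lambda>i. f i x) then f i x else 0) \<in> borel_measurable M" for i
    by measurable
  fix x
  have "convergent (\<lambda>i. if Cauchy (\<lambda>i. f i x) then f i x else 0)"
    by (cases "Cauchy (\<lambda>i. f i x)") (auto simp: Cauchy_convergent_iff convergent_const)
  then show "(\<lambda>i. if Cauchy (\<lambda>i. f i x) then f i x else 0) \<longlonglongrightarrow> lim0 (\<lambda>i. f i x)"
    by (simp add: lim0_def convergent_LIMSEQ_iff)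
qed

text \<open>The sum of the truncated increments has finite integral, hence is finite almost
  everywhere, so almost every sequence of values is Cauchy. The factor 2 is the sum of the geometric
  series of increments.\<close>

lemma (in prob_space) meas_dist_complete:
  fixes U :: "nat \<Rightarrow> 'a \<Rightarrow> 'b::{complete_space, second_countable_topology, zero}"
  assumes [measurable]: "\<And>k. U k \<in> borel_measurable M"
    and le: "\<And>k. meas_dist M (U k) (U (Suc k)) \<le> c / 2 ^ k"
  shows "meas_dist M (U k) (\<lambda>x. lim0 (\<lambda>k. U k x)) \<le> 2 * c / 2 ^ k"
proof -
  define v where "v x = lim0 (\<lambda>k. U k x)" for x
  have [measurable]: "v \<in> borel_measurable M"
    unfolding v_def by (rule borel_measurable_lim0) simp
  let ?a = "\<lambda>k x. min 1 (dist (U k x) (U (Suc k) x))"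
  have "(\<integral>\<^sup>+x. (\<Sum>k. ennreal (?a k x)) \<partial>M) = (\<Sum>k. \<integral>\<^sup>+x. ennreal (?a k x) \<partial>M)"
    by (rule nn_integral_suminf) auto
  also have "\<dots> = (\<Sum>k. ennreal (meas_dist M (U k) (U (Suc k))))"
    unfolding meas_dist_def
    by (intro suminf_cong nn_integral_eq_integral integrable_min_dist) auto
  also have "\<dots> \<le> (\<Sum>k. ennreal (c * (1 / 2) ^ k))"
  proof (intro suminf_le ennreal_leI)
    show "meas_dist M (U k) (U (Suc k)) \<le> c * (1 / 2) ^ k" for k
      using le[of k] by (simp add: power_one_over)
  qed auto
  also have "\<dots> < \<infinity>"
  proof -
    have "0 \<le> c" using le[of 0] meas_dist_nonneg[of "U 0" "U (Suc 0)"] by simp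
    then have "(\<Sum>k. ennreal (c * (1 / 2) ^ k)) = ennreal (\<Sum>k. c * (1 / 2) ^ k)"
      by (intro suminf_ennreal2 summable_mult summable_geometric) auto
    then show ?thesis by simp
  qed
  finally have "AE x in M. (\<Sum>k. ennreal (?a k x)) \<noteq> \<infinity>"
    by (intro nn_integral_PInf_AE) auto
  then have AE: "AE x in M. (\<lambda>k. U k x) \<longlonglongrightarrow> v x"
  proof eventually_elim
    case (elim x)
    then have "summable (\<lambda>k. ?a k x)"
      by (intro summable_suminf_not_top) auto
    then show ?case unfolding v_def by (intro lim0_tendsto Cauchy_if_summable_dist)
  qed
  \<comment> \<open>The subtracted term lets the induction close: adding the next increment
    \<open>c / 2 ^ (k + j)\<close> exactly halves it.\<close>
  have fin: "meas_dist M (U k) (U (k + j)) \<le> 2 * c / 2 ^ k - 2 * c / 2 ^ (k + j)" for j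
  proof (induction j)
    case 0
    then show ?case by (simp add: meas_dist_def)
  next
    case (Suc j)
    have "meas_dist M (U k) (U (k + Suc j)) \<le> meas_dist M (U k) (U (k + j)) + meas_dist M (U (k + j)) (U (k + Suc j))"
      by (rule meas_dist_triangle) auto
    also have "\<dots> \<le> (2 * c / 2 ^ k - 2 * c / 2 ^ (k + j)) + c / 2 ^ (k + j)"
      using Suc le[of "k + j"] by simp
    finally show ?case by (simp add: field_simps)
  qed
  have "(\<lambda>j. meas_dist M (U j) v) \<longlonglongrightarrow> 0"
    by (rule meas_dist_tendsto_AE) (use AE in auto)
  then have l: "(\<lambda>j. meas_dist M (U (j + k)) v) \<longlonglongrightarrow> 0"
    by (rule LIMSEQ_ignore_initial_segment)
  have "0 \<le> c" using le[of 0] meas_dist_nonneg[of "U 0" "U (Suc 0)"] by simp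
  have "meas_dist M (U k) v - 2 * c / 2 ^ k \<le> meas_dist M (U (j + k)) v" for j
    using meas_dist_triangle[of "U k" "U (k + j)" v] fin[of j] \<open>0 \<le> c\<close>
    by (simp add: add.commute) (smt (verit) divide_nonneg_nonneg zero_le_power)
  then have "meas_dist M (U k) v - 2 * c / 2 ^ k \<le> 0"
    using l by (intro LIMSEQ_le_const[OF l]) auto
  then show ?thesis unfolding v_def by simp
qed

lemma borel_measurable_uminus_group [measurable (raw)]:
  fixes f :: "'x \<Rightarrow> 'b::{second_countable_topology, topological_group_add}"
  assumes "f \<in> borel_measurable M"
  shows "(\<lambda>x. - f x) \<in> borel_measurable M"
  using assms by (rule borel_measurable_continuous_on[rotated]) (intro continuous_intros)

lemma borel_measurable_diff_group [measurable (raw)]: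
  fixes f :: "'x \<Rightarrow> 'b::{second_countable_topology, topological_group_add}"
  assumes [measurable]: "f \<in> borel_measurable M" "g \<in> borel_measurable M"
  shows "(\<lambda>x. f x - g x) \<in> borel_measurable M"
  unfolding diff_conv_add_uminus by measurable

section \<open>Quasi-invariant probability measures\<close>

text \<open>The condition on bounded functions says that the left translates of the measure by a
  convergent sequence of group elements are uniformly absolutely continuous.\<close>

locale quasi_invariant = prob_space L
  for L :: "'g::{topological_group_add, t2_space, second_countable_topology} measure" +
  assumes sets_L: "sets L = sets borel"
    and open_pos: "\<And>U. open U \<Longrightarrow> U \<noteq> {} \<Longrightarrow> emeasure L U > 0"
    and completely_regular: "completely_regular_space (euclidean :: 'g topology)"
    and translate_tendsto_0: "\<And>\<gamma> g \<phi>. \<gamma> \<longlonglongrightarrow> g \<Longrightarrow> (\<And>k. \<phi> k \<in> borel_measurable borel) \<Longrightarrow>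
      (\<And>k x. 0 \<le> \<phi> k x \<and> \<phi> k x \<le> (1::real)) \<Longrightarrow> (\<lambda>k::nat. \<integral>x. \<phi> k x \<partial>L) \<longlonglongrightarrow> 0 \<Longrightarrow>
      (\<lambda>k. \<integral>x. \<phi> k (\<gamma> k + x) \<partial>L) \<longlonglongrightarrow> 0"
    and AE_right_translate: "\<And>Q t. AE x in L. Q x \<Longrightarrow> AE x in L. Q (x + t)"
begin

lemma space_L [simp]: "space L = UNIV"
  using sets_eq_imp_space_eq[OF sets_L] by simp

lemma measurable_L [simp]: "measurable L M = measurable borel M" "measurable M L = measurable M borel"
  by (rule measurable_cong_sets; simp add: sets_L)+

lemma integrable_bounded_L:
  fixes \<phi> :: "'g \<Rightarrow> real"
  assumes "\<phi> \<in> borel_measurable borel" "\<And>x. \<bar>\<phi> x\<bar> \<le> B"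
  shows "integrable L \<phi>"
  by (rule integrable_const_bound[of _ B]) (use assms in auto)

section \<open>Continuity of left translation in measure\<close>

abbreviation "trans_cont E \<equiv> \<forall>\<eta>. \<eta> \<longlonglongrightarrow> (0::'g) \<longrightarrow>
  (\<lambda>k. \<integral>x. \<bar>indicator E (\<eta> k + x) - indicator E x\<bar> \<partial>L) \<longlonglongrightarrow> (0::real)"

text \<open>The symmetric difference splits into points leaving \<open>W\<close> and points entering
  it. Since \<open>W\<close> is open, a given point of \<open>W\<close> eventually stays in it, so
  the leaving part vanishes by dominated convergence. The entering part is the translate of the
  points that leave under the inverse translation, and uniform absolute continuity of the translates
  makes it vanish too.\<close>

lemma trans_cont_open:
  assumes W: "open W" and \<eta>: "\<eta> \<longlonglongrightarrow> (0::'g)"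
  shows "(\<lambda>k. \<integral>x. \<bar>indicator W (\<eta> k + x) - indicator W x\<bar> \<partial>L) \<longlonglongrightarrow> (0::real)"
proof -
  have [measurable]: "W \<in> sets borel" using W by simp
  have ev: "eventually (\<lambda>k. \<eta> k + x \<in> W) sequentially" "eventually (\<lambda>k. - \<eta> k + x \<in> W) sequentially"
    if "x \<in> W" for x
  proof -
    have "(\<lambda>k. \<eta> k + x) \<longlonglongrightarrow> 0 + x" "(\<lambda>k. - \<eta> k + x) \<longlonglongrightarrow> - 0 + x"
      by (intro tendsto_intros \<eta>)+
    with W that show "eventually (\<lambda>k. \<eta> k + x \<in> W) sequentially" "eventually (\<lambda>k. - \<eta> k + x \<in> W) sequentially"
      by (auto dest: topological_tendstoD)
  qed
  define f where "f k x = (indicator W x * (1 - indicator W (\<eta> k + x)) :: real)" for k x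
  define h where "h k x = (indicator W x * (1 - indicator W (- \<eta> k + x)) :: real)" for k x
  have [measurable]: "f k \<in> borel_measurable borel" "h k \<in> borel_measurable borel" for k
    unfolding f_def h_def by measurable
  have bd: "0 \<le> f k x \<and> f k x \<le> 1" "0 \<le> h k x \<and> h k x \<le> 1" for k x
    unfolding f_def h_def by (auto simp: indicator_def)
  have "(\<lambda>k. \<integral>x. f k x \<partial>L) \<longlonglongrightarrow> (\<integral>x. 0 \<partial>L)" "(\<lambda>k. \<integral>x. h k x \<partial>L) \<longlonglongrightarrow> (\<integral>x. 0 \<partial>L)"
  proof (rule_tac [!] integral_dominated_convergence[where w = "\<lambda>_. 1"])
    show "AE x in L. (\<lambda>k. f k x) \<longlonglongrightarrow> 0"
    proof (intro AE_I2)
      fix x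
      show "(\<lambda>k. f k x) \<longlonglongrightarrow> 0"
      proof (cases "x \<in> W")
        case True
        have "eventually (\<lambda>k. f k x = 0) sequentially"
          using ev(1)[OF True] by eventually_elim (simp add: f_def)
        then show ?thesis by (rule tendsto_eventually)
      qed (simp add: f_def)
    qed
    show "AE x in L. (\<lambda>k. h k x) \<longlonglongrightarrow> 0"
    proof (intro AE_I2)
      fix x
      show "(\<lambda>k. h k x) \<longlonglongrightarrow> 0"
      proof (cases "x \<in> W")
        case True
        have "eventually (\<lambda>k. h k x = 0) sequentially"
          using ev(2)[OF True] by eventually_elim (simp add: h_def)
        then show ?thesis by (rule tendsto_eventually)
      qed (simp add: h_def)
    qed
  qed (use bd in auto)
  then have f: "(\<lambda>k. \<integral>x. f k x \<partial>L) \<longlonglongrightarrow> 0" and h0: "(\<lambda>k. \<integral>x. h k x \<partial>L) \<longlonglongrightarrow> 0" by auto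
  have h: "(\<lambda>k. \<integral>x. h k (\<eta> k + x) \<partial>L) \<longlonglongrightarrow> 0"
    by (rule translate_tendsto_0[OF \<eta> _ _ h0]) (use bd in auto)
  have "(\<integral>x. \<bar>indicator W (\<eta> k + x) - indicator W x\<bar> \<partial>L) = (\<integral>x. f k x \<partial>L) + (\<integral>x. h k (\<eta> k + x) \<partial>L)" for k
  proof -
    have "(\<integral>x. f k x \<partial>L) + (\<integral>x. h k (\<eta> k + x) \<partial>L) = (\<integral>x. f k x + h k (\<eta> k + x) \<partial>L)"
      by (rule Bochner_Integration.integral_add[symmetric]; rule integrable_bounded_L[of _ 1])
         (use bd in \<open>auto simp: abs_le_iff intro: order_trans[of _ 0]\<close>)
    also have "(\<lambda>x. f k x + h k (\<eta> k + x)) = (\<lambda>x. \<bar>indicator W (\<eta> k + x) - indicator W x\<bar>)"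
      by (auto simp: f_def h_def indicator_def add.assoc[symmetric])
    finally show ?thesis by simp
  qed
  then show ?thesis using tendsto_add[OF f h] by simp
qed

text \<open>If no index worked, each \<open>N\<close> would have a bad translate with index at least
  \<open>N\<close>; these translates still converge to \<open>g\<close>, contradicting the limit
  condition on translates. The gain is that one \<open>N\<close> serves all late translates at
  once.\<close>

lemma translate_unif:
  assumes \<eta>: "\<eta> \<longlonglongrightarrow> (g::'g)" and [measurable]: "\<And>N. \<phi> N \<in> borel_measurable borel"
    and bd: "\<And>N x. 0 \<le> \<phi> N x \<and> \<phi> N x \<le> (1::real)" and l: "(\<lambda>N::nat. \<integral>x. \<phi> N x \<partial>L) \<longlonglongrightarrow> 0" and e: "0 < e"
  shows "\<exists>N. (\<integral>x. \<phi> N x \<partial>L) < e \<and> (\<forall>k\<ge>N. (\<integral>x. \<phi> N (\<eta> k + x) \<partial>L) < e)"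
proof (rule ccontr)
  assume *: "\<not> ?thesis"
  have "\<exists>k\<ge>N. (\<integral>x. \<phi> N x \<partial>L) < e \<longrightarrow> e \<le> (\<integral>x. \<phi> N (\<eta> k + x) \<partial>L)" for N
    using * by (metis not_less order_refl)
  then obtain \<kappa> where \<kappa>: "\<And>N. \<kappa> N \<ge> N" "\<And>N. (\<integral>x. \<phi> N x \<partial>L) < e \<Longrightarrow> e \<le> (\<integral>x. \<phi> N (\<eta> (\<kappa> N) + x) \<partial>L)"
    by metis
  have "filterlim \<kappa> at_top sequentially"
    using \<kappa>(1) by (intro filterlim_at_top_mono[OF filterlim_ident]) auto
  then have "(\<lambda>N. \<eta> (\<kappa> N)) \<longlonglongrightarrow> g"
    using filterlim_compose[OF \<eta>] by blast
  then have "(\<lambda>N. \<integral>x. \<phi> N (\<eta> (\<kappa> N) + x) \<partial>L) \<longlonglongrightarrow> 0"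
    by (rule translate_tendsto_0) (use bd l in auto)
  then have "eventually (\<lambda>N. (\<integral>x. \<phi> N (\<eta> (\<kappa> N) + x) \<partial>L) < e) sequentially"
    using e by (rule order_tendstoD)
  moreover have "eventually (\<lambda>N. (\<integral>x. \<phi> N x \<partial>L) < e) sequentially"
    using l e by (rule order_tendstoD)
  ultimately have "eventually (\<lambda>N. False) sequentially"
    by eventually_elim (use \<kappa>(2) in \<open>force simp: not_less\<close>)
  then show False by simp
qed

text \<open>Open sets are stable under intersection and generate, so complements and disjoint unions
  remain. A disjoint union is cut off after finitely many members, the rest being small uniformly
  over the translates.\<close>

lemma trans_cont_borel:
  assumes "E \<in> sets (borel :: 'g measure)"
  shows "trans_cont E"
proof -
  let ?G = "{S :: 'g set. open S}"
  have "Int_stable ?G" by (auto simp: Int_stable_def)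
  moreover have "?G \<subseteq> Pow UNIV" by simp
  moreover have "E \<in> sigma_sets UNIV ?G" using assms by (simp add: borel_def)
  ultimately show ?thesis
  proof (induction rule: sigma_sets_induct_disjoint)
    case (basic A)
    then show ?case using trans_cont_open by auto
  next
    case empty
    then show ?case by simp
  next
    case (compl A)
    have "indicator (UNIV - A) x = (1::real) - indicator A x" for x :: 'g by (simp add: indicator_def)
    then show ?case using compl(2) by (simp add: abs_minus_commute)
  next
    case (union A)
    have [measurable]: "A i \<in> sets borel" for i using union(2) by (auto simp: borel_def)
    show ?case
    proof (intro allI impI LIMSEQ_I)
      fix \<eta> :: "nat \<Rightarrow> 'g" and e :: real assume \<eta>: "\<eta> \<longlonglongrightarrow> 0" and e: "0 < e"
      define B where "B N = (\<Union>i. A i) - (\<Union>i<N. A i)" for N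
      define \<phi> where "\<phi> N x = (indicator (B N) x :: real)" for N x
      have [measurable]: "B N \<in> sets borel" for N unfolding B_def by measurable
      have [measurable]: "\<phi> N \<in> borel_measurable borel" for N unfolding \<phi>_def by measurable
      have bd: "0 \<le> \<phi> N x \<and> \<phi> N x \<le> 1" for N x by (simp add: \<phi>_def)
      have "(\<lambda>N. \<integral>x. \<phi> N x \<partial>L) \<longlonglongrightarrow> (\<integral>x. 0 \<partial>L)"
      proof (rule integral_dominated_convergence[where w = "\<lambda>_. 1"])
        show "AE x in L. (\<lambda>N. \<phi> N x) \<longlonglongrightarrow> 0"
        proof (intro AE_I2)
          fix x
          show "(\<lambda>N. \<phi> N x) \<longlonglongrightarrow> 0"
          proof (cases "\<exists>i. x \<in> A i")
            case True
            then obtain i where "x \<in> A i" by blast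
            then have "\<forall>N\<ge>Suc i. \<phi> N x = 0" unfolding \<phi>_def B_def by (auto simp: indicator_def)
            then show ?thesis by (intro tendsto_eventually) (auto simp: eventually_sequentially)
          qed (simp add: \<phi>_def B_def)
        qed
      qed (use bd in auto)
      then have "(\<lambda>N. \<integral>x. \<phi> N x \<partial>L) \<longlonglongrightarrow> 0" by simp
      \<comment> \<open>One quarter for the remainder of the union, one quarter for its translate,
        and one half for the finitely many members kept.\<close>
      from translate_unif[OF \<eta> _ bd this, of "e / 4"] e obtain N where
        N: "(\<integral>x. \<phi> N x \<partial>L) < e / 4" "\<And>k. k \<ge> N \<Longrightarrow> (\<integral>x. \<phi> N (\<eta> k + x) \<partial>L) < e / 4" by auto
      let ?D = "\<lambda>E k x. \<bar>indicator E (\<eta> k + x) - indicator E x :: real\<bar>"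
      have "(\<lambda>k. \<Sum>i<N. \<integral>x. ?D (A i) k x \<partial>L) \<longlonglongrightarrow> (\<Sum>i<N. 0)"
        using union(3) \<eta> by (intro tendsto_sum) auto
      then have "eventually (\<lambda>k. (\<Sum>i<N. \<integral>x. ?D (A i) k x \<partial>L) < e / 2) sequentially"
        using e by (intro order_tendstoD(2)[of _ 0]) auto
      then obtain K where K: "\<And>k. k \<ge> K \<Longrightarrow> (\<Sum>i<N. \<integral>x. ?D (A i) k x \<partial>L) < e / 2"
        by (auto simp: eventually_sequentially)
      have int: "integrable L (\<lambda>x. ?D E k x)" if "E \<in> sets borel" for E k
        by (rule integrable_bounded_L[of _ 1]) (use that in \<open>auto simp: indicator_def\<close>)
      have "(\<integral>x. ?D (\<Union>i. A i) k x \<partial>L) < e" if k: "k \<ge> max N K" for k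
      proof -
        have le: "?D (\<Union>i. A i) k x \<le> \<phi> N (\<eta> k + x) + \<phi> N x + (\<Sum>i<N. ?D (A i) k x)" for x
        proof -
          have eq: "indicator (\<Union>i. A i) y = (\<phi> N y + (\<Sum>i<N. indicator (A i) y) :: real)" for y
          proof -
            have "disjoint_family_on A {..<N}" using union(1) by (auto simp: disjoint_family_on_def)
            then have "indicator (\<Union>i<N. A i) y = (\<Sum>i<N. indicator (A i) y :: real)"
              by (intro indicator_UN_disjoint) auto
            moreover have "indicator (\<Union>i. A i) y = (\<phi> N y + indicator (\<Union>i<N. A i) y :: real)"
              unfolding \<phi>_def B_def by (auto simp: indicator_def)
            ultimately show ?thesis by simp
          qed
          have "\<bar>(\<Sum>i<N. indicator (A i) (\<eta> k + x)) - (\<Sum>i<N. indicator (A i) x :: real)\<bar> \<le> (\<Sum>i<N. ?D (A i) k x)"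
            unfolding sum_subtractf[symmetric] by (rule sum_abs)
          then show ?thesis unfolding eq using bd[of N x] bd[of N "\<eta> k + x"] by linarith
        qed
        have int': "integrable L (\<phi> N)" "integrable L (\<lambda>x. \<phi> N (\<eta> k + x))"
          by (rule integrable_bounded_L[of _ 1]; use bd in auto)+
        have "(\<integral>x. ?D (\<Union>i. A i) k x \<partial>L) \<le> (\<integral>x. \<phi> N (\<eta> k + x) + \<phi> N x + (\<Sum>i<N. ?D (A i) k x) \<partial>L)"
          by (intro integral_mono[OF _ _ le] int Bochner_Integration.integrable_add Bochner_Integration.integrable_sum int') measurable
        also have "\<dots> = (\<integral>x. \<phi> N (\<eta> k + x) \<partial>L) + (\<integral>x. \<phi> N x \<partial>L) + (\<Sum>i<N. \<integral>x. ?D (A i) k x \<partial>L)"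
          by (simp add: int int')
        also have "\<dots> < e" using N(1) N(2)[of k] k K[of k] by simp
        finally show ?thesis .
      qed
      then show "\<exists>no. \<forall>k\<ge>no. norm ((\<integral>x. ?D (\<Union>i. A i) k x \<partial>L) - 0) < e"
        by (intro exI[of _ "max N K"]) (auto simp: abs_less_iff intro: le_less_trans[of _ 0])
    qed
  qed
qed

text \<open>By separability of the target, all but little of the mass is sent into finitely many
  balls of radius \<open>e / 6\<close>. If a point and its translate have values in the same ball,
  these differ by less than \<open>e / 3\<close>; otherwise the indicator of some preimage jumps,
  which is rare by continuity of translation on Borel sets.\<close>

lemma translate_cont:
  fixes u :: "'g \<Rightarrow> 'b::{metric_space, second_countable_topology}"
  assumes [measurable]: "u \<in> borel_measurable borel" and \<gamma>: "\<gamma> \<longlonglongrightarrow> g"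
  shows "(\<lambda>k. meas_dist L (\<lambda>x. u (\<gamma> k + x)) (\<lambda>x. u (g + x))) \<longlonglongrightarrow> 0"
proof -
  \<comment> \<open>Absorbing \<open>g\<close> into the function reduces the claim to translations
    tending to the identity.\<close>
  define v where "v x = u (g + x)" for x
  define \<eta> where "\<eta> k = - g + \<gamma> k" for k
  have [measurable]: "v \<in> borel_measurable borel" unfolding v_def by measurable
  have "\<eta> \<longlonglongrightarrow> - g + g" unfolding \<eta>_def by (intro tendsto_intros \<gamma>)
  then have \<eta>: "\<eta> \<longlonglongrightarrow> 0" by simp
  have uv: "u (\<gamma> k + x) = v (\<eta> k + x)" "u (g + x) = v x" for k x
    by (simp_all add: v_def \<eta>_def add.assoc[symmetric])
  have "(\<lambda>k. meas_dist L (\<lambda>x. v (\<eta> k + x)) v) \<longlonglongrightarrow> 0"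
  proof (rule LIMSEQ_I)
    fix e :: real assume e: "0 < e"
    obtain D :: "'b set" where D: "countable D" "\<And>X. open X \<Longrightarrow> X \<noteq> {} \<Longrightarrow> \<exists>x\<in>D. x \<in> X"
      using countable_dense_exists by blast
    then have "D \<noteq> {}" using D(2)[of UNIV] by auto
    define d where "d = from_nat_into D"
    have d: "\<exists>i. d i \<in> X" if "open X" "X \<noteq> {}" for X
      using D(2)[OF that] from_nat_into_surj[OF D(1)] unfolding d_def by metis
    define E where "E i = v -` ball (d i) (e / 6)" for i
    have [measurable]: "E i \<in> sets borel" for i
      unfolding E_def using measurable_sets_borel[of v borel "ball (d i) (e/6)"] by simp
    define \<phi> where "\<phi> N x = (indicator (- (\<Union>i<N. E i)) x :: real)" for N x
    have [measurable]: "\<phi> N \<in> borel_measurable borel" for N unfolding \<phi>_def by measurable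
    have bd: "0 \<le> \<phi> N x \<and> \<phi> N x \<le> 1" for N x by (simp add: \<phi>_def)
    have "(\<lambda>N. \<integral>x. \<phi> N x \<partial>L) \<longlonglongrightarrow> (\<integral>x. 0 \<partial>L)"
    proof (rule integral_dominated_convergence[where w = "\<lambda>_. 1"])
      show "AE x in L. (\<lambda>N. \<phi> N x) \<longlonglongrightarrow> 0"
      proof (intro AE_I2)
        fix x
        obtain i where "d i \<in> ball (v x) (e / 6)" using d[of "ball (v x) (e/6)"] e by auto
        then have "x \<in> E i" by (simp add: E_def dist_commute)
        then have "\<forall>N\<ge>Suc i. \<phi> N x = 0" unfolding \<phi>_def by (auto simp: indicator_def)
        then show "(\<lambda>N. \<phi> N x) \<longlonglongrightarrow> 0"
          by (intro tendsto_eventually) (auto simp: eventually_sequentially)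
      qed
    qed (use bd in auto)
    then have "(\<lambda>N. \<integral>x. \<phi> N x \<partial>L) \<longlonglongrightarrow> 0" by simp
    then have "eventually (\<lambda>N. (\<integral>x. \<phi> N x \<partial>L) < e / 3) sequentially"
      using e by (intro order_tendstoD(2)[of _ 0]) auto
    then obtain N where N: "(\<integral>x. \<phi> N x \<partial>L) < e / 3" by (auto simp: eventually_sequentially)
    let ?D = "\<lambda>E k x. \<bar>indicator E (\<eta> k + x) - indicator E x :: real\<bar>"
    have "(\<lambda>k. \<Sum>i<N. \<integral>x. ?D (E i) k x \<partial>L) \<longlonglongrightarrow> (\<Sum>i<N. 0)"
      using trans_cont_borel \<eta> by (intro tendsto_sum) auto
    then have "eventually (\<lambda>k. (\<Sum>i<N. \<integral>x. ?D (E i) k x \<partial>L) < e / 3) sequentially"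
      using e by (intro order_tendstoD(2)[of _ 0]) auto
    then obtain K where K: "\<And>k. k \<ge> K \<Longrightarrow> (\<Sum>i<N. \<integral>x. ?D (E i) k x \<partial>L) < e / 3"
      by (auto simp: eventually_sequentially)
    have "meas_dist L (\<lambda>x. v (\<eta> k + x)) v < e" if "k \<ge> K" for k
    proof -
      have le: "min 1 (dist (v (\<eta> k + x)) (v x)) \<le> e / 3 + \<phi> N x + (\<Sum>i<N. ?D (E i) k x)" for x
      proof (cases "\<exists>i<N. x \<in> E i")
        case True
        then obtain i where i: "i < N" "x \<in> E i" by blast
        show ?thesis
        proof (cases "\<eta> k + x \<in> E i")
          case True
          then have "dist (d i) (v (\<eta> k + x)) < e / 6" "dist (d i) (v x) < e / 6" using i by (auto simp: E_def)
          then have "dist (v (\<eta> k + x)) (v x) < e / 3"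
            using dist_triangle3[of "v (\<eta> k + x)" "v x" "d i"] by simp
          moreover have "0 \<le> (\<Sum>i<N. ?D (E i) k x)" by (rule sum_nonneg) simp
          ultimately show ?thesis using bd[of N x] by linarith
        next
          case False
          with i have "1 = ?D (E i) k x" by simp
          also have "\<dots> \<le> (\<Sum>i<N. ?D (E i) k x)" by (rule member_le_sum) (use i in auto)
          finally show ?thesis using bd[of N x] e by linarith
        qed
      next
        case False
        then have "\<phi> N x = 1" by (simp add: \<phi>_def)
        moreover have "0 \<le> (\<Sum>i<N. ?D (E i) k x)" by (rule sum_nonneg) simp
        ultimately show ?thesis using e by linarith
      qed
      have int: "integrable L (\<lambda>x. ?D (E i) k x)" for i
        by (rule integrable_bounded_L[of _ 1]) (auto simp: indicator_def)
      have int': "integrable L (\<phi> N)" by (rule integrable_bounded_L[of _ 1]; use bd in auto)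
      have "meas_dist L (\<lambda>x. v (\<eta> k + x)) v \<le> (\<integral>x. e / 3 + \<phi> N x + (\<Sum>i<N. ?D (E i) k x) \<partial>L)"
        unfolding meas_dist_def
        by (intro integral_mono le integrable_min_dist Bochner_Integration.integrable_add Bochner_Integration.integrable_sum int int')
           auto
      also have "\<dots> = e / 3 + (\<integral>x. \<phi> N x \<partial>L) + (\<Sum>i<N. \<integral>x. ?D (E i) k x \<partial>L)"
        by (simp add: int int' prob_space[simplified])
      also have "\<dots> < e" using N K[OF that] by simp
      finally show ?thesis .
    qed
    then show "\<exists>no. \<forall>k\<ge>no. norm (meas_dist L (\<lambda>x. v (\<eta> k + x)) v - 0) < e"
      by (intro exI[of _ K]) (simp add: abs_of_nonneg meas_dist_nonneg)
  qed
  then show ?thesis by (simp add: uv)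
qed

end

section \<open>Sequences in the group\<close>

lemma tendsto_fun_iff:
  fixes X :: "'k \<Rightarrow> 'i \<Rightarrow> 'b::topological_space"
  shows "(X \<longlongrightarrow> x) F \<longleftrightarrow> (\<forall>i. ((\<lambda>k. X k i) \<longlongrightarrow> x i) F)"
proof -
  have "(X \<longlongrightarrow> x) F \<longleftrightarrow> limitin (product_topology (\<lambda>i. euclidean) UNIV) X x F"
    by (simp add: euclidean_product_topology)
  also have "\<dots> \<longleftrightarrow> (\<forall>i. ((\<lambda>k. X k i) \<longlongrightarrow> x i) F)"
    unfolding limitin_componentwise by simp
  finally show ?thesis .
qed

definition translate :: "'g::group_add \<Rightarrow> (nat \<Rightarrow> 'g) \<Rightarrow> (nat \<Rightarrow> 'g)" where
  "translate g x = (\<lambda>i. g + x i)"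

text \<open>Translating infinitely many coordinates can make an infinite product measure singular to
  itself. Moving only the first \<open>n\<close> keeps null sets null, and a function of
  \<open>n\<close> variables cannot tell the difference.\<close>

definition translate_upto :: "nat \<Rightarrow> 'g::group_add \<Rightarrow> (nat \<Rightarrow> 'g) \<Rightarrow> (nat \<Rightarrow> 'g)" where
  "translate_upto n g x = (\<lambda>i. if i < n then g + x i else x i)"

definition face :: "nat \<Rightarrow> (nat \<Rightarrow> 'g) \<Rightarrow> (nat \<Rightarrow> 'g)" where
  "face i x = (\<lambda>j. if j < i then x j else x (Suc j))"

definition depends_upto :: "nat \<Rightarrow> ((nat \<Rightarrow> 'g) \<Rightarrow> 'b) \<Rightarrow> bool" where
  "depends_upto n F \<longleftrightarrow> (\<forall>x y. (\<forall>i<n. x i = y i) \<longrightarrow> F x = F y)"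

lemma depends_uptoD: "depends_upto n F \<Longrightarrow> (\<And>i. i < n \<Longrightarrow> x i = y i) \<Longrightarrow> F x = F y"
  by (auto simp: depends_upto_def)

lemma translate_upto_Suc: "translate_upto (Suc n) g x = translate_upto n g (x(n := g + x n))"
  by (auto simp: translate_upto_def fun_eq_iff less_Suc_eq)

lemma depends_upto_translate: "depends_upto n F \<Longrightarrow> F (translate g x) = F (translate_upto n g x)"
  by (rule depends_uptoD) (auto simp: translate_def translate_upto_def)

lemma measurable_fun_upd [measurable (raw)]:
  fixes f :: "'x \<Rightarrow> nat \<Rightarrow> 'b::second_countable_topology"
  assumes [measurable]: "f \<in> borel_measurable M" "h \<in> borel_measurable M"
  shows "(\<lambda>x. (f x)(i := h x)) \<in> borel_measurable M"
proof (rule measurable_coordinatewise_then_product)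
  fix j
  have [measurable]: "(\<lambda>x. f x j) \<in> borel_measurable M" by (rule measurable_product_then_coordinatewise) simp
  show "(\<lambda>x. ((f x)(i := h x)) j) \<in> borel_measurable M" by (cases "j = i") simp_all
qed

lemma measurable_translate [measurable (raw)]:
  fixes f :: "'x \<Rightarrow> nat \<Rightarrow> 'b::{second_countable_topology, topological_group_add}"
  assumes [measurable]: "f \<in> borel_measurable M" "h \<in> borel_measurable M"
  shows "(\<lambda>x. translate (h x) (f x)) \<in> borel_measurable M"
proof (rule measurable_coordinatewise_then_product)
  fix j
  have [measurable]: "(\<lambda>x. f x j) \<in> borel_measurable M" by (rule measurable_product_then_coordinatewise) simp
  show "(\<lambda>x. translate (h x) (f x) j) \<in> borel_measurable M" by (simp add: translate_def)
qed

lemma measurable_translate_upto [measurable (raw)]: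
  fixes f :: "'x \<Rightarrow> nat \<Rightarrow> 'b::{second_countable_topology, topological_group_add}"
  assumes [measurable]: "f \<in> borel_measurable M" "h \<in> borel_measurable M"
  shows "(\<lambda>x. translate_upto n (h x) (f x)) \<in> borel_measurable M"
proof (rule measurable_coordinatewise_then_product)
  fix j
  have [measurable]: "(\<lambda>x. f x j) \<in> borel_measurable M" by (rule measurable_product_then_coordinatewise) simp
  show "(\<lambda>x. translate_upto n (h x) (f x) j) \<in> borel_measurable M" by (simp add: translate_upto_def)
qed

lemma measurable_face [measurable (raw)]:
  fixes f :: "'x \<Rightarrow> nat \<Rightarrow> 'b::second_countable_topology"
  assumes [measurable]: "f \<in> borel_measurable M"
  shows "(\<lambda>x. face i (f x)) \<in> borel_measurable M"
proof (rule measurable_coordinatewise_then_product)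
  fix j
  have [measurable]: "(\<lambda>x. f x j) \<in> borel_measurable M" for j by (rule measurable_product_then_coordinatewise) simp
  show "(\<lambda>x. face i (f x) j) \<in> borel_measurable M" by (simp add: face_def)
qed

lemma measurable_comb_seq_borel [measurable (raw)]:
  fixes f :: "'x \<Rightarrow> nat \<Rightarrow> 'b::second_countable_topology"
  assumes [measurable]: "f \<in> borel_measurable M" "h \<in> borel_measurable M"
  shows "(\<lambda>x. comb_seq i (f x) (h x)) \<in> borel_measurable M"
proof (rule measurable_coordinatewise_then_product)
  fix j
  have [measurable]: "(\<lambda>x. f x j) \<in> borel_measurable M" "(\<lambda>x. h x j) \<in> borel_measurable M" for j
    by (rule measurable_product_then_coordinatewise; simp)+
  show "(\<lambda>x. comb_seq i (f x) (h x) j) \<in> borel_measurable M" by (simp add: comb_seq_def)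
qed

section \<open>Fubini, translations and faces in the infinite product\<close>

context quasi_invariant
begin

sublocale seq: sequence_space L ..

abbreviation P :: "(nat \<Rightarrow> 'g) measure" where "P \<equiv> PiM UNIV (\<lambda>_. L)"

lemma sets_P: "sets P = sets borel"
proof -
  have "sets P = sets (PiM UNIV (\<lambda>_::nat. borel :: 'g measure))"
    by (rule sets_PiM_cong) (simp_all add: sets_L)
  then show ?thesis by (simp add: sets_PiM_equal_borel)
qed

lemma space_P [simp]: "space P = UNIV"
  using sets_eq_imp_space_eq[OF sets_P] by simp

lemma measurable_P [simp]: "measurable P M = measurable borel M" "measurable M P = measurable M borel"
  by (rule measurable_cong_sets; simp add: sets_P)+

lemma measurable_pair_L [simp]:
  "measurable (L \<Otimes>\<^sub>M P) M = measurable (borel \<Otimes>\<^sub>M borel) M"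
  "measurable (P \<Otimes>\<^sub>M P) M = measurable (borel \<Otimes>\<^sub>M borel) M"
  "measurable (P \<Otimes>\<^sub>M L) M = measurable (borel \<Otimes>\<^sub>M borel) M"
  by (rule measurable_cong_sets; simp add: sets_P sets_L cong: sets_pair_measure_cong)+

sublocale LP: pair_prob_space L P ..

sublocale PPP: pair_prob_space P P ..

lemma distr_upd: "distr (L \<Otimes>\<^sub>M P) P (\<lambda>(t, x). x(i := t)) = P"
proof (rule seq.PiM_eq)
  let ?f = "\<lambda>(t, x). (x :: nat \<Rightarrow> 'g)(i := t)"
  have [measurable]: "?f \<in> measurable (L \<Otimes>\<^sub>M P) P"
    by simp
  fix J and E :: "nat \<Rightarrow> 'g set"
  assume J: "finite J" "J \<subseteq> UNIV" "\<And>j. j \<in> J \<Longrightarrow> E j \<in> sets L"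
  let ?X = "prod_emb UNIV (\<lambda>_. L) J (\<Pi>\<^sub>E j\<in>J. E j)"
  let ?E = "if i \<in> J then E i else UNIV" and ?F = "prod_emb UNIV (\<lambda>_. L) (J - {i}) (\<Pi>\<^sub>E j\<in>J - {i}. E j)"
  have mF: "?F \<in> sets P" by (rule sets_PiM_I) (use J in auto)
  have mX: "?X \<in> sets P" by (rule sets_PiM_I) (use J in auto)
  have mE: "?E \<in> sets L" using J by (auto simp: sets_L)
  have "?f -` ?X \<inter> space (L \<Otimes>\<^sub>M P) = ?E \<times> ?F"
    by (auto simp: space_pair_measure prod_emb_def PiE_iff split: if_splits)
  then have "emeasure (distr (L \<Otimes>\<^sub>M P) P ?f) ?X = emeasure (L \<Otimes>\<^sub>M P) (?E \<times> ?F)"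
    by (subst emeasure_distr) (use mX in auto)
  also have "\<dots> = emeasure L ?E * emeasure P ?F"
    using mE mF by (rule seq.P.emeasure_pair_measure_Times)
  also have "emeasure P ?F = (\<Prod>j\<in>J - {i}. emeasure L (E j))"
    using J by (intro seq.emeasure_PiM_emb) auto
  also have "emeasure L ?E * \<dots> = (\<Prod>j\<in>J. emeasure L (E j))"
    using J(1) emeasure_space_1 by (cases "i \<in> J") (auto simp: prod.remove)
  finally show "emeasure (distr (L \<Otimes>\<^sub>M P) P ?f) ?X = (\<Prod>j\<in>J. emeasure L (E j))" .
qed simp

lemma AE_upd:
  assumes "AE x in P. Q x"
  shows "AE t in L. AE x in P. Q (x(i := t))"
proof -
  have "AE x in distr (L \<Otimes>\<^sub>M P) P (\<lambda>(t, x). x(i := t)). Q x"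
    using assms by (simp only: distr_upd)
  then have "AE z in L \<Otimes>\<^sub>M P. Q (case z of (t, x) \<Rightarrow> x(i := t))"
    by (rule AE_distrD[rotated]) simp
  from LP.AE_pair[OF this] show ?thesis by simp
qed

lemma integrable_bounded_P:
  fixes \<phi> :: "(nat \<Rightarrow> 'g) \<Rightarrow> real"
  assumes "\<phi> \<in> borel_measurable borel" "\<And>x. \<bar>\<phi> x\<bar> \<le> B"
  shows "integrable P \<phi>"
  by (rule seq.P.integrable_const_bound[of _ B]) (use assms in auto)

lemma integral_upd:
  fixes \<phi> :: "(nat \<Rightarrow> 'g) \<Rightarrow> real"
  assumes [measurable]: "\<phi> \<in> borel_measurable borel" and "\<And>x. \<bar>\<phi> x\<bar> \<le> B"
  shows "(\<integral>x. \<phi> x \<partial>P) = (\<integral>t. \<integral>x. \<phi> (x(i := t)) \<partial>P \<partial>L)"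
    and "(\<integral>x. \<phi> x \<partial>P) = (\<integral>x. \<integral>t. \<phi> (x(i := t)) \<partial>L \<partial>P)"
proof -
  have int: "integrable (L \<Otimes>\<^sub>M P) (\<lambda>(t, x). \<phi> (x(i := t)))"
    by (rule LP.P.integrable_const_bound[of _ B]) (use assms in auto)
  have "(\<integral>x. \<phi> x \<partial>P) = (\<integral>x. \<phi> x \<partial>distr (L \<Otimes>\<^sub>M P) P (\<lambda>(t, x). x(i := t)))"
    by (simp only: distr_upd)
  also have "\<dots> = (\<integral>z. (case z of (t, x) \<Rightarrow> \<phi> (x(i := t))) \<partial>(L \<Otimes>\<^sub>M P))"
    by (subst integral_distr) (auto simp: case_prod_unfold)
  finally have *: "(\<integral>x. \<phi> x \<partial>P) = (\<integral>z. (case z of (t, x) \<Rightarrow> \<phi> (x(i := t))) \<partial>(L \<Otimes>\<^sub>M P))" .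
  show "(\<integral>x. \<phi> x \<partial>P) = (\<integral>t. \<integral>x. \<phi> (x(i := t)) \<partial>P \<partial>L)"
    unfolding * using LP.integral_fst'[OF int] by simp
  show "(\<integral>x. \<phi> x \<partial>P) = (\<integral>x. \<integral>t. \<phi> (x(i := t)) \<partial>L \<partial>P)"
    unfolding * using LP.integral_snd[OF int] by simp
qed

text \<open>Integrating out the other coordinates leaves functions of one group variable with values
  in the unit interval, to which the condition on translates applies.\<close>

lemma translate_coord_tendsto_0:
  fixes \<phi> :: "nat \<Rightarrow> (nat \<Rightarrow> 'g) \<Rightarrow> real"
  assumes \<gamma>: "\<gamma> \<longlonglongrightarrow> g" and [measurable]: "\<And>k. \<phi> k \<in> borel_measurable borel"
    and bd: "\<And>k x. 0 \<le> \<phi> k x \<and> \<phi> k x \<le> 1" and lim: "(\<lambda>k. \<integral>x. \<phi> k x \<partial>P) \<longlonglongrightarrow> 0"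
  shows "(\<lambda>k. \<integral>x. \<phi> k (x(i := \<gamma> k + x i)) \<partial>P) \<longlonglongrightarrow> 0"
proof -
  define \<psi> where "\<psi> k t = (\<integral>x. \<phi> k (x(i := t)) \<partial>P)" for k t
  have abs: "\<bar>\<phi> k x\<bar> \<le> 1" for k x using bd[of k x] by auto
  have [measurable]: "\<psi> k \<in> borel_measurable borel" for k
  proof -
    have "(\<lambda>t. \<integral>x. \<phi> k (x(i := t)) \<partial>P) \<in> borel_measurable borel"
      by (rule seq.P.borel_measurable_lebesgue_integral)
         (simp add: measurable_cong_sets[OF sets_pair_measure_cong[OF refl sets_P] refl])
    then show ?thesis by (simp add: \<psi>_def[abs_def])
  qed
  have bd': "0 \<le> \<psi> k t \<and> \<psi> k t \<le> 1" for k t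
  proof -
    have "\<psi> k t \<le> (\<integral>x. 1 \<partial>P)"
      unfolding \<psi>_def by (rule integral_mono) (use bd abs in \<open>auto intro!: integrable_bounded_P[of _ 1]\<close>)
    moreover have "0 \<le> \<psi> k t" unfolding \<psi>_def by (rule integral_nonneg_AE) (use bd in auto)
    ultimately show ?thesis using seq.P.prob_space by simp
  qed
  have "(\<integral>x. \<phi> k x \<partial>P) = (\<integral>t. \<psi> k t \<partial>L)" for k
    unfolding \<psi>_def by (rule integral_upd(1)[of _ 1]) (use abs in auto)
  then have "(\<lambda>k. \<integral>t. \<psi> k t \<partial>L) \<longlonglongrightarrow> 0" using lim by simp
  from translate_tendsto_0[OF \<gamma> _ bd' this] have "(\<lambda>k. \<integral>t. \<psi> k (\<gamma> k + t) \<partial>L) \<longlonglongrightarrow> 0" by simp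
  moreover have "(\<integral>x. \<phi> k (x(i := \<gamma> k + x i)) \<partial>P) = (\<integral>t. \<psi> k (\<gamma> k + t) \<partial>L)" for k
    unfolding \<psi>_def by (subst integral_upd(1)[of _ 1 i]) (use abs in auto)
  ultimately show ?thesis by simp
qed

text \<open>The function and the translation vary together, so the triangle inequality passes
  through the fixed \<open>u\<close> translated by \<open>\<gamma> k\<close>. Its translates
  converge for each value of the other coordinates, hence on average; the error
  \<open>U k - u\<close> stays small after translation by uniform absolute continuity.\<close>

lemma translate_coord_cont:
  fixes u :: "(nat \<Rightarrow> 'g) \<Rightarrow> 'b::{metric_space, second_countable_topology}"
  assumes [measurable]: "\<And>k. U k \<in> borel_measurable borel" "u \<in> borel_measurable borel" and \<gamma>: "\<gamma> \<longlonglongrightarrow> g"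
    and lim: "(\<lambda>k. meas_dist P (U k) u) \<longlonglongrightarrow> 0"
  shows "(\<lambda>k. meas_dist P (\<lambda>x. U k (x(i := \<gamma> k + x i))) (\<lambda>x. u (x(i := g + x i)))) \<longlonglongrightarrow> 0"
proof -
  have "(\<lambda>k. \<integral>x. \<integral>t. min 1 (dist (u (x(i := \<gamma> k + t))) (u (x(i := g + t)))) \<partial>L \<partial>P) \<longlonglongrightarrow> (\<integral>x. 0 \<partial>P)"
  proof (rule integral_dominated_convergence[where w = "\<lambda>_. 1"])
    show "AE x in P. (\<lambda>k. \<integral>t. min 1 (dist (u (x(i := \<gamma> k + t))) (u (x(i := g + t)))) \<partial>L) \<longlonglongrightarrow> 0"
      using translate_cont[of "\<lambda>t. u (_(i := t))", OF _ \<gamma>]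
      by (intro AE_I2) (simp add: meas_dist_def)
    show "(\<lambda>x. \<integral>t. min 1 (dist (u (x(i := \<gamma> k + t))) (u (x(i := g + t)))) \<partial>L) \<in> borel_measurable P" for k
      by (rule borel_measurable_lebesgue_integral) simp
    show "AE x in P. norm (\<integral>t. min 1 (dist (u (x(i := \<gamma> k + t))) (u (x(i := g + t)))) \<partial>L) \<le> 1" for k
    proof (intro AE_I2)
      fix x
      have "\<bar>meas_dist L (\<lambda>t. u (x(i := \<gamma> k + t))) (\<lambda>t. u (x(i := g + t)))\<bar> \<le> 1"
        by (simp add: meas_dist_nonneg meas_dist_le_1)
      then show "norm (\<integral>t. min 1 (dist (u (x(i := \<gamma> k + t))) (u (x(i := g + t)))) \<partial>L) \<le> 1"
        by (simp add: meas_dist_def)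
    qed
  qed auto
  moreover have "meas_dist P (\<lambda>x. u (x(i := \<gamma> k + x i))) (\<lambda>x. u (x(i := g + x i))) =
    (\<integral>x. \<integral>t. min 1 (dist (u (x(i := \<gamma> k + t))) (u (x(i := g + t)))) \<partial>L \<partial>P)" for k
    unfolding meas_dist_def by (subst integral_upd(2)[of _ 1 i]) auto
  ultimately have 1: "(\<lambda>k. meas_dist P (\<lambda>x. u (x(i := \<gamma> k + x i))) (\<lambda>x. u (x(i := g + x i)))) \<longlonglongrightarrow> 0"
    by simp
  have 2: "(\<lambda>k. meas_dist P (\<lambda>x. U k (x(i := \<gamma> k + x i))) (\<lambda>x. u (x(i := \<gamma> k + x i)))) \<longlonglongrightarrow> 0"
    using translate_coord_tendsto_0[OF \<gamma>, of "\<lambda>k x. min 1 (dist (U k x) (u x))" i] lim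
    by (simp add: meas_dist_def)
  show ?thesis
  proof (rule tendsto_sandwich[OF _ _ tendsto_const])
    show "(\<lambda>k. meas_dist P (\<lambda>x. U k (x(i := \<gamma> k + x i))) (\<lambda>x. u (x(i := \<gamma> k + x i))) +
       meas_dist P (\<lambda>x. u (x(i := \<gamma> k + x i))) (\<lambda>x. u (x(i := g + x i)))) \<longlonglongrightarrow> 0"
      using tendsto_add[OF 2 1] by simp
  qed (auto intro!: always_eventually seq.P.meas_dist_nonneg seq.P.meas_dist_triangle)
qed

lemma translate_upto_cont:
  fixes u :: "(nat \<Rightarrow> 'g) \<Rightarrow> 'b::{metric_space, second_countable_topology}"
  assumes [measurable]: "\<And>k. U k \<in> borel_measurable borel" "u \<in> borel_measurable borel" and \<gamma>: "\<gamma> \<longlonglongrightarrow> g"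
    and "(\<lambda>k. meas_dist P (U k) u) \<longlonglongrightarrow> 0"
  shows "(\<lambda>k. meas_dist P (\<lambda>x. U k (translate_upto n (\<gamma> k) x)) (\<lambda>x. u (translate_upto n g x))) \<longlonglongrightarrow> 0"
proof (induction n)
  case 0
  then show ?case using assms(4) by (simp add: translate_upto_def)
next
  case (Suc n)
  show ?case unfolding translate_upto_Suc
    by (rule translate_coord_cont[OF _ _ \<gamma> Suc]) auto
qed

lemma AE_translate_coord:
  assumes "AE x in P. Q x"
  shows "AE x in P. Q (x(i := g + x i))"
proof -
  from assms obtain N where N: "N \<in> null_sets P" "{x. \<not> Q x} \<subseteq> N"
    by (auto simp: eventually_ae_filter)
  have [measurable]: "N \<in> sets borel" using N(1) by (auto simp: sets_P null_sets_def)
  \<comment> \<open>For a constant sequence and the indicator of a null set the limit condition says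
    that the translated indicator has integral 0.\<close>
  have "(\<lambda>k::nat. \<integral>x. indicator N (x(i := g + x i)) \<partial>P) \<longlonglongrightarrow> (0::real)"
  proof (rule translate_coord_tendsto_0[where \<gamma> = "\<lambda>_. g" and \<phi> = "\<lambda>_. indicator N"])
    have "(\<integral>x. indicator N x \<partial>P) = (0::real)"
      using N(1) by (simp add: measure_def null_sets_def)
    then show "(\<lambda>k::nat. \<integral>x. indicator N x \<partial>P) \<longlonglongrightarrow> (0::real)" by simp
  qed auto
  then have "(\<integral>x. indicator N (x(i := g + x i)) \<partial>P) = (0::real)"
    by (simp add: LIMSEQ_const_iff)
  then have "AE x in P. indicator N (x(i := g + x i)) = (0::real)"
    by (subst (asm) integral_nonneg_eq_0_iff_AE) (auto intro!: integrable_bounded_P[of _ 1])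
  then show ?thesis
    by eventually_elim (use N(2) in \<open>auto simp: indicator_def split: if_splits\<close>)
qed

lemma AE_translate_upto:
  assumes "AE x in P. Q x"
  shows "AE x in P. Q (translate_upto n g x)"
proof (induction n)
  case 0
  then show ?case using assms by (simp add: translate_upto_def)
next
  case (Suc n)
  show ?case unfolding translate_upto_Suc by (rule AE_translate_coord[OF Suc])
qed

text \<open>Omitting a coordinate is an injective reindexing of an independent, identically
  distributed family.\<close>

lemma distr_face: "distr P P (face i) = P"
proof -
  let ?f = "\<lambda>j. if j < i then j else Suc j"
  have "inj ?f" by (auto simp: inj_def split: if_splits)
  moreover have "face i = (\<lambda>\<omega>::nat \<Rightarrow> 'g. \<lambda>n\<in>UNIV. \<omega> (?f n))"
    by (auto simp: face_def fun_eq_iff)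
  ultimately show ?thesis
    using distr_PiM_reindex[of UNIV "\<lambda>_. L" ?f UNIV] prob_space_axioms by simp
qed

lemma AE_face:
  assumes "AE x in P. Q x"
  shows "AE x in P. Q (face i x)"
proof -
  have "AE x in distr P P (face i). Q x" using assms by (simp only: distr_face)
  then show ?thesis by (rule AE_distrD[rotated]) simp
qed

lemma meas_dist_face:
  fixes u v :: "(nat \<Rightarrow> 'g) \<Rightarrow> 'b::{metric_space, second_countable_topology}"
  assumes [measurable]: "u \<in> borel_measurable borel" "v \<in> borel_measurable borel"
  shows "meas_dist P (\<lambda>x. u (face i x)) (\<lambda>x. v (face i x)) = meas_dist P u v"
proof -
  have "meas_dist P u v = (\<integral>x. min 1 (dist (u x) (v x)) \<partial>distr P P (face i))"
    unfolding meas_dist_def by (simp only: distr_face)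
  also have "\<dots> = meas_dist P (\<lambda>x. u (face i x)) (\<lambda>x. v (face i x))"
    unfolding meas_dist_def by (rule integral_distr) auto
  finally show ?thesis by simp
qed

lemma AE_comb_seqD:
  assumes "AE x in P. Q x"
  shows "AE g in P. AE h in P. Q (comb_seq m g h)"
proof -
  have "AE x in distr (P \<Otimes>\<^sub>M P) P (\<lambda>(g, h). comb_seq m g h). Q x"
    using assms by (simp only: seq.PiM_comb_seq)
  then have "AE z in P \<Otimes>\<^sub>M P. Q (case z of (g, h) \<Rightarrow> comb_seq m g h)"
    by (rule AE_distrD[rotated]) simp
  from PPP.AE_pair[OF this] show ?thesis by simp
qed

text \<open>Measurability of the set enters in this direction of Fubini, since a nonmeasurable set
  may have null sections without being null.\<close>

lemma AE_comb_seqI: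
  assumes "{x. Q x} \<in> sets borel" "AE g in P. AE h in P. Q (comb_seq m g h)"
  shows "AE x in P. Q x"
proof -
  have [measurable]: "Measurable.pred borel Q" using assms(1) by (simp add: pred_def)
  have "AE z in P \<Otimes>\<^sub>M P. Q (case z of (g, h) \<Rightarrow> comb_seq m g h)"
  proof (rule PPP.AE_pair_measure)
    have "Measurable.pred (P \<Otimes>\<^sub>M P) (\<lambda>z. Q (case z of (g, h) \<Rightarrow> comb_seq m g h))" by simp
    then show "{z \<in> space (P \<Otimes>\<^sub>M P). Q (case z of (g, h) \<Rightarrow> comb_seq m g h)} \<in> sets (P \<Otimes>\<^sub>M P)"
      by (rule predE)
  qed (use assms in simp)
  then have "AE x in distr (P \<Otimes>\<^sub>M P) P (\<lambda>(g, h). comb_seq m g h). Q x"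
    by (subst AE_distr_iff) (use assms in \<open>auto simp: sets_P\<close>)
  then show ?thesis by (simp only: seq.PiM_comb_seq)
qed

section \<open>Full support and neighbourhoods with null frontier\<close>

lemma open_pos_P:
  assumes "open U" "x \<in> U"
  shows "emeasure P U > 0"
proof -
  have "openin (product_topology (\<lambda>i::nat. euclidean :: 'g topology) UNIV) U"
    using assms by (simp add: euclidean_product_topology)
  from product_topology_open_contains_basis[OF this assms(2)] obtain X where
    X: "x \<in> Pi\<^sub>E UNIV X" "\<And>i. open (X i)" "finite {i. X i \<noteq> UNIV}" "Pi\<^sub>E UNIV X \<subseteq> U" by auto
  let ?J = "{i. X i \<noteq> UNIV}"
  have "Pi\<^sub>E UNIV X = prod_emb UNIV (\<lambda>_. L) ?J (Pi\<^sub>E ?J X)"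
    by (auto simp: prod_emb_def PiE_iff) (metis UNIV_I)
  then have "emeasure P (Pi\<^sub>E UNIV X) = (\<Prod>i\<in>?J. emeasure L (X i))"
    using seq.emeasure_PiM_emb[of ?J X] X by (simp add: sets_L)
  moreover have "(\<Prod>i\<in>?J. emeasure L (X i)) \<noteq> 0"
  proof -
    have "emeasure L (X i) \<noteq> 0" for i
      using open_pos[OF X(2), of i] X(1) by (force simp: PiE_iff)
    then show ?thesis using X(3) by (simp add: prod_zero_iff)
  qed
  ultimately have "0 < emeasure P (Pi\<^sub>E UNIV X)" by (simp add: zero_less_iff_neq_zero)
  also have "\<dots> \<le> emeasure P U" by (rule emeasure_mono) (use X assms in \<open>auto simp: sets_P\<close>)
  finally show ?thesis .
qed

lemma AE_P_dense:
  assumes "AE x in P. Q x" "open U" "x \<in> U"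
  shows "\<exists>y\<in>U. Q y"
proof (rule ccontr)
  assume "\<not> ?thesis"
  then have "Q y \<longrightarrow> y \<notin> U" for y by blast
  with assms(1) have "AE y in P. y \<notin> U" by (rule AE_mp[OF _ AE_I2])
  then have "emeasure P U = 0"
    using assms by (subst (asm) AE_iff_null_sets[symmetric]) (auto simp: sets_P)
  with open_pos_P[OF assms(2,3)] show False by simp
qed

lemma AE_P_seq:
  assumes "AE x in P. Q x"
  shows "\<exists>X. X \<longlonglongrightarrow> x \<and> (\<forall>k::nat. Q (X k))"
proof -
  obtain A :: "nat \<Rightarrow> (nat \<Rightarrow> 'g) set" where A: "\<And>i. open (A i)" "\<And>i. x \<in> A i"
    "\<And>S. open S \<Longrightarrow> x \<in> S \<Longrightarrow> eventually (\<lambda>i. A i \<subseteq> S) sequentially"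
    by (rule countable_basis_at_decseq) blast
  have "\<exists>y. y \<in> A k \<and> Q y" for k using AE_P_dense[OF assms A(1,2)] by blast
  then obtain X where X: "\<And>k. X k \<in> A k" "\<And>k. Q (X k)" by metis
  have "X \<longlonglongrightarrow> x"
  proof (rule topological_tendstoI)
    fix S assume "open S" "x \<in> S"
    from A(3)[OF this] show "eventually (\<lambda>k. X k \<in> S) sequentially"
      by eventually_elim (use X(1) in auto)
  qed
  with X(2) show ?thesis by blast
qed

text \<open>Complete regularity provides a continuous \<open>f\<close> that is 0 at \<open>x\<close>
  and 1 off \<open>U\<close>. Its fibres are disjoint, so all but countably many are null for the
  finite measure, and a sublevel set has its frontier inside a single fibre.\<close>

lemma null_frontier_nhd:
  fixes \<nu> :: "(nat \<Rightarrow> 'g) measure"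
  assumes "finite_measure \<nu>" "sets \<nu> = sets borel" "open U" "x \<in> U"
  shows "\<exists>V. open V \<and> x \<in> V \<and> V \<subseteq> U \<and> emeasure \<nu> (frontier V) = 0"
proof -
  interpret finite_measure \<nu> by fact
  have "completely_regular_space (euclidean :: (nat \<Rightarrow> 'g) topology)"
    unfolding euclidean_product_topology[symmetric] completely_regular_space_product_topology
    using completely_regular by simp
  then obtain f :: "(nat \<Rightarrow> 'g) \<Rightarrow> real" where f: "continuous_map euclidean (top_of_set {0..1}) f" "f x = 0" "f ` (- U) \<subseteq> {1}"
    unfolding completely_regular_space_def using assms(3,4) by (metis Compl_iff Diff_iff UNIV_I closed_closedin closed_Compl topspace_euclidean)
  have cont: "continuous_on UNIV f"
    using f(1) by (simp add: continuous_map_in_subtopology)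
  then have [measurable]: "f \<in> borel_measurable \<nu>"
    using assms(2) by (simp add: borel_measurable_continuous_onI measurable_cong_sets[OF assms(2) refl])
  interpret D: finite_measure "distr \<nu> borel f" by (rule finite_measure_distr) simp
  have "uncountable {0<..<1::real}" by (simp add: uncountable_open_interval)
  moreover have "countable {t. measure (distr \<nu> borel f) {t} \<noteq> 0}" by (rule D.countable_support)
  ultimately have "\<not> {0<..<1::real} \<subseteq> {t. measure (distr \<nu> borel f) {t} \<noteq> 0}"
    using countable_subset by blast
  then obtain t where t: "0 < t" "t < 1" "measure (distr \<nu> borel f) {t} = 0" by auto
  define V where "V = f -` {..<t}"
  have "open V" unfolding V_def using cont by (simp add: open_vimage)
  have "closed (f -` {..t})" using cont by (simp add: closed_vimage)
  then have "closure V \<subseteq> f -` {..t}" by (intro closure_minimal) (auto simp: V_def)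
  then have fr: "frontier V \<subseteq> f -` {t}"
    unfolding frontier_def interior_open[OF \<open>open V\<close>] by (auto simp: V_def)
  have "emeasure \<nu> (f -` {t} \<inter> space \<nu>) = 0"
    using t(3) D.emeasure_eq_measure[of "{t}"] by (simp add: emeasure_distr)
  moreover have "space \<nu> = UNIV" using sets_eq_imp_space_eq[OF assms(2)] by simp
  ultimately have "emeasure \<nu> (frontier V) = 0"
    using emeasure_mono[OF fr, of \<nu>] measurable_sets[of f \<nu> borel "{t}"] by simp
  then show ?thesis using \<open>open V\<close> f t by (intro exI[of _ V]) (auto simp: V_def)
qed

end

section \<open>Almost continuous selections\<close>

lemma measurable_section_borel:
  assumes "(\<lambda>(x, h). b x h) \<in> borel_measurable (borel \<Otimes>\<^sub>M borel)"
  shows "b x \<in> borel_measurable borel"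
  using measurable_compose[OF measurable_Pair1' assms, of x] by simp

context quasi_invariant
begin

text \<open>The refinement step of the selection: the values chosen on the open pieces of one level are
  corrected, by a small amount in measure, on a finer family of open pieces.  The pieces have null
  frontiers, so together they miss only a null set.\<close>

lemma selection_step:
  fixes \<Omega> :: "'w measure" and N :: "'w \<Rightarrow> nat \<Rightarrow> 'g"
    and Lft :: "(nat \<Rightarrow> 'g) \<Rightarrow> ((nat \<Rightarrow> 'g) \<Rightarrow> 'a::polish_space) \<Rightarrow> bool"
    and b :: "(nat \<Rightarrow> 'g) \<Rightarrow> (nat \<Rightarrow> 'g) \<Rightarrow> 'a"
  assumes \<Omega>: "finite_measure \<Omega>" "N \<in> borel_measurable \<Omega>"
    and S: "AE \<omega> in \<Omega>. N \<omega> \<in> S"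
    and meas: "\<And>x e. Lft x e \<Longrightarrow> e \<in> borel_measurable borel"
    and dep: "\<And>x e. Lft x e \<Longrightarrow> depends_upto j e"
    and op: "\<And>x e \<epsilon>. x \<in> S \<Longrightarrow> Lft x e \<Longrightarrow> 0 < \<epsilon> \<Longrightarrow>
      \<exists>V. open V \<and> x \<in> V \<and> (\<forall>y\<in>V \<inter> S. \<exists>e'. Lft y e' \<and> meas_dist P e e' < \<epsilon>)"
    and W: "AE \<omega> in \<Omega>. N \<omega> \<in> W"
    and b: "(\<lambda>(x, h). b x h) \<in> borel_measurable (borel \<Otimes>\<^sub>M borel)" "\<And>x. depends_upto j (b x)"
      "\<And>x. x \<in> W \<Longrightarrow> \<exists>V. open V \<and> x \<in> V \<and> (\<forall>y\<in>V. b y = b x)"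
      "\<And>y. y \<in> W \<inter> S \<Longrightarrow> \<exists>e'. Lft y e' \<and> meas_dist P (b y) e' < r"
    and r: "0 < r" "0 < r'"
  obtains W' b' where "AE \<omega> in \<Omega>. N \<omega> \<in> W'"
    "(\<lambda>(x, h). b' x h) \<in> borel_measurable (borel \<Otimes>\<^sub>M borel)" "\<And>x. depends_upto j (b' x)"
    "\<And>x. x \<in> W' \<Longrightarrow> \<exists>V. open V \<and> x \<in> V \<and> (\<forall>y\<in>V. b' y = b' x)"
    "\<And>y. y \<in> W' \<inter> S \<Longrightarrow> \<exists>e'. Lft y e' \<and> meas_dist P (b' y) e' < r'"
    "\<And>y. meas_dist P (b y) (b' y) \<le> r"
proof (cases "W \<inter> S = {}")
  \<comment> \<open>Here the measure \<open>\<Omega>\<close> is zero, so the empty set serves as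
    \<open>W'\<close>. Disposing of this case allows the countable cover below to be
    enumerated.\<close>
  case True
  from W S have "AE \<omega> in \<Omega>. N \<omega> \<in> {}"
    by eventually_elim (use True in auto)
  moreover have "meas_dist P (b y) (b y) \<le> r" for y
    using r by (simp add: meas_dist_def)
  ultimately show ?thesis using b by (intro that[of "{}" b]) auto
next
  case False
  \<comment> \<open>Frontiers have to be null for the law of \<open>N\<close>, not for
    \<open>P\<close>: that law may live on a \<open>P\<close>-null set and may have atoms.\<close>
  define \<nu> where "\<nu> = distr \<Omega> borel N"
  have \<nu>: "finite_measure \<nu>" "sets \<nu> = sets borel"
    unfolding \<nu>_def using finite_measure.finite_measure_distr[OF \<Omega>(1), of N borel] \<Omega>(2) by auto
  have "\<exists>V e. open V \<and> x \<in> V \<and> emeasure \<nu> (frontier V) = 0 \<and> Lft x e \<and> meas_dist P (b x) e < r \<and>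
     (\<forall>y\<in>V. b y = b x) \<and> (\<forall>y\<in>V \<inter> S. \<exists>e'. Lft y e' \<and> meas_dist P e e' < r')" if x: "x \<in> W \<inter> S" for x
  proof -
    obtain e where e: "Lft x e" "meas_dist P (b x) e < r" using b(4)[OF x] by blast
    obtain V1 where V1: "open V1" "x \<in> V1" "\<forall>y\<in>V1 \<inter> S. \<exists>e'. Lft y e' \<and> meas_dist P e e' < r'"
      using op[OF _ e(1) r(2)] x by blast
    obtain V2 where V2: "open V2" "x \<in> V2" "\<forall>y\<in>V2. b y = b x" using b(3) x by blast
    obtain V where "open V" "x \<in> V" "V \<subseteq> V1 \<inter> V2" "emeasure \<nu> (frontier V) = 0"
      using null_frontier_nhd[OF \<nu>, of "V1 \<inter> V2" x] V1 V2 by auto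
    with e V1 V2 show ?thesis by (intro exI[of _ V] exI[of _ e]) blast
  qed
  then obtain V e where Ve: "\<And>x. x \<in> W \<inter> S \<Longrightarrow> open (V x) \<and> x \<in> V x \<and> emeasure \<nu> (frontier (V x)) = 0 \<and>
     Lft x (e x) \<and> meas_dist P (b x) (e x) < r \<and> (\<forall>y\<in>V x. b y = b x) \<and>
     (\<forall>y\<in>V x \<inter> S. \<exists>e'. Lft y e' \<and> meas_dist P (e x) e' < r')"
    by metis
  obtain F where F: "F \<subseteq> V ` (W \<inter> S)" "countable F" "\<Union>F = \<Union>(V ` (W \<inter> S))"
    using Lindelof[of "V ` (W \<inter> S)"] Ve by blast
  obtain D where D: "countable D" "D \<subseteq> W \<inter> S" "F = V ` D"
    using countable_subset_image F(1,2) by metis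
  have "D \<noteq> {}" using False F(3) D(3) Ve by fastforce
  define d where "d = from_nat_into D"
  have d: "d k \<in> W \<inter> S" for k
    using from_nat_into[OF \<open>D \<noteq> {}\<close>] D(2) unfolding d_def by blast
  have cover: "\<exists>k. x \<in> V (d k)" if "x \<in> W \<inter> S" for x
  proof -
    have "x \<in> \<Union>F" using F(3) Ve[OF that] that by blast
    then obtain y where "y \<in> D" "x \<in> V y" using D(3) by blast
    then show ?thesis using from_nat_into_surj[OF D(1)] unfolding d_def by metis
  qed
  \<comment> \<open>Subtracting closures keeps the disjoint pieces open; what is lost compared with
    subtracting the sets themselves lies in their frontiers.\<close>
  define U where "U k = V (d k) - (\<Union>l<k. closure (V (d l)))" for k
  have openU: "open (U k)" for k
    unfolding U_def using Ve[OF d] by (intro open_Diff closed_UN) auto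
  then have [measurable]: "U k \<in> sets borel" for k by simp
  define idx where "idx x = (LEAST k. x \<in> U k)" for x
  have disj: "k = l" if "x \<in> U k" "x \<in> U l" for x k l
  proof -
    have "\<not> k < l" if "x \<in> U k" "x \<in> U l" for k l
      using that closure_subset[of "V (d k)"] unfolding U_def by blast
    from this[OF that] this[OF that(2,1)] show ?thesis by simp
  qed
  have idx: "idx x = k" if "x \<in> U k" for x k
    unfolding idx_def using that disj by (intro Least_equality) (auto intro: eq_refl)
  have [measurable]: "idx \<in> measurable borel (count_space UNIV)"
    unfolding idx_def by measurable
  define W' where "W' = (\<Union>k. U k)"
  have [measurable]: "W' \<in> sets borel" unfolding W'_def by measurable
  \<comment> \<open>Off the new pieces the old value is kept, so the bound \<open>r\<close> on the
    correction holds at every point and not merely almost everywhere.\<close>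
  define b' where "b' x = (if x \<in> W' then e (d (idx x)) else b x)" for x
  have b'U: "b' y = e (d k)" if "y \<in> U k" for y k
    using that idx[OF that] by (auto simp: b'_def W'_def)
  have e_meas [measurable]: "e (d k) \<in> borel_measurable borel" for k
    using Ve[OF d] meas by blast
  note b(1)[measurable]
  show ?thesis
  proof (rule that[of W' b'])
    have "frontier (V (d k)) \<in> null_sets \<nu>" for k
      using Ve[OF d, of k] \<nu>(2) frontier_closed[of "V (d k)"] by (auto simp: null_sets_def)
    then have "AE x in distr \<Omega> borel N. \<forall>k. x \<notin> frontier (V (d k))"
      unfolding \<nu>_def[symmetric] by (subst AE_all_countable) (auto intro: AE_not_in)
    then have "AE \<omega> in \<Omega>. \<forall>k. N \<omega> \<notin> frontier (V (d k))"
      by (rule AE_distrD[OF \<Omega>(2)])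
    with W S show "AE \<omega> in \<Omega>. N \<omega> \<in> W'"
    proof eventually_elim
      case (elim \<omega>)
      define x where "x = N \<omega>"
      have "\<exists>k. x \<in> V (d k)" using cover elim by (auto simp: x_def)
      define k where "k = (LEAST k. x \<in> V (d k))"
      have "x \<in> V (d k)" unfolding k_def using \<open>\<exists>k. _\<close> by (rule LeastI_ex)
      moreover have "x \<notin> closure (V (d l))" if "l < k" for l
        using not_less_Least[OF that[unfolded k_def]] elim(3) closure_Un_frontier[of "V (d l)"] unfolding x_def by blast
      ultimately show ?case unfolding W'_def U_def x_def by blast
    qed
    have "(\<lambda>(x, h). b' x h) = (\<lambda>z. if fst z \<in> W' then e (d (idx (fst z))) (snd z) else (case z of (x, h) \<Rightarrow> b x h))"
      by (auto simp: b'_def fun_eq_iff)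
    moreover have "(\<lambda>z. e (d (idx (fst z))) (snd z)) \<in> borel_measurable (borel \<Otimes>\<^sub>M borel)"
      by (rule measurable_compose_countable[where g = "\<lambda>z. idx (fst z)"]) measurable
    ultimately show "(\<lambda>(x, h). b' x h) \<in> borel_measurable (borel \<Otimes>\<^sub>M borel)"
      by simp
    show "depends_upto j (b' x)" for x
      using Ve[OF d, of "idx x"] dep[of "d (idx x)"] b(2) by (auto simp: b'_def)
    show "\<exists>V. open V \<and> x \<in> V \<and> (\<forall>y\<in>V. b' y = b' x)" if x: "x \<in> W'" for x
    proof -
      from x obtain k where "x \<in> U k" unfolding W'_def by blast
      then show ?thesis using openU b'U by (intro exI[of _ "U k"]) auto
    qed
    show "\<exists>e'. Lft y e' \<and> meas_dist P (b' y) e' < r'" if y: "y \<in> W' \<inter> S" for y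
    proof -
      from y obtain k where k: "y \<in> U k" unfolding W'_def by blast
      then have "y \<in> V (d k) \<inter> S" using y by (auto simp: U_def)
      then show ?thesis using Ve[OF d, of k] b'U[OF k] by auto
    qed
    show "meas_dist P (b y) (b' y) \<le> r" for y
    proof (cases "y \<in> W'")
      case True
      then obtain k where k: "y \<in> U k" unfolding W'_def by blast
      then have "y \<in> V (d k)" by (auto simp: U_def)
      then have "b y = b (d k)" using Ve[OF d, of k] by blast
      moreover have "meas_dist P (b (d k)) (e (d k)) < r" using Ve[OF d, of k] by blast
      ultimately show ?thesis unfolding b'U[OF k] by simp
    qed (use r in \<open>simp add: b'_def meas_dist_def\<close>)
  qed
qed

text \<open>Iterated refinement gives maps that converge uniformly in measure and are locally
  constant near almost every \<open>N \<omega>\<close>. The limit is therefore continuous there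
  along all sequences, including those outside \<open>S\<close>. Openness of the lifting relation
  (\<open>op\<close>) supplies small corrections, closedness (\<open>cl\<close>) puts the limit into
  the relation. Keeping \<open>\<Omega>\<close> and \<open>N\<close> general leaves the law of the
  points free to be singular.\<close>

lemma almost_continuous_selection:
  fixes \<Omega> :: "'w measure" and N :: "'w \<Rightarrow> nat \<Rightarrow> 'g"
    and Lft :: "(nat \<Rightarrow> 'g) \<Rightarrow> ((nat \<Rightarrow> 'g) \<Rightarrow> 'a::{polish_space, zero}) \<Rightarrow> bool"
  assumes \<Omega>: "finite_measure \<Omega>" "N \<in> borel_measurable \<Omega>"
    and S: "AE \<omega> in \<Omega>. N \<omega> \<in> S"
    and meas: "\<And>x e. Lft x e \<Longrightarrow> e \<in> borel_measurable borel"
    and dep: "\<And>x e. Lft x e \<Longrightarrow> depends_upto j e"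
    and ne: "\<And>x. x \<in> S \<Longrightarrow> \<exists>e. Lft x e"
    and op: "\<And>x e \<epsilon>. x \<in> S \<Longrightarrow> Lft x e \<Longrightarrow> 0 < \<epsilon> \<Longrightarrow>
      \<exists>V. open V \<and> x \<in> V \<and> (\<forall>y\<in>V \<inter> S. \<exists>e'. Lft y e' \<and> meas_dist P e e' < \<epsilon>)"
    and cl: "\<And>x e E. x \<in> S \<Longrightarrow> (\<And>k::nat. Lft x (E k)) \<Longrightarrow> e \<in> borel_measurable borel \<Longrightarrow> depends_upto j e \<Longrightarrow>
      (\<lambda>k. meas_dist P (E k) e) \<longlonglongrightarrow> 0 \<Longrightarrow> Lft x e"
  obtains b where "(\<lambda>(x, h). b x h) \<in> borel_measurable (borel \<Otimes>\<^sub>M borel)" "\<And>x. depends_upto j (b x)"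
    "AE \<omega> in \<Omega>. Lft (N \<omega>) (b (N \<omega>))"
    "AE \<omega> in \<Omega>. \<forall>X. X \<longlonglongrightarrow> N \<omega> \<longrightarrow> (\<lambda>k. meas_dist P (b (X k)) (b (N \<omega>))) \<longlonglongrightarrow> 0"
proof -
  define Inv where "Inv n p \<longleftrightarrow> (case p of (W, b) \<Rightarrow> (AE \<omega> in \<Omega>. N \<omega> \<in> W) \<and>
    (\<lambda>(x, h). b x h) \<in> borel_measurable (borel \<Otimes>\<^sub>M borel) \<and> (\<forall>x. depends_upto j (b x)) \<and>
    (\<forall>x\<in>W. \<exists>V. open V \<and> x \<in> V \<and> (\<forall>y\<in>V. b y = b x)) \<and>
    (\<forall>y\<in>W \<inter> S. \<exists>e'. Lft y e' \<and> meas_dist P (b y) e' < 2 / 2 ^ n))" for n :: nat and p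
  define Next where "Next n p p' \<longleftrightarrow> (\<forall>y. meas_dist P (snd p y) (snd p' y) \<le> 2 / 2 ^ n)"
    for n :: nat and p p' :: "(nat \<Rightarrow> 'g) set \<times> ((nat \<Rightarrow> 'g) \<Rightarrow> (nat \<Rightarrow> 'g) \<Rightarrow> 'a)"
  have "\<exists>f. \<forall>n. Inv n (f n) \<and> Next n (f n) (f (Suc n))"
  proof (rule dependent_nat_choice)
    \<comment> \<open>The iteration can start from the constant 0: the distance never exceeds 1,
      while the radius at level 0 is 2.\<close>
    have "\<exists>e'. Lft y e' \<and> meas_dist P (\<lambda>h. 0) e' < 2" if y: "y \<in> S" for y
    proof -
      obtain e where e: "Lft y e" using ne[OF y] by blast
      have "meas_dist P (\<lambda>h. 0) e \<le> 1"
        by (rule seq.P.meas_dist_le_1) (use meas[OF e] in auto)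
      with e show ?thesis by (intro exI[of _ e]) simp
    qed
    then show "\<exists>p. Inv 0 p"
      by (intro exI[of _ "(UNIV, \<lambda>x h. 0)"]) (auto simp: Inv_def depends_upto_def)
  next
    fix p and n :: nat assume "Inv n p"
    moreover obtain W b where p: "p = (W, b)" by (cases p)
    ultimately have *: "AE \<omega> in \<Omega>. N \<omega> \<in> W" "(\<lambda>(x, h). b x h) \<in> borel_measurable (borel \<Otimes>\<^sub>M borel)"
      "\<And>x. depends_upto j (b x)"
      "\<And>x. x \<in> W \<Longrightarrow> \<exists>V. open V \<and> x \<in> V \<and> (\<forall>y\<in>V. b y = b x)"
      "\<And>y. y \<in> W \<inter> S \<Longrightarrow> \<exists>e'. Lft y e' \<and> meas_dist P (b y) e' < 2 / 2 ^ n"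
      by (auto simp: Inv_def)
    obtain W' b' where "AE \<omega> in \<Omega>. N \<omega> \<in> W'"
      "(\<lambda>(x, h). b' x h) \<in> borel_measurable (borel \<Otimes>\<^sub>M borel)" "\<And>x. depends_upto j (b' x)"
      "\<And>x. x \<in> W' \<Longrightarrow> \<exists>V. open V \<and> x \<in> V \<and> (\<forall>y\<in>V. b' y = b' x)"
      "\<And>y. y \<in> W' \<inter> S \<Longrightarrow> \<exists>e'. Lft y e' \<and> meas_dist P (b' y) e' < 2 / 2 ^ Suc n"
      "\<And>y. meas_dist P (b y) (b' y) \<le> 2 / 2 ^ n"
      by (rule selection_step[OF \<Omega> S meas dep op *, where r' = "2 / 2 ^ Suc n"]) auto
    then show "\<exists>p'. Inv (Suc n) p' \<and> Next n p p'"
      by (intro exI[of _ "(W', b')"]) (auto simp: Inv_def Next_def p)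
  qed
  then obtain f where f: "\<And>n. Inv n (f n)" "\<And>n. Next n (f n) (f (Suc n))" by blast
  define W where "W n = fst (f n)" for n
  define B where "B n = snd (f n)" for n
  have W: "AE \<omega> in \<Omega>. N \<omega> \<in> W n"
    and Bm: "(\<lambda>(x, h). B n x h) \<in> borel_measurable (borel \<Otimes>\<^sub>M borel)"
    and Bd: "depends_upto j (B n x)"
    and Bl: "x \<in> W n \<Longrightarrow> \<exists>V. open V \<and> x \<in> V \<and> (\<forall>y\<in>V. B n y = B n x)"
    and BL: "y \<in> W n \<inter> S \<Longrightarrow> \<exists>e'. Lft y e' \<and> meas_dist P (B n y) e' < 2 / 2 ^ n" for n x y
    using f(1)[of n] by (auto simp: Inv_def W_def B_def split_beta)
  have Bs: "meas_dist P (B n y) (B (Suc n) y) \<le> 2 / 2 ^ n" for n y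
    using f(2)[of n] by (auto simp: Next_def B_def)
  note Bm1 [measurable] = measurable_section_borel[OF Bm]
  define b where "b x h = lim0 (\<lambda>n. B n x h)" for x h
  have bm: "(\<lambda>(x, h). b x h) \<in> borel_measurable (borel \<Otimes>\<^sub>M borel)"
    unfolding b_def case_prod_unfold
    by (rule borel_measurable_lim0) (use Bm in \<open>simp add: case_prod_unfold\<close>)
  note bm1 [measurable] = measurable_section_borel[OF bm]
  have bd: "depends_upto j (b x)" for x
    unfolding depends_upto_def
  proof (intro allI impI)
    fix h h' :: "nat \<Rightarrow> 'g" assume "\<forall>i<j. h i = h' i"
    then have "B n x h = B n x h'" for n using Bd[of n x] by (auto simp: depends_upto_def)
    then show "b x h = b x h'" by (simp add: b_def)
  qed
  \<comment> \<open>The increments \<open>2 / 2 ^ n\<close> add up to \<open>4 / 2 ^ n\<close>, and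
    do so at every \<open>x\<close>, whether or not it lies in the good sets.\<close>
  have close: "meas_dist P (B n x) (b x) \<le> 4 / 2 ^ n" for n x
    using seq.P.meas_dist_complete[of "\<lambda>n. B n x" 2 n] Bs by (simp add: b_def[abs_def])
  have Wall: "AE \<omega> in \<Omega>. \<forall>n. N \<omega> \<in> W n"
    using W by (simp add: AE_all_countable)
  have pow0: "(\<lambda>n. c / 2 ^ n) \<longlonglongrightarrow> (0::real)" for c :: real
    using tendsto_mult[OF tendsto_const LIMSEQ_inverse_realpow_zero[of 2], of c] by (simp add: divide_inverse)
  show ?thesis
  proof (rule that[OF bm bd])
    from S Wall show "AE \<omega> in \<Omega>. Lft (N \<omega>) (b (N \<omega>))"
    proof eventually_elim
      case (elim \<omega>)
      define x where "x = N \<omega>"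
      have xS: "x \<in> S" "\<forall>n. x \<in> W n" using elim by (auto simp: x_def)
      then have "\<forall>n. \<exists>e'. Lft x e' \<and> meas_dist P (B n x) e' < 2 / 2 ^ n" using BL by blast
      then obtain E where E: "\<And>n. Lft x (E n)" "\<And>n. meas_dist P (B n x) (E n) < 2 / 2 ^ n" by metis
      note [measurable] = meas[OF E(1)]
      show ?case unfolding x_def[symmetric]
      proof (rule cl[OF xS(1) E(1) bm1 bd])
        show "(\<lambda>n. meas_dist P (E n) (b x)) \<longlonglongrightarrow> 0"
        proof (rule tendsto_sandwich[OF _ _ tendsto_const pow0[of 6]])
          show "\<forall>\<^sub>F n in sequentially. meas_dist P (E n) (b x) \<le> 6 / 2 ^ n"
          proof (rule always_eventually, rule allI)
            fix n
            have "meas_dist P (E n) (b x) \<le> meas_dist P (E n) (B n x) + meas_dist P (B n x) (b x)"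
              by (rule seq.P.meas_dist_triangle) auto
            also have "\<dots> \<le> 2 / 2 ^ n + 4 / 2 ^ n"
              using E(2)[of n] close[of n x] unfolding seq.P.meas_dist_commute[of "E n"] by linarith
            finally show "meas_dist P (E n) (b x) \<le> 6 / 2 ^ n" by (simp add: add_divide_distrib[symmetric])
          qed
        qed (auto intro!: always_eventually seq.P.meas_dist_nonneg)
      qed
    qed
    from Wall show "AE \<omega> in \<Omega>. \<forall>X. X \<longlonglongrightarrow> N \<omega> \<longrightarrow> (\<lambda>k. meas_dist P (b (X k)) (b (N \<omega>))) \<longlonglongrightarrow> 0"
    proof eventually_elim
      case (elim \<omega>)
      define x where "x = N \<omega>"
      show ?case unfolding x_def[symmetric]
      proof (intro allI impI tendstoI)
        fix X and \<epsilon> :: real assume X: "X \<longlonglongrightarrow> x" and \<epsilon>: "0 < \<epsilon>"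
        \<comment> \<open>Twice \<open>4 / 2 ^ n\<close>: the limit is compared with level
          \<open>n\<close> at both points, and level \<open>n\<close> is constant near
          \<open>x\<close>.\<close>
        have "eventually (\<lambda>n. 8 / 2 ^ n < \<epsilon>) sequentially"
          using order_tendstoD(2)[OF pow0 \<epsilon>] .
        then obtain n :: nat where n: "8 / 2 ^ n < \<epsilon>" by (auto simp: eventually_sequentially)
        from Bl[OF elim[rule_format, of n, folded x_def]]
        obtain V where V: "open V" "x \<in> V" "\<forall>y\<in>V. B n y = B n x" by (elim exE conjE)
        have "eventually (\<lambda>k. X k \<in> V) sequentially" using X V by (simp add: topological_tendstoD)
        then show "eventually (\<lambda>k. dist (meas_dist P (b (X k)) (b x)) 0 < \<epsilon>) sequentially"
        proof eventually_elim
          case (elim k)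
          have "meas_dist P (b (X k)) (b x) \<le> meas_dist P (b (X k)) (B n (X k)) + meas_dist P (B n (X k)) (b x)"
            by (rule seq.P.meas_dist_triangle) auto
          also have "\<dots> \<le> 4 / 2 ^ n + 4 / 2 ^ n"
            using close[of n "X k"] close[of n x] unfolding V(3)[rule_format, OF elim] seq.P.meas_dist_commute[of "b (X k)"] by linarith
          also have "\<dots> < \<epsilon>" using n by (simp add: add_divide_distrib[symmetric])
          finally show ?case by (simp add: seq.P.meas_dist_nonneg)
        qed
      qed
    qed
  qed
qed

end

section \<open>Partial coboundaries\<close>

definition alt :: "nat \<Rightarrow> 'a::ab_group_add \<Rightarrow> 'a" where
  "alt i a = (if even i then a else - a)"

lemma alt_alt [simp]: "alt i (alt i a) = a"
  and alt_0 [simp]: "alt i 0 = 0"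
  and alt_Suc: "alt (Suc i) a = - alt i a"
  and alt_add: "alt i (a + b) = alt i a + alt i b"
  and alt_minus: "alt i (- a) = - alt i a"
  and alt_comm: "alt i (alt k a) = alt k (alt i a)"
  by (simp_all add: alt_def)

lemma alt_sum: "alt i (\<Sum>x\<in>A. f x) = (\<Sum>x\<in>A. alt i (f x))"
  by (simp add: alt_def sum_negf)

lemma tendsto_alt:
  fixes f :: "'x \<Rightarrow> 'a::topological_ab_group_add"
  shows "(f \<longlongrightarrow> l) F \<Longrightarrow> ((\<lambda>x. alt i (f x)) \<longlongrightarrow> alt i l) F"
  by (auto simp: alt_def intro: tendsto_minus)

lemma measurable_alt [measurable (raw)]:
  fixes f :: "'x \<Rightarrow> 'a::{topological_ab_group_add, second_countable_topology}"
  shows "f \<in> borel_measurable M \<Longrightarrow> (\<lambda>x. alt i (f x)) \<in> borel_measurable M"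
  by (cases "even i") (simp_all add: alt_def borel_measurable_uminus_group)

text \<open>The faces are summed over the index interval from \<open>a\<close> to \<open>b - 1\<close> only: splitting the
  variables into a head and a tail turns the coboundary into a double complex.\<close>

definition pcobd :: "nat \<Rightarrow> nat \<Rightarrow> ((nat \<Rightarrow> 'g) \<Rightarrow> 'a::ab_group_add) \<Rightarrow> (nat \<Rightarrow> 'g) \<Rightarrow> 'a" where
  "pcobd a b F x = (\<Sum>i=a..<b. alt i (F (face i x)))"

lemma face_face: "l \<le> i \<Longrightarrow> face l (face (Suc i) x) = face i (face l x)"
  by (auto simp: face_def fun_eq_iff)

lemma pcobd_empty [simp]: "b \<le> a \<Longrightarrow> pcobd a b F x = 0"
  by (simp add: pcobd_def)

lemma pcobd_add: "pcobd a b (\<lambda>x. F x + H x) x = pcobd a b F x + pcobd a b H x"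
  by (simp add: pcobd_def alt_add sum.distrib)

lemma pcobd_minus: "pcobd a b (\<lambda>x. - F x) x = - pcobd a b F x"
  by (simp add: pcobd_def alt_minus sum_negf)

lemma pcobd_diff: "pcobd a b (\<lambda>x. F x - H x) x = pcobd a b F x - pcobd a b H x"
  using pcobd_add[of a b F "\<lambda>x. - H x"] pcobd_minus[of a b H] by simp

lemma pcobd_split: "a \<le> c \<Longrightarrow> c \<le> b \<Longrightarrow> pcobd a b F x = pcobd a c F x + pcobd c b F x"
  by (simp add: pcobd_def sum.atLeastLessThan_concat)

text \<open>The squares of the double complex anticommute. By the simplicial identity, omitting an
  early variable shifts the later indices by one, which accounts both for \<open>Suc\<close> on the
  later range and for the sign. The condition \<open>b \<le> Suc c\<close> says that every early
  index is at most every later one.\<close>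

lemma pcobd_commute:
  assumes "b \<le> Suc c"
  shows "pcobd (Suc c) (Suc d) (pcobd a b u) x = - pcobd a b (pcobd c d u) x"
proof -
  have "pcobd (Suc c) (Suc d) (pcobd a b u) x =
    (\<Sum>i=c..<d. \<Sum>l=a..<b. alt (Suc i) (alt l (u (face l (face (Suc i) x)))))"
    unfolding pcobd_def sum.shift_bounds_Suc_ivl alt_sum by (rule refl)
  also have "\<dots> = (\<Sum>i=c..<d. \<Sum>l=a..<b. - alt l (alt i (u (face i (face l x)))))"
    using assms by (intro sum.cong refl) (simp add: face_face alt_Suc alt_minus alt_comm)
  also have "\<dots> = - (\<Sum>l=a..<b. \<Sum>i=c..<d. alt l (alt i (u (face i (face l x)))))"
    by (subst sum.swap) (simp add: sum_negf)
  finally show ?thesis by (simp add: pcobd_def alt_sum)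
qed

text \<open>Enlarging the range by one face adds two cross terms, which cancel because partial
  coboundaries anticommute. The case \<open>a = 0\<close> is the usual vanishing of the squared
  differential; other values of \<open>a\<close> give that of the tail complex.\<close>

lemma pcobd_pcobd: "pcobd a (Suc b) (pcobd a b u) x = 0"
proof (cases "a \<le> b")
  case True
  then show ?thesis
  proof (induction b rule: dec_induct)
    case base
    have "pcobd a a u = (\<lambda>x. 0)" by (simp add: fun_eq_iff)
    then show ?case by (simp add: pcobd_def)
  next
    case (step b)
    have eq: "pcobd a (Suc b) u = (\<lambda>x. pcobd a b u x + pcobd b (Suc b) u x)"
      using step(1) by (auto simp: fun_eq_iff intro: pcobd_split)
    have "pcobd a (Suc (Suc b)) (pcobd a (Suc b) u) x =
      pcobd a (Suc b) (pcobd a (Suc b) u) x + pcobd (Suc b) (Suc (Suc b)) (pcobd a (Suc b) u) x"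
      using step(1) by (intro pcobd_split) auto
    also have "pcobd (Suc b) (Suc (Suc b)) (pcobd a (Suc b) u) x = - pcobd a (Suc b) (pcobd b (Suc b) u) x"
      by (rule pcobd_commute) simp
    also have "pcobd a (Suc b) (pcobd a (Suc b) u) x = pcobd a (Suc b) (pcobd b (Suc b) u) x"
      unfolding eq by (simp add: pcobd_add step.IH)
    finally show ?case by simp
  qed
next
  case False
  then show ?thesis by simp
qed

lemma face_comb_seq_head: "i \<le> m \<Longrightarrow> face i (comb_seq (Suc m) g h) = comb_seq m (face i g) h"
  by (auto simp: face_def comb_seq_def fun_eq_iff)

lemma face_comb_seq_tail: "face (m + i) (comb_seq m g h) = comb_seq m g (face i h)"
  by (auto simp: face_def comb_seq_def fun_eq_iff Suc_diff_le)

lemma translate_comb_seq: "translate g (comb_seq m x h) = comb_seq m (translate g x) (translate g h)"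
  by (auto simp: translate_def comb_seq_def)

lemma translate_face: "translate g (face i x) = face i (translate g x)"
  by (auto simp: translate_def face_def)

lemma translate_translate: "translate g (translate h x) = translate (g + h) x"
  by (simp add: translate_def add.assoc)

lemma translate_0 [simp]: "translate 0 x = x"
  by (simp add: translate_def)

lemma tendsto_face: "(X \<longlongrightarrow> x) F \<Longrightarrow> ((\<lambda>k. face i (X k)) \<longlongrightarrow> face i x) F"
  by (simp add: tendsto_fun_iff face_def)

text \<open>The tail part of the coboundary with the head held fixed. The signs are shifted by
  \<open>m\<close> because tail variable \<open>i\<close> has position \<open>m + i\<close> in the
  full tuple.\<close>

definition tcobd :: "nat \<Rightarrow> nat \<Rightarrow> ((nat \<Rightarrow> 'g) \<Rightarrow> 'a::ab_group_add) \<Rightarrow> (nat \<Rightarrow> 'g) \<Rightarrow> 'a" where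
  "tcobd m q e h = (\<Sum>i<q. alt (m + i) (e (face i h)))"

lemma pcobd_comb_seq: "pcobd m (m + q) F (comb_seq m g h) = tcobd m q (\<lambda>h. F (comb_seq m g h)) h"
proof -
  have "pcobd m (m + q) F (comb_seq m g h) = (\<Sum>i=0..<q. alt (i + m) (F (face (i + m) (comb_seq m g h))))"
    unfolding pcobd_def using sum.shift_bounds_nat_ivl[of _ 0 m q] by (simp add: add.commute)
  then show ?thesis
    by (simp add: tcobd_def atLeast0LessThan face_comb_seq_tail add.commute[of _ m])
qed

lemma depends_upto_face: "depends_upto n F \<Longrightarrow> depends_upto (Suc n) (\<lambda>x. F (face i x))"
  by (auto simp: depends_upto_def face_def)

lemma depends_upto_sum:
  "(\<And>i. i \<in> I \<Longrightarrow> depends_upto n (F i)) \<Longrightarrow> depends_upto n (\<lambda>x. \<Sum>i\<in>I. F i x)"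
  unfolding depends_upto_def by (metis (no_types, lifting) sum.cong)

lemma depends_upto_compose2:
  "depends_upto n F \<Longrightarrow> depends_upto n H \<Longrightarrow> depends_upto n (\<lambda>x. f (F x) (H x))"
  unfolding depends_upto_def by metis

lemma depends_upto_alt: "depends_upto n F \<Longrightarrow> depends_upto n (\<lambda>x. alt i (F x))"
  unfolding depends_upto_def by metis

lemma depends_upto_tcobd: "depends_upto n e \<Longrightarrow> depends_upto (Suc n) (tcobd m q e)"
  unfolding tcobd_def[abs_def] by (intro depends_upto_sum depends_upto_alt depends_upto_face)

lemma depends_upto_comb_seq: "depends_upto n F \<Longrightarrow> depends_upto (n - m) (\<lambda>h. F (comb_seq m x h))"
  by (auto simp: depends_upto_def comb_seq_def)

lemma measurable_tcobd [measurable]: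
  fixes e :: "(nat \<Rightarrow> 'g::second_countable_topology) \<Rightarrow> 'a::{topological_ab_group_add, second_countable_topology}"
  assumes [measurable]: "e \<in> borel_measurable borel"
  shows "tcobd m q e \<in> borel_measurable borel"
  unfolding tcobd_def[abs_def] by measurable

lemma measurable_pcobd [measurable]:
  fixes e :: "(nat \<Rightarrow> 'g::second_countable_topology) \<Rightarrow> 'a::{topological_ab_group_add, second_countable_topology}"
  assumes [measurable]: "e \<in> borel_measurable borel"
  shows "pcobd m q e \<in> borel_measurable borel"
  unfolding pcobd_def[abs_def] by measurable

section \<open>Strictly equivariant cochains and continuity in the head\<close>

locale polish_module = quasi_invariant L
  for L :: "'g::{topological_group_add, t2_space, second_countable_topology} measure" +
  fixes \<alpha> :: "'g \<Rightarrow> 'a::{topological_ab_group_add, polish_space} \<Rightarrow> 'a"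
  assumes action: "G_module_action \<alpha>"
begin

lemma act_zero [simp]: "\<alpha> 0 a = a"
  and act_act: "\<alpha> g (\<alpha> h a) = \<alpha> (g + h) a"
  and act_add: "\<alpha> g (a + b) = \<alpha> g a + \<alpha> g b"
  and act_continuous: "continuous_on UNIV (\<lambda>(g, a). \<alpha> g a)"
  using action by (auto simp: G_module_action_def)

lemma act_0_right [simp]: "\<alpha> g 0 = 0"
  using act_add[of g 0 0] by simp

lemma act_minus: "\<alpha> g (- a) = - \<alpha> g a"
  using act_add[of g a "- a"] by (simp add: eq_neg_iff_add_eq_0 add.commute)

lemma act_alt: "\<alpha> g (alt i a) = alt i (\<alpha> g a)"
  by (simp add: alt_def act_minus)

lemma act_sum: "\<alpha> g (\<Sum>i\<in>I. f i) = (\<Sum>i\<in>I. \<alpha> g (f i))"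
  by (induction I rule: infinite_finite_induct) (simp_all add: act_add)

lemma tendsto_act: "(\<gamma> \<longlongrightarrow> g) F \<Longrightarrow> (f \<longlongrightarrow> a) F \<Longrightarrow> ((\<lambda>x. \<alpha> (\<gamma> x) (f x)) \<longlongrightarrow> \<alpha> g a) F"
  using continuous_on_tendsto_compose[OF act_continuous tendsto_Pair, of \<gamma> g F f a] by simp

lemma measurable_act [measurable (raw)]:
  assumes "f \<in> borel_measurable M" "h \<in> borel_measurable M"
  shows "(\<lambda>x. \<alpha> (f x) (h x)) \<in> borel_measurable M"
  by (rule borel_measurable_continuous_Pair[OF assms])
     (use act_continuous in \<open>simp add: case_prod_unfold\<close>)

text \<open>Equivariance is required at every point. An almost everywhere identity could not be used
  on heads with first entry 0, which may form a null set.\<close>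

definition cochain :: "nat \<Rightarrow> ((nat \<Rightarrow> 'g) \<Rightarrow> 'a) \<Rightarrow> bool" where
  "cochain n F \<longleftrightarrow> F \<in> borel_measurable borel \<and> depends_upto n F \<and> (\<forall>g x. F (translate g x) = \<alpha> g (F x))"

lemma cochain_measurable: "cochain n F \<Longrightarrow> F \<in> borel_measurable borel"
  and cochain_depends: "cochain n F \<Longrightarrow> depends_upto n F"
  and cochain_equiv: "cochain n F \<Longrightarrow> F (translate g x) = \<alpha> g (F x)"
  by (auto simp: cochain_def)

lemma cochain_0: "cochain n (\<lambda>x. 0)"
  by (simp add: cochain_def depends_upto_def)

lemma cochain_add: "cochain n F \<Longrightarrow> cochain n H \<Longrightarrow> cochain n (\<lambda>x. F x + H x)"
  unfolding cochain_def using depends_upto_compose2[of n F H "(+)"] by (auto simp: act_add)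

lemma cochain_minus: "cochain n F \<Longrightarrow> cochain n (\<lambda>x. - F x)"
  unfolding cochain_def
  using depends_upto_compose2[of n F F "\<lambda>a b. - a"] by (simp add: act_minus borel_measurable_uminus_group)

lemma cochain_diff: "cochain n F \<Longrightarrow> cochain n H \<Longrightarrow> cochain n (\<lambda>x. F x - H x)"
  using cochain_add[of n F "\<lambda>x. - H x"] cochain_minus by simp

lemma cochain_pcobd:
  assumes "cochain n F"
  shows "cochain (Suc n) (pcobd a b F)"
  unfolding cochain_def
proof (intro conjI allI)
  show "pcobd a b F \<in> borel_measurable borel" using assms by (intro measurable_pcobd cochain_measurable)
  show "depends_upto (Suc n) (pcobd a b F)"
    unfolding pcobd_def[abs_def] using assms
    by (intro depends_upto_sum depends_upto_alt depends_upto_face cochain_depends)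
  show "pcobd a b F (translate g x) = \<alpha> g (pcobd a b F x)" for g x
    by (simp add: pcobd_def act_sum act_alt translate_face[symmetric] cochain_equiv[OF assms])
qed

lemma AE_pcobd_cong:
  assumes "AE x in P. F x = H x"
  shows "AE x in P. pcobd a b F x = pcobd a b H x"
proof -
  have "AE x in P. \<forall>i. F (face i x) = H (face i x)"
    unfolding AE_all_countable using AE_face[OF assms] by blast
  then show ?thesis by eventually_elim (simp add: pcobd_def)
qed

text \<open>This is joint continuity of the action of the group on measurable functions with
  convergence in measure. Since only \<open>n\<close> variables matter, translating all coordinates
  amounts to translating finitely many.\<close>

lemma translate_cont_act:
  assumes [measurable]: "\<And>k. U k \<in> borel_measurable borel" "u \<in> borel_measurable borel"
    and dep: "\<And>k. depends_upto n (U k)" "depends_upto n u"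
    and \<gamma>: "\<gamma> \<longlonglongrightarrow> g" and lim: "(\<lambda>k. meas_dist P (U k) u) \<longlonglongrightarrow> 0"
  shows "(\<lambda>k. meas_dist P (\<lambda>h. \<alpha> (\<gamma> k) (U k (translate (- \<gamma> k) h))) (\<lambda>h. \<alpha> g (u (translate (- g) h)))) \<longlonglongrightarrow> 0"
proof -
  have "(\<lambda>k. - \<gamma> k) \<longlonglongrightarrow> - g" using \<gamma> by (rule tendsto_minus)
  from translate_upto_cont[OF assms(1,2) this lim, of n]
  have lim': "(\<lambda>k. meas_dist P (\<lambda>h. U k (translate (- \<gamma> k) h)) (\<lambda>h. u (translate (- g) h))) \<longlonglongrightarrow> 0"
    by (simp add: depends_upto_translate[OF dep(1)] depends_upto_translate[OF dep(2)])
  show ?thesis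
  proof (rule seq.P.meas_dist_tendsto_map[OF _ _ _ _ lim'])
    fix r :: "nat \<Rightarrow> nat" and x assume r: "strict_mono r"
      and *: "(\<lambda>k. U (r k) (translate (- \<gamma> (r k)) x)) \<longlonglongrightarrow> u (translate (- g) x)"
    have "(\<lambda>k. \<gamma> (r k)) \<longlonglongrightarrow> g" using LIMSEQ_subseq_LIMSEQ[OF \<gamma> r] by (simp add: o_def)
    then show "(\<lambda>k. \<alpha> (\<gamma> (r k)) (U (r k) (translate (- \<gamma> (r k)) x))) \<longlonglongrightarrow> \<alpha> g (u (translate (- g) x))"
      using * by (rule tendsto_act)
  qed auto
qed

text \<open>Continuity in the first \<open>m\<close> variables, as a map into the space of measurable functions of
  the remaining ones with the topology of convergence in measure.\<close>

definition cont_head :: "nat \<Rightarrow> ((nat \<Rightarrow> 'g) \<Rightarrow> 'a) \<Rightarrow> (nat \<Rightarrow> 'g) \<Rightarrow> bool" where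
  "cont_head m F x \<longleftrightarrow> (\<forall>X. X \<longlonglongrightarrow> x \<longrightarrow>
     (\<lambda>k. meas_dist P (\<lambda>h. F (comb_seq m (X k) h)) (\<lambda>h. F (comb_seq m x h))) \<longlonglongrightarrow> 0)"

text \<open>The identity tuple has its own clause because a single point is usually null and escapes
  the almost everywhere clause.\<close>

definition almost_cont_head :: "nat \<Rightarrow> ((nat \<Rightarrow> 'g) \<Rightarrow> 'a) \<Rightarrow> bool" where
  "almost_cont_head m F \<longleftrightarrow> (AE x in P. cont_head m F x) \<and> cont_head m F (\<lambda>_. 0)"

lemma cont_head_cong:
  assumes "cont_head m F x" "\<And>i. i < m \<Longrightarrow> x i = y i"
  shows "cont_head m F y"
  unfolding cont_head_def
proof (intro allI impI)
  fix X assume X: "X \<longlonglongrightarrow> y"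
  have "(\<lambda>k. comb_seq m (X k) (\<lambda>i. x (i + m))) \<longlonglongrightarrow> x"
    unfolding tendsto_fun_iff
  proof
    fix i
    show "(\<lambda>k. comb_seq m (X k) (\<lambda>i. x (i + m)) i) \<longlonglongrightarrow> x i"
      using X assms(2) by (cases "i < m") (auto simp: tendsto_fun_iff comb_seq_def)
  qed
  then have "(\<lambda>k. meas_dist P (\<lambda>h. F (comb_seq m (comb_seq m (X k) (\<lambda>i. x (i + m))) h)) (\<lambda>h. F (comb_seq m x h))) \<longlonglongrightarrow> 0"
    using assms(1) by (auto simp: cont_head_def)
  moreover have "comb_seq m (comb_seq m (X k) (\<lambda>i. x (i + m))) h = comb_seq m (X k) h" for k h
    by (auto simp: comb_seq_def)
  moreover have "comb_seq m x h = comb_seq m y h" for h using assms(2) by (auto simp: comb_seq_def)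
  ultimately show "(\<lambda>k. meas_dist P (\<lambda>h. F (comb_seq m (X k) h)) (\<lambda>h. F (comb_seq m y h))) \<longlonglongrightarrow> 0"
    by simp
qed

text \<open>The inverse translation carries approach to \<open>translate g x\<close> back to
  approach to \<open>x\<close>, and the action on measurable functions is continuous. Continuity at
  a generic head is thereby passed on to its normalised form.\<close>

lemma cont_head_translate:
  assumes F: "cochain n F" and "cont_head m F x"
  shows "cont_head m F (translate g x)"
  unfolding cont_head_def
proof (intro allI impI)
  note [measurable] = cochain_measurable[OF F]
  fix X assume X: "X \<longlonglongrightarrow> translate g x"
  define Y where "Y k = translate (- g) (X k)" for k
  have "Y \<longlonglongrightarrow> x"
    unfolding tendsto_fun_iff
  proof
    fix i
    have "(\<lambda>k. - g + X k i) \<longlonglongrightarrow> - g + (g + x i)"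
      using X by (intro tendsto_intros) (auto simp: tendsto_fun_iff translate_def)
    then show "(\<lambda>k. Y k i) \<longlonglongrightarrow> x i" by (simp add: Y_def translate_def add.assoc[symmetric])
  qed
  then have lim: "(\<lambda>k. meas_dist P (\<lambda>h. F (comb_seq m (Y k) h)) (\<lambda>h. F (comb_seq m x h))) \<longlonglongrightarrow> 0"
    using assms(2) by (auto simp: cont_head_def)
  have "(\<lambda>k. meas_dist P (\<lambda>h. \<alpha> g (F (comb_seq m (Y k) (translate (- g) h)))) (\<lambda>h. \<alpha> g (F (comb_seq m x (translate (- g) h))))) \<longlonglongrightarrow> 0"
    by (rule translate_cont_act[OF _ _ _ _ tendsto_const lim, where n = "n - m"])
       (auto intro!: depends_upto_comb_seq cochain_depends[OF F])
  then show "(\<lambda>k. meas_dist P (\<lambda>h. F (comb_seq m (X k) h)) (\<lambda>h. F (comb_seq m (translate g x) h))) \<longlonglongrightarrow> 0"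
    by (simp add: cochain_equiv[OF F, symmetric] translate_comb_seq translate_translate Y_def)
qed

lemma cont_head_1:
  assumes F: "cochain n F"
  shows "cont_head 1 F x"
  unfolding cont_head_def
proof (intro allI impI)
  note [measurable] = cochain_measurable[OF F]
  fix X :: "nat \<Rightarrow> nat \<Rightarrow> 'g" assume X: "X \<longlonglongrightarrow> x"
  define C where "C h = F (comb_seq 1 (\<lambda>_. 0) h)" for h
  have [measurable]: "C \<in> borel_measurable borel" unfolding C_def by measurable
  \<comment> \<open>With a single head variable, equivariance exhibits the family as one orbit: it
    is \<open>C\<close> moved by \<open>y 0\<close>.\<close>
  have "F (comb_seq 1 y h) = \<alpha> (y 0) (C (translate (- y 0) h))" for y h
  proof -
    have "\<alpha> (y 0) (C (translate (- y 0) h)) = F (comb_seq 1 (\<lambda>_. y 0) h)"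
      by (simp only: C_def cochain_equiv[OF F, symmetric] translate_comb_seq translate_translate)
         (simp add: translate_def)
    moreover have "comb_seq 1 (\<lambda>_. y 0) h = comb_seq 1 y h" by (auto simp: comb_seq_def)
    ultimately show ?thesis by simp
  qed
  moreover have "(\<lambda>k. meas_dist P (\<lambda>h. \<alpha> (X k 0) (C (translate (- X k 0) h))) (\<lambda>h. \<alpha> (x 0) (C (translate (- x 0) h)))) \<longlonglongrightarrow> 0"
  proof (rule translate_cont_act[where n = "n - 1"])
    show "depends_upto (n - 1) C" "depends_upto (n - 1) C"
      unfolding C_def by (intro depends_upto_comb_seq cochain_depends[OF F])+
    show "(\<lambda>k. X k 0) \<longlonglongrightarrow> x 0" using X by (simp add: tendsto_fun_iff)
  qed (auto simp: meas_dist_def)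
  ultimately show "(\<lambda>k. meas_dist P (\<lambda>h. F (comb_seq 1 (X k) h)) (\<lambda>h. F (comb_seq 1 x h))) \<longlonglongrightarrow> 0"
    by simp
qed

text \<open>Omitting one of the first \<open>m + 1\<close> variables leaves a head of length
  \<open>m\<close>, so the sum is continuous wherever all these faces are good; faces of generic
  points are generic, and those of the identity tuple are identity tuples. The minus sign
  anticipates moving the head coboundary to the other side of the cocycle identity.\<close>

lemma almost_cont_head_pcobd:
  assumes F: "cochain n F" and "almost_cont_head m F"
  shows "almost_cont_head (Suc m) (\<lambda>x. - pcobd 0 (Suc m) F x)"
proof -
  note [measurable] = cochain_measurable[OF F]
  have *: "cont_head (Suc m) (\<lambda>x. - pcobd 0 (Suc m) F x) x" if c: "\<And>i. cont_head m F (face i x)" for x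
    unfolding cont_head_def
  proof (intro allI impI)
    fix X assume X: "X \<longlonglongrightarrow> x"
    have "(\<lambda>k. meas_dist P (\<lambda>h. F (comb_seq m (face i (X k)) h)) (\<lambda>h. F (comb_seq m (face i x) h))) \<longlonglongrightarrow> 0" for i
      using c[of i] tendsto_face[OF X, of i] by (auto simp: cont_head_def)
    then have "(\<lambda>k. meas_dist P (\<lambda>h. alt (Suc i) (F (comb_seq m (face i (X k)) h))) (\<lambda>h. alt (Suc i) (F (comb_seq m (face i x) h)))) \<longlonglongrightarrow> 0" for i
      by (rule seq.P.meas_dist_tendsto_map[rotated 4]) (auto intro: tendsto_alt)
    then have "(\<lambda>k. meas_dist P (\<lambda>h. \<Sum>i=0..<Suc m. alt (Suc i) (F (comb_seq m (face i (X k)) h)))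
        (\<lambda>h. \<Sum>i=0..<Suc m. alt (Suc i) (F (comb_seq m (face i x) h)))) \<longlonglongrightarrow> 0"
      by (intro seq.P.meas_dist_sum_tendsto) auto
    moreover have "- pcobd 0 (Suc m) F (comb_seq (Suc m) y h) = (\<Sum>i=0..<Suc m. alt (Suc i) (F (comb_seq m (face i y) h)))" for y h
      unfolding pcobd_def sum_negf[symmetric]
      by (rule sum.cong) (auto simp: face_comb_seq_head alt_Suc)
    ultimately show "(\<lambda>k. meas_dist P (\<lambda>h. - pcobd 0 (Suc m) F (comb_seq (Suc m) (X k) h))
        (\<lambda>h. - pcobd 0 (Suc m) F (comb_seq (Suc m) x h))) \<longlonglongrightarrow> 0"
      by simp
  qed
  have "AE x in P. \<forall>i. cont_head m F (face i x)"
    unfolding AE_all_countable using AE_face assms(2) by (auto simp: almost_cont_head_def)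
  then have "AE x in P. cont_head (Suc m) (\<lambda>x. - pcobd 0 (Suc m) F x) x"
    by eventually_elim (use * in blast)
  moreover have "cont_head (Suc m) (\<lambda>x. - pcobd 0 (Suc m) F x) (\<lambda>_. 0)"
    using assms(2) by (intro *) (simp add: face_def almost_cont_head_def)
  ultimately show ?thesis by (simp add: almost_cont_head_def)
qed

lemma tcobd_tendsto:
  fixes e :: "(nat \<Rightarrow> 'g) \<Rightarrow> 'a"
  assumes [measurable]: "\<And>k. E k \<in> borel_measurable borel" "e \<in> borel_measurable borel"
    and "(\<lambda>k. meas_dist P (E k) e) \<longlonglongrightarrow> 0"
  shows "(\<lambda>k. meas_dist P (tcobd m q (E k)) (tcobd m q e)) \<longlonglongrightarrow> 0"
proof -
  have "(\<lambda>k. meas_dist P (\<lambda>h. E k (face i h)) (\<lambda>h. e (face i h))) \<longlonglongrightarrow> 0" for i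
    using assms(3) meas_dist_face[OF assms(1,2)] by simp
  then have "(\<lambda>k. meas_dist P (\<lambda>h. alt (m + i) (E k (face i h))) (\<lambda>h. alt (m + i) (e (face i h)))) \<longlonglongrightarrow> 0" for i
    by (rule seq.P.meas_dist_tendsto_map[rotated 4]) (auto intro: tendsto_alt)
  then show ?thesis
    unfolding tcobd_def[abs_def] by (intro seq.P.meas_dist_sum_tendsto) auto
qed

end

section \<open>Lifting through the tail coboundary\<close>

lemma AE_fst_pairI:
  assumes "prob_space B" "AE x in A. R x"
  shows "AE z in A \<Otimes>\<^sub>M B. R (fst z)"
proof -
  interpret B: prob_space B by fact
  from assms(2) obtain N where N: "N \<in> null_sets A" "{x \<in> space A. \<not> R x} \<subseteq> N"
    by (auto simp: eventually_ae_filter)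
  have "emeasure (A \<Otimes>\<^sub>M B) (N \<times> space B) = emeasure A N * emeasure B (space B)"
    using N(1) by (intro B.emeasure_pair_measure_Times) auto
  then have "N \<times> space B \<in> null_sets (A \<Otimes>\<^sub>M B)"
    using N(1) by (auto simp: null_sets_def)
  then show ?thesis
    by (rule AE_I') (use N(2) in \<open>auto simp: space_pair_measure\<close>)
qed

lemma (in quasi_invariant) AE_L_ex:
  assumes "AE t in L. R t"
  shows "\<exists>t. R t"
proof (rule ccontr)
  assume "\<not> ?thesis"
  then have "R = (\<lambda>t. False)" by auto
  with assms have "AE t in L. False" by simp
  then show False by (simp only: AE_False)
qed

context polish_module
begin

text \<open>Freezing the last variable at a generic value splits the tail coboundary.\<close>

lemma tcobd_exact:
  fixes w :: "nat \<Rightarrow> (nat \<Rightarrow> 'g) \<Rightarrow> 'a"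
  assumes [measurable]: "\<And>k. w k \<in> borel_measurable borel" and dep: "\<And>k. depends_upto (Suc j) (w k)"
    and cl: "\<And>k. AE h in P. tcobd m (Suc (Suc j)) (w k) h = 0" and Q: "AE h in P. Q (\<lambda>k. w k h)"
  obtains v where "\<And>k. v k \<in> borel_measurable borel" "\<And>k. depends_upto j (v k)"
    "\<And>k. AE h in P. tcobd m (Suc j) (v k) h = w k h" "AE h in P. Q (\<lambda>k. alt (m + j) (v k h))"
proof -
  \<comment> \<open>One \<open>t\<close> is used for the whole sequence, so that a property
    \<open>Q\<close> of the sequence, such as convergence to 0, passes to the primitives.\<close>
  have "AE h in P. \<forall>k. tcobd m (Suc (Suc j)) (w k) h = 0"
    using cl by (simp add: AE_all_countable)
  then have "AE t in L. AE h in P. \<forall>k. tcobd m (Suc (Suc j)) (w k) (h(Suc j := t)) = 0"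
    by (rule AE_upd)
  moreover have "AE t in L. AE h in P. Q (\<lambda>k. w k (h(j := t)))"
    using Q by (rule AE_upd)
  ultimately have "AE t in L. (AE h in P. \<forall>k. tcobd m (Suc (Suc j)) (w k) (h(Suc j := t)) = 0) \<and>
      (AE h in P. Q (\<lambda>k. w k (h(j := t))))"
    by eventually_elim simp
  then obtain t where t: "AE h in P. \<forall>k. tcobd m (Suc (Suc j)) (w k) (h(Suc j := t)) = 0"
    "AE h in P. Q (\<lambda>k. w k (h(j := t)))"
    using AE_L_ex by blast
  define v where "v k h = alt (m + j) (w k (h(j := t)))" for k h
  show ?thesis
  proof (rule that[of v])
    show "v k \<in> borel_measurable borel" for k unfolding v_def by measurable
    show "depends_upto j (v k)" for k
      unfolding depends_upto_def
    proof (intro allI impI)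
      fix x y :: "nat \<Rightarrow> 'g" assume xy: "\<forall>i<j. x i = y i"
      have "w k (x(j := t)) = w k (y(j := t))"
        by (rule depends_uptoD[OF dep]) (use xy in \<open>auto simp: less_Suc_eq\<close>)
      then show "v k x = v k y" by (simp add: v_def)
    qed
    show "AE h in P. tcobd m (Suc j) (v k) h = w k h" for k
      using t(1)
    proof eventually_elim
      case (elim h)
      have face_eq: "w k (face i (h(Suc j := t))) = w k ((face i h)(j := t))" if "i < Suc j" for i
        by (rule depends_uptoD[OF dep]) (use that in \<open>auto simp: face_def\<close>)
      have last: "w k (face (Suc j) (h(Suc j := t))) = w k h"
        by (rule depends_uptoD[OF dep]) (auto simp: face_def)
      have "0 = tcobd m (Suc (Suc j)) (w k) (h(Suc j := t))" using elim by simp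
      also have "\<dots> = (\<Sum>i<Suc j. alt (m + i) (w k (face i (h(Suc j := t))))) + alt (m + Suc j) (w k h)"
        unfolding tcobd_def by (subst sum.lessThan_Suc) (simp only: last)
      also have "(\<Sum>i<Suc j. alt (m + i) (w k (face i (h(Suc j := t))))) = (\<Sum>i<Suc j. alt (m + i) (w k ((face i h)(j := t))))"
        by (intro sum.cong refl) (simp add: face_eq)
      finally have "(\<Sum>i<Suc j. alt (m + i) (w k ((face i h)(j := t)))) = alt (m + j) (w k h)"
        by (simp add: alt_Suc)
      then have "alt (m + j) (\<Sum>i<Suc j. alt (m + i) (w k ((face i h)(j := t)))) = w k h"
        by simp
      then show ?case
        by (simp only: tcobd_def v_def alt_sum alt_comm[of "m + j"])
    qed
    show "AE h in P. Q (\<lambda>k. alt (m + j) (v k h))" using t(2) by (simp add: v_def)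
  qed
qed

lemma tcobd_translate:
  "tcobd m q (\<lambda>h. \<alpha> g (e (translate g' h))) h = \<alpha> g (tcobd m q e (translate g' h))"
  by (simp add: tcobd_def act_sum act_alt translate_face)

lemma tcobd_add: "tcobd m q (\<lambda>h. e h + f h) h = tcobd m q e h + tcobd m q f h"
  by (simp add: tcobd_def alt_add sum.distrib)

lemma tcobd_diff: "tcobd m q (\<lambda>h. e h - f h) h = tcobd m q e h - tcobd m q (f :: (nat \<Rightarrow> 'g) \<Rightarrow> 'a) h"
proof -
  have "alt i (x - y) = alt i x - alt i y" for i and x y :: 'a by (simp add: alt_def)
  then show ?thesis by (simp add: tcobd_def sum_subtractf)
qed

text \<open>The cochain \<open>T\<close> shows that \<open>c\<close> is a tail cocycle for almost
  every head. A new primitive, almost continuous in the head, is selected for normalised heads only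
  and extended to all heads by equivariance.\<close>

lemma almost_cont_lift:
  assumes m: "1 \<le> m" "m \<le> n" and T: "cochain n T" and c: "cochain (Suc n) c" "almost_cont_head m c"
    and Tc: "AE x in P. pcobd m (Suc n) T x = c x"
  obtains F where "cochain n F" "almost_cont_head m F" "AE x in P. pcobd m (Suc n) F x = c x"
proof -
  define j where "j = n - m"
  have n: "n = m + j" using m by (simp add: j_def)
  note [measurable] = cochain_measurable[OF T] cochain_measurable[OF c(1)]
  define z where "z x h = c (comb_seq m x h)" for x h
  have zm [measurable]: "z x \<in> borel_measurable borel" for x unfolding z_def by measurable
  have zd: "depends_upto (Suc j) (z x)" for x
    using depends_upto_comb_seq[OF cochain_depends[OF c(1)], of m x] n unfolding z_def by simp
  define Z where "Z x \<longleftrightarrow> (AE h in P. tcobd m (Suc (Suc j)) (z x) h = 0)" for x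
  have AE_Z: "AE x in P. Z x"
  proof -
    have "AE x in P. pcobd m (Suc (Suc n)) c x = 0"
      using AE_pcobd_cong[OF Tc, of m "Suc (Suc n)"] by eventually_elim (simp add: pcobd_pcobd)
    from AE_comb_seqD[OF this, of m] show ?thesis
      unfolding Z_def z_def using pcobd_comb_seq[of m "Suc (Suc j)" c] n by simp
  qed
  define S where "S = {x. cont_head m c x \<and> Z x}"
  have zlim: "(\<lambda>k. meas_dist P (z (X k)) (z x)) \<longlonglongrightarrow> 0" if "cont_head m c x" "X \<longlonglongrightarrow> x" for x X
    using that unfolding cont_head_def z_def by blast
  \<comment> \<open>The head moved so that its first entry is 0, padded by zeros: a representative
    of the orbit of the head that depends continuously on it.\<close>
  define N where "N g i = (if i < m then - g 0 + g i else 0)" for g :: "nat \<Rightarrow> 'g" and i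
  have [measurable]: "N \<in> borel_measurable borel"
    by (rule measurable_coordinatewise_then_product) (simp add: N_def)
  have Ncont: "X \<longlonglongrightarrow> g \<Longrightarrow> (\<lambda>k. N (X k)) \<longlonglongrightarrow> N g" for X g
    unfolding tendsto_fun_iff N_def by (auto intro!: tendsto_intros)
  have zN: "z (N g) h = \<alpha> (- g 0) (z g (translate (g 0) h))" for g h
  proof -
    have "z (N g) h = c (comb_seq m (translate (- g 0) g) h)"
      unfolding z_def by (rule arg_cong[where f = c]) (auto simp: comb_seq_def N_def translate_def)
    also have "\<dots> = c (translate (- g 0) (comb_seq m g (translate (g 0) h)))"
      by (simp add: translate_comb_seq translate_translate)
    finally show ?thesis by (simp add: cochain_equiv[OF c(1)] z_def)
  qed
  \<comment> \<open>The law of \<open>N g\<close> is carried by heads with first entry 0, so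
    genericity of \<open>g\<close> does not transfer by absolute continuity. It transfers because
    \<open>c\<close> is strictly equivariant and tail translations preserve null sets.\<close>
  have NS: "AE g in P. N g \<in> S"
    using AE_Z c(2)[unfolded almost_cont_head_def, THEN conjunct1]
  proof eventually_elim
    case (elim g)
    have "cont_head m c (N g)"
      by (rule cont_head_cong[OF cont_head_translate[OF c(1) elim(2), of "- g 0"]]) (simp add: N_def translate_def)
    moreover have "AE h in P. tcobd m (Suc (Suc j)) (z g) (translate_upto (Suc (Suc j)) (g 0) h) = 0"
      using elim(1) unfolding Z_def by (rule AE_translate_upto)
    then have "Z (N g)"
      unfolding Z_def zN[abs_def] tcobd_translate
      by eventually_elim (simp add: depends_upto_translate[OF depends_upto_tcobd[OF zd]])
    ultimately show ?case by (simp add: S_def)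
  qed
  \<comment> \<open>By full support the identity tuple is a limit of heads where \<open>c\<close> is
    a tail cocycle; continuity of \<open>c\<close> there lets the identity pass to the limit in
    measure.\<close>
  have S0: "(\<lambda>_. 0) \<in> S"
  proof -
    obtain X where X: "X \<longlonglongrightarrow> (\<lambda>_. 0)" "\<And>k::nat. Z (X k)" using AE_P_seq[OF AE_Z] by blast
    have ct: "cont_head m c (\<lambda>_. 0)" using c(2) by (simp add: almost_cont_head_def)
    have 1: "(\<lambda>k. meas_dist P (tcobd m (Suc (Suc j)) (z (X k))) (tcobd m (Suc (Suc j)) (z (\<lambda>_. 0)))) \<longlonglongrightarrow> 0"
      by (rule tcobd_tendsto[OF zm zm zlim[OF ct X(1)]])
    have "AE h in P. \<forall>k. tcobd m (Suc (Suc j)) (z (X k)) h = 0"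
      using X(2) by (simp add: AE_all_countable Z_def)
    then have 2: "(\<lambda>k. meas_dist P (tcobd m (Suc (Suc j)) (z (X k))) (\<lambda>_. 0)) \<longlonglongrightarrow> 0"
      by (intro seq.P.meas_dist_tendsto_AE) auto
    have "Z (\<lambda>_. 0)"
      unfolding Z_def by (rule seq.P.meas_dist_tendsto_unique[OF _ _ _ 1 2]) auto
    with ct show ?thesis by (simp add: S_def)
  qed
  define Lft where "Lft x e \<longleftrightarrow> e \<in> borel_measurable borel \<and> depends_upto j e \<and>
     (AE h in P. tcobd m (Suc j) e h = z x h)" for x and e :: "(nat \<Rightarrow> 'g) \<Rightarrow> 'a"
  have ne: "\<exists>e. Lft x e" if "x \<in> S" for x
    by (rule tcobd_exact[of "\<lambda>_. z x" j m "\<lambda>_. True"])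
       (use that zd in \<open>auto simp: S_def Z_def Lft_def\<close>)
  \<comment> \<open>Openness is checked along sequences by means of explicit primitives. If the
    heads converge, a subsequence of the tail cocycles converges almost everywhere; the differences
    are tail cocycles tending to 0, their primitives by freezing also tend to 0, and adding these to
    \<open>e\<close> gives nearby lifts.\<close>
  have opn: "\<exists>V. open V \<and> x \<in> V \<and> (\<forall>y\<in>V \<inter> S. \<exists>e'. Lft y e' \<and> meas_dist P e e' < \<epsilon>)"
    if x: "x \<in> S" and e: "Lft x e" and \<epsilon>: "0 < \<epsilon>" for x e \<epsilon>
  proof -
    note [measurable] = e[unfolded Lft_def, THEN conjunct1]
    define R where "R y \<longleftrightarrow> (\<exists>e'. Lft y e' \<and> meas_dist P e e' < \<epsilon>)" for y
    have "eventually R (inf (nhds x) (principal S))"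
    proof (rule sequentially_imp_eventually_nhds_within, intro allI impI, elim conjE, rule ccontr)
      fix Y assume Y: "\<forall>k. Y k \<in> S" "Y \<longlonglongrightarrow> x" and "\<not> eventually (\<lambda>k. R (Y k)) sequentially"
      then have inf: "infinite {k. \<not> R (Y k)}"
        by (simp add: frequently_cofinite[symmetric] cofinite_eq_sequentially frequently_def)
      define r where "r = enumerate {k. \<not> R (Y k)}"
      have r: "strict_mono r" "\<And>k. \<not> R (Y (r k))"
        using inf unfolding r_def by (auto simp: strict_mono_enumerate dest: enumerate_in_set)
      have "(\<lambda>k. Y (r k)) \<longlonglongrightarrow> x" using LIMSEQ_subseq_LIMSEQ[OF Y(2) r(1)] by (simp add: o_def)
      then have "(\<lambda>k. meas_dist P (z (Y (r k))) (z x)) \<longlonglongrightarrow> 0"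
        using x by (intro zlim) (auto simp: S_def)
      then obtain s :: "nat \<Rightarrow> nat" where s: "AE h in P. (\<lambda>k. z (Y (r (s k))) h) \<longlonglongrightarrow> z x h"
        using seq.P.meas_dist_AE_subseq[of "\<lambda>k. z (Y (r k))" "z x"] by auto
      define w where "w k h = z (Y (r (s k))) h - z x h" for k h
      have w1: "AE h in P. (\<lambda>k. w k h) \<longlonglongrightarrow> 0"
        using s
      proof eventually_elim
        case (elim h)
        from tendsto_diff[OF elim tendsto_const[of "z x h"]] show ?case by (simp add: w_def)
      qed
      have w2: "AE h in P. tcobd m (Suc (Suc j)) (w k) h = 0" for k
      proof -
        have "Z (Y (r (s k)))" "Z x" using Y(1) x by (auto simp: S_def)
        then show ?thesis unfolding Z_def w_def[abs_def] tcobd_diff by eventually_elim simp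
      qed
      have w3: "w k \<in> borel_measurable borel" for k unfolding w_def by measurable
      have w4: "depends_upto (Suc j) (w k)" for k
        unfolding w_def[abs_def] by (rule depends_upto_compose2[OF zd zd])
      obtain v where v: "\<And>k. v k \<in> borel_measurable borel" "\<And>k. depends_upto j (v k)"
        "\<And>k. AE h in P. tcobd m (Suc j) (v k) h = w k h" "AE h in P. (\<lambda>k. alt (m + j) (v k h)) \<longlonglongrightarrow> 0"
        by (rule tcobd_exact[of w j m "\<lambda>f. f \<longlonglongrightarrow> 0", OF w3 w4 w2 w1]) blast
      note [measurable] = v(1)
      have Lv: "Lft (Y (r (s k))) (\<lambda>h. e h + v k h)" for k
        unfolding Lft_def
      proof (intro conjI)
        show "(\<lambda>h. e h + v k h) \<in> borel_measurable borel" by measurable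
        show "depends_upto j (\<lambda>h. e h + v k h)"
          using e[unfolded Lft_def] v(2)[of k] depends_upto_compose2[of j e "v k" "(+)"] by blast
        from v(3)[of k] e[unfolded Lft_def, THEN conjunct2, THEN conjunct2]
        show "AE h in P. tcobd m (Suc j) (\<lambda>h. e h + v k h) h = z (Y (r (s k))) h"
          unfolding tcobd_add by eventually_elim (simp add: w_def)
      qed
      have "AE h in P. (\<lambda>k. e h + v k h) \<longlonglongrightarrow> e h"
        using v(4)
      proof eventually_elim
        case (elim h)
        from tendsto_alt[OF elim, of "m + j"] have "(\<lambda>k. v k h) \<longlonglongrightarrow> 0" by simp
        from tendsto_add[OF tendsto_const this, of "e h"] show ?case by simp
      qed
      then have "(\<lambda>k. meas_dist P (\<lambda>h. e h + v k h) e) \<longlonglongrightarrow> 0"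
        by (intro seq.P.meas_dist_tendsto_AE) auto
      then have "eventually (\<lambda>k. meas_dist P (\<lambda>h. e h + v k h) e < \<epsilon>) sequentially"
        using \<epsilon> by (rule order_tendstoD)
      then obtain k where "meas_dist P (\<lambda>h. e h + v k h) e < \<epsilon>"
        by (auto simp: eventually_sequentially)
      then have "meas_dist P e (\<lambda>h. e h + v k h) < \<epsilon>"
        unfolding seq.P.meas_dist_commute[of e] .
      with Lv have "R (Y (r (s k)))" unfolding R_def by blast
      with r(2) show False by blast
    qed
    then obtain V where "open V" "x \<in> V" "\<And>y. y \<in> V \<Longrightarrow> y \<in> S \<Longrightarrow> R y"
      by (auto simp: eventually_inf_principal eventually_nhds)
    then show ?thesis unfolding R_def by blast
  qed
  have cls: "Lft x e" if "x \<in> S" "\<And>k::nat. Lft x (E k)" and em [measurable]: "e \<in> borel_measurable borel"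
    and ed: "depends_upto j e" and lim: "(\<lambda>k. meas_dist P (E k) e) \<longlonglongrightarrow> 0" for x e E
  proof -
    have [measurable]: "E k \<in> borel_measurable borel" for k using that(2) by (simp add: Lft_def)
    have "AE h in P. \<forall>k. tcobd m (Suc j) (E k) h = z x h"
      using that(2) by (simp add: AE_all_countable Lft_def)
    then have 1: "(\<lambda>k. meas_dist P (tcobd m (Suc j) (E k)) (z x)) \<longlonglongrightarrow> 0"
      by (intro seq.P.meas_dist_tendsto_AE) auto
    have 2: "(\<lambda>k. meas_dist P (tcobd m (Suc j) (E k)) (tcobd m (Suc j) e)) \<longlonglongrightarrow> 0"
      by (rule tcobd_tendsto[OF _ _ lim]) auto
    have "AE h in P. tcobd m (Suc j) e h = z x h"
      by (rule seq.P.meas_dist_tendsto_unique[OF _ _ _ 2 1]) auto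
    then show ?thesis using em ed by (simp add: Lft_def)
  qed
  \<comment> \<open>A fair coin decides between the normalised generic head and the identity tuple.
    The law of \<open>N'\<close> thus has an atom at the identity tuple, where the selection is
    forced to be correct and continuous.\<close>
  define B where "B = measure_pmf (bernoulli_pmf (1/2))"
  interpret B: prob_space B unfolding B_def by (rule prob_space_measure_pmf)
  interpret PB: pair_prob_space P B ..
  define N' where "N' z = (if snd z then N (fst z) else (\<lambda>_. 0))" for z
  have "sets B = sets (count_space UNIV)" by (simp add: B_def)
  then have [measurable]: "snd \<in> measurable (P \<Otimes>\<^sub>M B) (count_space UNIV)"
    using measurable_snd[of P B] measurable_cong_sets[OF refl, of B "count_space UNIV"] by blast
  have [measurable]: "fst \<in> borel_measurable (P \<Otimes>\<^sub>M B)"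
    using measurable_fst[of P B] by simp
  have N'm: "N' \<in> borel_measurable (P \<Otimes>\<^sub>M B)"
    unfolding N'_def by measurable
  have N'S: "AE z in P \<Otimes>\<^sub>M B. N' z \<in> S"
    using AE_fst_pairI[OF B.prob_space_axioms NS]
    by eventually_elim (use S0 in \<open>simp add: N'_def\<close>)
  have Lm: "e \<in> borel_measurable borel" and Ld: "depends_upto j e" if "Lft x e" for x e
    using that by (auto simp: Lft_def)
  obtain b where b: "(\<lambda>(x, h). b x h) \<in> borel_measurable (borel \<Otimes>\<^sub>M borel)" "\<And>x. depends_upto j (b x)"
    "AE z in P \<Otimes>\<^sub>M B. Lft (N' z) (b (N' z))"
    "AE z in P \<Otimes>\<^sub>M B. \<forall>X. X \<longlonglongrightarrow> N' z \<longrightarrow> (\<lambda>k. meas_dist P (b (X k)) (b (N' z))) \<longlonglongrightarrow> 0"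
  proof (rule almost_continuous_selection[OF PB.P.finite_measure_axioms N'm N'S])
    show "\<exists>V. open V \<and> x \<in> V \<and> (\<forall>y\<in>V \<inter> S. \<exists>e'. Lft y e' \<and> meas_dist P e e' < \<epsilon>)"
      if "x \<in> S" "Lft x e" "0 < \<epsilon>" for x e \<epsilon> by (rule opn[OF that])
    show "Lft x e" if "x \<in> S" "\<And>k::nat. Lft x (E k)" "e \<in> borel_measurable borel" "depends_upto j e"
      "(\<lambda>k. meas_dist P (E k) e) \<longlonglongrightarrow> 0" for x e E by (rule cls[OF that])
  qed (rule Lm Ld ne that; assumption)+
  have bm [measurable]: "b x \<in> borel_measurable borel" for x
    by (rule measurable_section_borel[OF b(1)])
  \<comment> \<open>Both outcomes of the coin have positive probability, so a statement holding
    almost surely holds at the identity tuple itself and at almost every normalised head.\<close>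
  have AE_B: "AE g in P. Q (N g)" "Q (\<lambda>_. 0)" if "AE z in P \<Otimes>\<^sub>M B. Q (N' z)" for Q
  proof -
    have *: "AE g in P. Q (N g) \<and> Q (\<lambda>_. 0)"
      using PB.AE_pair[OF that]
    proof eventually_elim
      case (elim g)
      then have "Q (N' (g, True))" "Q (N' (g, False))"
        unfolding B_def by (auto simp: AE_measure_pmf_iff)
      then show ?case by (simp_all add: N'_def)
    qed
    then show "AE g in P. Q (N g)" by eventually_elim simp
    from AE_P_dense[OF *, of UNIV undefined] show "Q (\<lambda>_. 0)" by simp
  qed
  note bL = AE_B[OF b(3)]
  note bC = AE_B[OF b(4)]
  \<comment> \<open>The choice made for the normalised head is carried back by \<open>g 0\<close>.
    Both \<open>N g\<close> and the tail translated by \<open>- g 0\<close> are invariant under left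
    translation of \<open>g\<close>, which makes \<open>F\<close> exactly equivariant.\<close>
  define F where "F g = \<alpha> (g 0) (b (N g) (translate (- g 0) (\<lambda>i. g (m + i))))" for g
  have Fcomb: "F (comb_seq m g h) = \<alpha> (g 0) (b (N g) (translate (- g 0) h))" for g h
  proof -
    have "N (comb_seq m g h) = N g" using m by (auto simp: N_def comb_seq_def)
    moreover have "comb_seq m g h 0 = g 0" using m by (simp add: comb_seq_def)
    ultimately show ?thesis by (simp add: F_def comb_seq_def)
  qed
  have F: "cochain n F"
    unfolding cochain_def
  proof (intro conjI allI)
    have [measurable]: "(\<lambda>g i. g (m + i)) \<in> borel_measurable (borel :: (nat \<Rightarrow> 'g) measure)"
      by (rule measurable_coordinatewise_then_product) simp
    have "(\<lambda>g. (case (N g, translate (- g 0) (\<lambda>i. g (m + i))) of (x, h) \<Rightarrow> b x h)) \<in> borel_measurable borel"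
      by (rule measurable_compose[OF _ b(1)]) measurable
    then show "F \<in> borel_measurable borel" unfolding F_def[abs_def] by simp
    show "depends_upto n F"
      unfolding depends_upto_def
    proof (intro allI impI)
      fix x y :: "nat \<Rightarrow> 'g" assume xy: "\<forall>i<n. x i = y i"
      then have "N x = N y" "x 0 = y 0" using m n by (auto simp: N_def fun_eq_iff)
      moreover have "b (N y) (translate (- y 0) (\<lambda>i. x (m + i))) = b (N y) (translate (- y 0) (\<lambda>i. y (m + i)))"
        by (rule depends_uptoD[OF b(2)]) (use xy n in \<open>auto simp: translate_def\<close>)
      ultimately show "F x = F y" by (simp add: F_def)
    qed
    fix g x
    have cancel: "- (g + y) + (g + y') = - y + y'" for y y' :: 'g
      by (simp only: minus_add add.assoc minus_add_cancel)
    have "N (translate g x) = N x"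
      by (auto simp: N_def translate_def fun_eq_iff cancel)
    moreover have "translate (- translate g x 0) (\<lambda>i. translate g x (m + i)) = translate (- x 0) (\<lambda>i. x (m + i))"
      by (auto simp: translate_def fun_eq_iff cancel)
    ultimately show "F (translate g x) = \<alpha> g (F x)"
      by (simp add: F_def act_act translate_def)
  qed
  have cF: "cont_head m F g" if "\<forall>X. X \<longlonglongrightarrow> N g \<longrightarrow> (\<lambda>k. meas_dist P (b (X k)) (b (N g))) \<longlonglongrightarrow> 0" for g
    unfolding cont_head_def Fcomb
  proof (intro allI impI)
    fix X assume X: "X \<longlonglongrightarrow> g"
    show "(\<lambda>k. meas_dist P (\<lambda>h. \<alpha> (X k 0) (b (N (X k)) (translate (- X k 0) h)))
        (\<lambda>h. \<alpha> (g 0) (b (N g) (translate (- g 0) h)))) \<longlonglongrightarrow> 0"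
    proof (rule translate_cont_act[OF bm bm b(2) b(2)])
      show "(\<lambda>k. X k 0) \<longlonglongrightarrow> g 0" using X by (simp add: tendsto_fun_iff)
      show "(\<lambda>k. meas_dist P (b (N (X k))) (b (N g))) \<longlonglongrightarrow> 0" using that Ncont[OF X] by blast
    qed
  qed
  have "N (\<lambda>_. 0) = (\<lambda>_. 0)" by (auto simp: N_def)
  then have "almost_cont_head m F"
    unfolding almost_cont_head_def using bC cF by (auto elim: eventually_mono)
  moreover have "AE x in P. pcobd m (Suc n) F x = c x"
  proof (rule AE_comb_seqI[where m = m])
    note [measurable] = cochain_measurable[OF F]
    show "{x. pcobd m (Suc n) F x = c x} \<in> sets borel"
      using measurable_equality_set[of "pcobd m (Suc n) F" borel c] by simp
    show "AE g in P. AE h in P. pcobd m (Suc n) F (comb_seq m g h) = c (comb_seq m g h)"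
      using bL(1)
    proof eventually_elim
      case (elim g)
      then have "AE h in P. tcobd m (Suc j) (b (N g)) (translate_upto (Suc j) (- g 0) h) =
          z (N g) (translate_upto (Suc j) (- g 0) h)"
        unfolding Lft_def using AE_translate_upto by blast
      then show ?case
      proof eventually_elim
        case (elim h)
        then have *: "tcobd m (Suc j) (b (N g)) (translate (- g 0) h) = z (N g) (translate (- g 0) h)"
          by (simp add: depends_upto_translate[OF depends_upto_tcobd[OF b(2)]] depends_upto_translate[OF zd])
        have "pcobd m (Suc n) F (comb_seq m g h) = tcobd m (Suc j) (\<lambda>h. F (comb_seq m g h)) h"
          using pcobd_comb_seq[of m "Suc j" F g h] n by simp
        also have "\<dots> = \<alpha> (g 0) (z (N g) (translate (- g 0) h))"
          unfolding Fcomb tcobd_translate * ..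
        also have "\<dots> = c (comb_seq m g h)"
          unfolding zN act_act translate_translate by (simp add: z_def)
        finally show ?case .
      qed
    qed
  qed
  ultimately show ?thesis using F by (intro that[of F]) auto
qed

text \<open>The last variable is frozen relative to the first one, at \<open>x 0 + t\<close> instead
  of \<open>t\<close>, so that the resulting primitive is equivariant. This takes place inside the
  tail because \<open>1 \<le> m\<close> keeps variable 0 in the head.\<close>

lemma pcobd_exact:
  assumes m: "1 \<le> m" "m \<le> n" and D: "cochain n D" "AE x in P. pcobd m (Suc n) D x = 0"
  obtains u where "cochain (n - 1) u" "AE x in P. D x = pcobd m n u x"
proof (cases "m = n")
  \<comment> \<open>Only the face with index \<open>n\<close> is left, and a function of
    \<open>n\<close> variables does not notice it. So \<open>D\<close> itself vanishes almost
    everywhere.\<close>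
  case True
  have eq: "D (face n x) = D x" for x
    by (rule depends_uptoD[OF cochain_depends[OF D(1)]]) (simp add: face_def)
  have "AE x in P. D x = 0"
    using D(2)
  proof eventually_elim
    case (elim x)
    then have "alt n (D x) = 0" using True by (simp add: pcobd_def eq)
    then have "alt n (alt n (D x)) = alt n 0" by simp
    then show ?case by simp
  qed
  then show ?thesis using True by (intro that[of "\<lambda>x. 0"] cochain_0) simp
next
  case False
  with m have mn: "m < n" by simp
  note [measurable] = cochain_measurable[OF D(1)]
  let ?Q = "\<lambda>x. pcobd m (Suc n) D x = 0"
  \<comment> \<open>For fixed first variable this is a left translation of a single coordinate,
    which preserves null sets; Fubini with a head of length 1 assembles the fibres, and there
    coordinate \<open>n\<close> becomes tail coordinate \<open>n - 1\<close>.\<close>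
  have "AE x in P. ?Q (x(n := x 0 + x n))"
  proof (rule AE_comb_seqI[where m = 1])
    have "Measurable.pred borel (\<lambda>x. ?Q (x(n := x 0 + x n)))" by measurable
    then show "{x. ?Q (x(n := x 0 + x n))} \<in> sets borel" by (simp add: pred_def)
    show "AE g in P. AE h in P. ?Q ((comb_seq 1 g h)(n := comb_seq 1 g h 0 + comb_seq 1 g h n))"
      using AE_comb_seqD[OF D(2), of 1]
    proof eventually_elim
      case (elim g)
      from AE_translate_coord[OF elim, of "n - 1" "g 0"]
      show ?case
      proof eventually_elim
        case (elim h)
        moreover have "comb_seq 1 g (h(n - 1 := g 0 + h (n - 1))) = (comb_seq 1 g h)(n := comb_seq 1 g h 0 + comb_seq 1 g h n)"
          using mn by (auto simp: fun_eq_iff split: nat.split)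
        ultimately show ?case by simp
      qed
    qed
  qed
  from AE_upd[OF this, of n] have "AE t in L. AE x in P. ?Q (x(n := x 0 + t))"
    using mn by simp
  then obtain t where t: "AE x in P. ?Q (x(n := x 0 + t))"
    using AE_L_ex by blast
  \<comment> \<open>The sign comes from solving the identity for the last face, whose coefficient is
    \<open>alt n\<close>.\<close>
  define u where "u x = alt (Suc n) (D (x(n - 1 := x 0 + t)))" for x
  have "cochain (n - 1) u"
    unfolding cochain_def
  proof (intro conjI allI)
    show "u \<in> borel_measurable borel" unfolding u_def[abs_def] by measurable
    show "depends_upto (n - 1) u"
      unfolding depends_upto_def
    proof (intro allI impI)
      fix x y :: "nat \<Rightarrow> 'g" assume xy: "\<forall>i<n - 1. x i = y i"
      then have "x 0 = y 0" using mn m by auto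
      then have "D (x(n - 1 := x 0 + t)) = D (y(n - 1 := y 0 + t))"
        by (intro depends_uptoD[OF cochain_depends[OF D(1)]]) (use xy in auto)
      then show "u x = u y" by (simp add: u_def)
    qed
    fix g x
    have "(translate g x)(n - 1 := translate g x 0 + t) = translate g (x(n - 1 := x 0 + t))"
      by (auto simp: translate_def fun_eq_iff add.assoc)
    then show "u (translate g x) = \<alpha> g (u x)"
      by (simp add: u_def act_alt cochain_equiv[OF D(1)])
  qed
  moreover have "AE x in P. D x = pcobd m n u x"
    using t
  proof eventually_elim
    case (elim x)
    let ?y = "x(n := x 0 + t)"
    have eq: "D (face i ?y) = D ((face i x)(n - 1 := face i x 0 + t))" if "m \<le> i" "i < n" for i
      by (rule depends_uptoD[OF cochain_depends[OF D(1)]]) (use that m in \<open>auto simp: face_def\<close>)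
    have eqn: "D (face n ?y) = D x"
      by (rule depends_uptoD[OF cochain_depends[OF D(1)]]) (auto simp: face_def)
    have "0 = pcobd m n D ?y + alt n (D x)"
      using elim mn eqn by (simp add: pcobd_def)
    moreover have "pcobd m n D ?y = alt (Suc n) (pcobd m n u x)"
      unfolding pcobd_def alt_sum by (intro sum.cong refl) (simp add: eq u_def alt_comm[of "Suc n"])
    ultimately have "alt n (pcobd m n u x) = alt n (D x)" by (simp add: alt_Suc)
    then have "alt n (alt n (pcobd m n u x)) = alt n (alt n (D x))" by simp
    then show ?case by simp
  qed
  ultimately show ?thesis by (rule that)
qed

text \<open>At stage \<open>m\<close> the error \<open>F - \<sigma>\<close> is a head coboundary of
  \<open>u\<close> plus a tail coboundary of \<open>v\<close>. Under the next head coboundary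
  \<open>u\<close> drops out, \<open>v\<close> takes its place, and a fresh \<open>v\<close>
  measures the difference between two primitives. At \<open>m = n\<close> the tail part is empty and
  the error is a genuine coboundary.\<close>

lemma almost_cont_cocycle:
  assumes \<sigma>: "cochain n \<sigma>" "AE x in P. pcobd 0 (Suc n) \<sigma> x = 0" and n: "2 \<le> n"
  obtains F u where "cochain n F" "almost_cont_head n F" "cochain (n - 1) u"
    "AE x in P. F x = \<sigma> x + pcobd 0 n u x"
proof -
  have Sn: "Suc (n - 1) = n" using n by simp
  have "\<exists>F u v. cochain n F \<and> almost_cont_head m F \<and> cochain (n - 1) u \<and> cochain (n - 1) v \<and>
     (AE x in P. F x = \<sigma> x + pcobd 0 m u x + pcobd m n v x)" if "1 \<le> m" "m \<le> n" for m
    using that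
  proof (induction m rule: dec_induct)
    case base
    have "almost_cont_head 1 \<sigma>" using cont_head_1[OF \<sigma>(1)] by (simp add: almost_cont_head_def)
    then show ?case
      by (intro exI[of _ \<sigma>] exI[of _ "\<lambda>x. 0"]) (simp add: \<sigma> cochain_0 pcobd_def)
  next
    case (step m)
    then obtain F u v where F: "cochain n F" "almost_cont_head m F" and u: "cochain (n - 1) u"
      and v: "cochain (n - 1) v" and eq: "AE x in P. F x = \<sigma> x + pcobd 0 m u x + pcobd m n v x" by auto
    \<comment> \<open>Taking one more head face of \<open>v\<close> produces a cochain whose tail
      coboundary is minus the head coboundary of \<open>F\<close>: the cocycle identity handles
      \<open>\<sigma>\<close>, anticommutation handles \<open>v\<close>.\<close>
    define T where "T x = \<sigma> x + pcobd 0 (Suc m) v x" for x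
    have T: "cochain n T"
      unfolding T_def using cochain_pcobd[OF v] Sn \<sigma>(1) by (intro cochain_add) auto
    define c where "c x = - pcobd 0 (Suc m) F x" for x
    have c: "cochain (Suc n) c" unfolding c_def by (intro cochain_minus cochain_pcobd F)
    have cc: "almost_cont_head (Suc m) c" unfolding c_def by (rule almost_cont_head_pcobd[OF F])
    have Tc: "AE x in P. pcobd (Suc m) (Suc n) T x = c x"
      using \<sigma>(2) AE_pcobd_cong[OF eq, of 0 "Suc m"]
    proof eventually_elim
      case (elim x)
      have "pcobd 0 (Suc n) \<sigma> x = pcobd 0 (Suc m) \<sigma> x + pcobd (Suc m) (Suc n) \<sigma> x"
        by (rule pcobd_split) (use step in auto)
      with elim(1) have "pcobd (Suc m) (Suc n) \<sigma> x = - pcobd 0 (Suc m) \<sigma> x"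
        by (simp add: eq_neg_iff_add_eq_0 add.commute)
      moreover have "pcobd (Suc m) (Suc n) (pcobd 0 (Suc m) v) x = - pcobd 0 (Suc m) (pcobd m n v) x"
        by (rule pcobd_commute) simp
      moreover have "pcobd 0 (Suc m) F x = pcobd 0 (Suc m) \<sigma> x + pcobd 0 (Suc m) (pcobd m n v) x"
        using elim(2) by (simp add: pcobd_add pcobd_pcobd)
      ultimately show ?case by (simp add: T_def[abs_def] c_def pcobd_add)
    qed
    have m: "1 \<le> Suc m" "Suc m \<le> n" using step by auto
    obtain F' where F': "cochain n F'" "almost_cont_head (Suc m) F'"
      "AE x in P. pcobd (Suc m) (Suc n) F' x = c x"
      by (rule almost_cont_lift[OF m T c cc Tc])
    have "AE x in P. pcobd (Suc m) (Suc n) (\<lambda>x. F' x - T x) x = 0"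
      using F'(3) Tc by eventually_elim (simp add: pcobd_diff)
    then obtain w where w: "cochain (n - 1) w" "AE x in P. F' x - T x = pcobd (Suc m) n w x"
      by (rule pcobd_exact[OF m cochain_diff[OF F'(1) T]])
    from w(2) have "AE x in P. F' x = \<sigma> x + pcobd 0 (Suc m) v x + pcobd (Suc m) n w x"
      by eventually_elim (simp add: T_def algebra_simps)
    with F' w v show ?case by blast
  qed
  from this[of n] n obtain F u v where "cochain n F" "almost_cont_head n F" "cochain (n - 1) u"
    "AE x in P. F x = \<sigma> x + pcobd 0 n u x + pcobd n n v x" by auto
  then show ?thesis by (intro that[of F u]) auto
qed

end

section \<open>Haar measure\<close>

lemma lcsc_sigma_compact:
  assumes "locally_compact_space (euclidean :: 'g::{t2_space, second_countable_topology} topology)"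
  obtains C :: "nat \<Rightarrow> 'g::{t2_space, second_countable_topology} set"
  where "\<And>i. compact (C i)" "(\<Union>i. C i) = UNIV"
proof -
  have "\<exists>U K. open U \<and> compact K \<and> x \<in> U \<and> U \<subseteq> K" for x :: 'g
    using assms by (simp add: locally_compact_space_def)
  then obtain U K where UK: "\<And>x::'g. open (U x)" "\<And>x. compact (K x)" "\<And>x. x \<in> U x" "\<And>x. U x \<subseteq> K x"
    by metis
  obtain F where F: "F \<subseteq> range U" "countable F" "\<Union>F = \<Union>(range U)"
    using Lindelof[of "range U"] UK(1) by blast
  obtain D where D: "countable D" "F = U ` D"
    using countable_subset_image F(1,2) by metis
  have cov: "(\<Union>x\<in>D. U x) = UNIV" using F(3) D(2) UK(3) by blast
  then have "D \<noteq> {}" by auto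
  show ?thesis
  proof (rule that[of "\<lambda>i. K (from_nat_into D i)"])
    have "x \<in> (\<Union>i. K (from_nat_into D i))" for x
    proof -
      obtain y where "y \<in> D" "x \<in> U y" using cov by blast
      moreover obtain i where "from_nat_into D i = y" using from_nat_into_surj[OF D(1) \<open>y \<in> D\<close>] by blast
      ultimately show ?thesis using UK(4) by blast
    qed
    then show "(\<Union>i. K (from_nat_into D i)) = UNIV" by blast
  qed (rule UK(2))
qed

locale haar =
  fixes \<mu> :: "'g::{topological_group_add, t2_space, second_countable_topology} measure"
  assumes lc: "locally_compact_space (euclidean :: 'g topology)" and haar: "haar_measure \<mu>"
begin

lemma sets_mu: "sets \<mu> = sets borel"
  and haar_compact: "compact K \<Longrightarrow> emeasure \<mu> K < \<infinity>"
  and haar_open: "open U \<Longrightarrow> U \<noteq> {} \<Longrightarrow> emeasure \<mu> U > 0"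
  and haar_image: "A \<in> sets borel \<Longrightarrow> emeasure \<mu> ((\<lambda>x. g + x) ` A) = emeasure \<mu> A"
  using haar by (auto simp: haar_measure_def)

lemma space_mu [simp]: "space \<mu> = UNIV"
  using sets_eq_imp_space_eq[OF sets_mu] by simp

lemma UNIV_mu [simp]: "UNIV \<in> sets \<mu>"
  by (simp add: sets_mu)

lemma measurable_mu [simp]: "measurable \<mu> M = measurable borel M" "measurable M \<mu> = measurable M borel"
  by (rule measurable_cong_sets; simp add: sets_mu)+

sublocale sigma_finite_measure \<mu>
proof
  obtain C :: "nat \<Rightarrow> 'g set" where C: "\<And>i. compact (C i)" "(\<Union>i. C i) = UNIV"
    using lcsc_sigma_compact[OF lc] by blast
  show "\<exists>A. countable A \<and> A \<subseteq> sets \<mu> \<and> \<Union>A = space \<mu> \<and> (\<forall>a\<in>A. emeasure \<mu> a \<noteq> \<infinity>)"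
  proof (intro exI[of _ "range C"] conjI ballI)
    show "range C \<subseteq> sets \<mu>" using C(1) by (auto simp: sets_mu compact_imp_closed)
    show "emeasure \<mu> a \<noteq> \<infinity>" if a: "a \<in> range C" for a
    proof -
      from a obtain i where "a = C i" by blast
      with haar_compact[OF C(1)[of i]] show ?thesis by simp
    qed
  qed (use C(2) in auto)
qed

sublocale pair: pair_sigma_finite \<mu> \<mu> ..

lemma distr_left: "distr \<mu> borel (\<lambda>x. g + x) = \<mu>"
proof (rule measure_eqI)
  fix A assume "A \<in> sets (distr \<mu> borel (\<lambda>x. g + x))"
  then have A [measurable]: "A \<in> sets borel" by simp
  have "(\<lambda>x. g + x) -` A = (\<lambda>x. - g + x) ` A"
  proof (intro equalityI subsetI)
    fix x assume "x \<in> (\<lambda>x. g + x) -` A"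
    then show "x \<in> (\<lambda>x. - g + x) ` A" by (intro image_eqI[of _ _ "g + x"]) (auto simp: add.assoc[symmetric])
  qed (auto simp: add.assoc[symmetric])
  then show "emeasure (distr \<mu> borel (\<lambda>x. g + x)) A = emeasure \<mu> A"
    using haar_image[OF A, of "- g"] by (simp add: emeasure_distr)
qed (simp add: sets_mu)

lemma AE_left:
  assumes "AE x in \<mu>. Q x"
  shows "AE x in \<mu>. Q (g + x)"
proof -
  have "AE x in distr \<mu> borel (\<lambda>x. g + x). Q x" using assms by (simp only: distr_left)
  then show ?thesis by (rule AE_distrD[rotated]) simp
qed

lemma AE_mu_ex:
  assumes "AE x in \<mu>. Q x"
  shows "\<exists>x. Q x"
proof (rule ccontr)
  assume "\<not> ?thesis"
  with assms have "AE x in \<mu>. x \<notin> space \<mu>" by (auto elim: eventually_mono)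
  then have "emeasure \<mu> (space \<mu>) = 0"
    by (subst (asm) AE_iff_null_sets[symmetric]) auto
  with haar_open[of UNIV] show False by simp
qed

text \<open>By Fubini, the null set \<open>N\<close> is avoided by \<open>- y + x\<close> for almost all pairs, hence for some \<open>x\<close>
  and almost all \<open>y\<close>; left invariance then removes \<open>x\<close>.\<close>

lemma AE_inverse:
  assumes "AE x in \<mu>. Q x"
  shows "AE x in \<mu>. Q (- x)"
proof -
  from assms obtain N where N: "N \<in> null_sets \<mu>" "{x. \<not> Q x} \<subseteq> N"
    by (auto simp: eventually_ae_filter)
  have [measurable]: "N \<in> sets borel" using N(1) by (auto simp: sets_mu null_sets_def)
  have "AE y in \<mu>. AE x in \<mu>. - y + x \<notin> N"
    by (intro AE_I2 AE_left AE_not_in N)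
  moreover have "Measurable.pred (\<mu> \<Otimes>\<^sub>M \<mu>) (\<lambda>z. - fst z + snd z \<notin> N)"
    by (simp add: measurable_cong_sets[OF sets_pair_measure_cong[OF sets_mu sets_mu] refl])
  then have "{z \<in> space (\<mu> \<Otimes>\<^sub>M \<mu>). - fst z + snd z \<notin> N} \<in> sets (\<mu> \<Otimes>\<^sub>M \<mu>)"
    by (rule predE)
  ultimately have "AE x in \<mu>. AE y in \<mu>. - y + x \<notin> N"
    using pair.AE_commute[of "\<lambda>y x. - y + x \<notin> N"] by blast
  then obtain x where "AE y in \<mu>. - y + x \<notin> N" using AE_mu_ex by blast
  from AE_left[OF this, of x] have "AE y in \<mu>. - y \<notin> N"
    by (simp add: minus_add add.assoc)
  then show ?thesis by eventually_elim (use N(2) in auto)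
qed

text \<open>Right translation is left translation conjugated by inversion, and both preserve null
  sets.\<close>

lemma AE_right:
  assumes "AE x in \<mu>. Q x"
  shows "AE x in \<mu>. Q (x + t)"
proof -
  have "AE x in \<mu>. Q (- (- t + - x))"
    using AE_inverse[OF AE_left[OF AE_inverse[OF assms], of "- t"]] .
  then show ?thesis by (simp add: minus_add)
qed

text \<open>A positive bounded integrable density leaves the null sets unchanged. For uniformity
  over translates, most of the mass lies in a compact set; translating it by a convergent sequence
  stays in a larger compact set of finite Haar measure, where left invariance removes the
  translation and dominated convergence applies along a subsequence.\<close>

lemma equivalent_probability:
  obtains w :: "'g \<Rightarrow> real" where "w \<in> borel_measurable borel" "\<And>x. 0 < w x"
    "quasi_invariant (density \<mu> (\<lambda>x. ennreal (w x)))"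
proof -
  obtain f :: "'g \<Rightarrow> real" where f: "f \<in> borel_measurable \<mu>" "\<And>x. 0 < f x" "\<And>x. f x \<le> 1" "integrable \<mu> f"
    by (rule obtain_positive_integrable_function) blast
  note f(1)[simplified, measurable]
  define c where "c = (\<integral>x. f x \<partial>\<mu>)"
  have "c \<noteq> 0"
  proof
    assume "c = 0"
    then have "AE x in \<mu>. f x = 0"
      unfolding c_def using f by (subst (asm) integral_nonneg_eq_0_iff_AE) (auto intro: less_imp_le)
    then obtain x where "f x = 0" using AE_mu_ex by blast
    with f(2)[of x] show False by simp
  qed
  moreover have "0 \<le> c" unfolding c_def using f(2) by (intro integral_nonneg_AE) (auto intro: less_imp_le)
  ultimately have c: "0 < c" by simp
  define w where "w x = f x / c" for x
  have wm [measurable]: "w \<in> borel_measurable borel" unfolding w_def by measurable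
  have w0: "0 < w x" and w1: "w x \<le> 1 / c" for x using f(2,3) c by (auto simp: w_def divide_right_mono)
  define L where "L = density \<mu> (\<lambda>x. ennreal (w x))"
  have sets_L: "sets L = sets borel" by (simp add: L_def sets_mu)
  have [simp]: "space L = UNIV" by (simp add: L_def)
  have mL [simp]: "measurable L M = measurable borel M" for M :: "'m measure"
    by (rule measurable_cong_sets) (simp_all add: sets_L)
  have AE_L: "(AE x in L. Q x) \<longleftrightarrow> (AE x in \<mu>. Q x)" for Q
    unfolding L_def by (subst AE_density) (use w0 in auto)
  have "integrable \<mu> w" unfolding w_def using f(4) by simp
  then have "(\<integral>\<^sup>+x. ennreal (w x) \<partial>\<mu>) = ennreal (\<integral>x. w x \<partial>\<mu>)"
    using w0 by (intro nn_integral_eq_integral) (auto intro: less_imp_le)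
  also have "(\<integral>x. w x \<partial>\<mu>) = 1" using c by (simp add: w_def c_def)
  finally have "emeasure L (space L) = 1" by (simp add: L_def emeasure_density)
  then interpret L: prob_space L by (rule prob_spaceI)
  have "quasi_invariant L"
  proof
    show "sets L = sets borel" by (rule sets_L)
    show "emeasure L U > 0" if U: "open U" "U \<noteq> {}" for U
    proof (rule ccontr)
      assume "\<not> ?thesis"
      then have "AE x in L. x \<notin> U" using U by (intro AE_not_in) (auto simp: null_sets_def sets_L)
      then have "emeasure \<mu> U = 0"
        unfolding AE_L using U by (subst (asm) AE_iff_null_sets[symmetric]) (auto simp: sets_mu)
      with haar_open[OF U] show False by simp
    qed
    have "Hausdorff_space (euclidean :: 'g topology)"
      unfolding Hausdorff_space_def using hausdorff[where 'a = 'g] by (simp add: disjnt_def)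
    then show "completely_regular_space (euclidean :: 'g topology)"
      using locally_compact_regular_imp_completely_regular_space[OF lc] by blast
    show "AE x in L. Q (x + t)" if "AE x in L. Q x" for Q t
      using that AE_right unfolding AE_L by blast
  next
    fix \<gamma> :: "nat \<Rightarrow> 'g" and g and \<phi> :: "nat \<Rightarrow> 'g \<Rightarrow> real"
    assume \<gamma>: "\<gamma> \<longlonglongrightarrow> g" and \<phi> [measurable]: "\<And>k. \<phi> k \<in> borel_measurable borel"
      and bd: "\<And>k x. 0 \<le> \<phi> k x \<and> \<phi> k x \<le> 1" and lim: "(\<lambda>k. \<integral>x. \<phi> k x \<partial>L) \<longlonglongrightarrow> 0"
    have intL: "integrable L \<psi>" if "\<psi> \<in> borel_measurable borel" "\<And>x. \<bar>\<psi> x\<bar> \<le> 1" for \<psi> :: "'g \<Rightarrow> real"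
      by (rule L.integrable_const_bound[of _ 1]) (use that in auto)
    have abs\<phi>: "\<bar>\<phi> k x\<bar> \<le> 1" for k x using bd[of k x] by auto
    obtain C :: "nat \<Rightarrow> 'g set" where C: "\<And>i. compact (C i)" "(\<Union>i. C i) = UNIV"
      using lcsc_sigma_compact[OF lc] by blast
    show "(\<lambda>k. \<integral>x. \<phi> k (\<gamma> k + x) \<partial>L) \<longlonglongrightarrow> 0"
    proof (rule tendsto_subseqI)
      fix r :: "nat \<Rightarrow> nat" assume r: "strict_mono r"
      have "(\<lambda>k. \<integral>x. norm (\<phi> (r k) x) \<partial>L) \<longlonglongrightarrow> 0"
        using LIMSEQ_subseq_LIMSEQ[OF lim r] bd by (simp add: o_def)
      then obtain s :: "nat \<Rightarrow> nat" where s: "strict_mono s" "AE x in L. (\<lambda>k. \<phi> (r (s k)) x) \<longlonglongrightarrow> 0"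
        using tendsto_L1_AE_subseq[of L "\<lambda>k. \<phi> (r k)"] intL[OF \<phi> abs\<phi>] by auto
      define \<psi> where "\<psi> k = \<phi> (r (s k))" for k
      define \<eta> where "\<eta> k = \<gamma> (r (s k))" for k
      have [measurable]: "\<psi> k \<in> borel_measurable borel" for k by (simp add: \<psi>_def)
      have bd': "0 \<le> \<psi> k x" "\<psi> k x \<le> 1" for k x using bd by (auto simp: \<psi>_def)
      have \<eta>: "\<eta> \<longlonglongrightarrow> g"
        using LIMSEQ_subseq_LIMSEQ[OF \<gamma> strict_mono_o[OF r s(1)]] by (simp add: o_def \<eta>_def[abs_def])
      have \<psi>0: "AE x in \<mu>. (\<lambda>k. \<psi> k x) \<longlonglongrightarrow> 0" using s(2) unfolding AE_L by (simp add: \<psi>_def)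
      have "\<exists>V K0. open V \<and> compact K0 \<and> g \<in> V \<and> V \<subseteq> K0"
        using lc by (simp add: locally_compact_space_def)
      then obtain V K0 where V: "open V" "compact K0" "g \<in> V" "V \<subseteq> K0"
        by (elim exE conjE)
      have ev: "eventually (\<lambda>k. \<eta> k \<in> K0) sequentially"
        using topological_tendstoD[OF \<eta> V(1,3)] by eventually_elim (use V(4) in auto)
      have "(\<lambda>k. \<integral>x. \<psi> k (\<eta> k + x) \<partial>L) \<longlonglongrightarrow> 0"
      proof (rule tendstoI)
        fix e :: real assume e: "0 < e"
        define A where "A n = (\<Union>i<n. C i)" for n
        have Acomp: "compact (A n)" for n unfolding A_def using C(1) by (intro compact_UN) auto
        then have Am [measurable]: "A n \<in> sets borel" for n by (simp add: compact_imp_closed)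
        have "(\<lambda>n. L.prob (A n)) \<longlonglongrightarrow> L.prob (\<Union>n. A n)"
        proof (rule L.finite_Lim_measure_incseq)
          show "range A \<subseteq> sets L" using Am by (auto simp: sets_L)
          show "incseq A" unfolding A_def by (intro monoI UN_mono) auto
        qed
        moreover have "(\<Union>n. A n) = space L" using C(2) by (auto simp: A_def)
        ultimately have "(\<lambda>n. L.prob (A n)) \<longlonglongrightarrow> 1" using L.prob_space by simp
        then have "eventually (\<lambda>n. 1 - e / 2 < L.prob (A n)) sequentially"
          by (rule order_tendstoD) (use e in simp)
        then obtain n where n: "1 - e / 2 < L.prob (A n)" by (auto simp: eventually_sequentially)
        define K where "K = A n"
        have [measurable]: "K \<in> sets borel" by (simp add: K_def)
        \<comment> \<open>\<open>K0\<close> contains all late \<open>\<eta> k\<close>, so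
          \<open>K'\<close> contains the corresponding translates of \<open>K\<close>; it is compact
          as the image of a product under addition.\<close>
        define K' where "K' = (\<lambda>(a, b). a + b) ` (K0 \<times> K)"
        have "compact K'"
          unfolding K'_def using V(2) Acomp[of n]
          by (intro compact_continuous_image compact_Times) (auto simp: K_def case_prod_unfold intro!: continuous_intros)
        then have [measurable]: "K' \<in> sets borel" and K'fin: "emeasure \<mu> K' < \<infinity>"
          using compact_imp_closed[of K'] haar_compact[of K'] by simp_all
        have intK': "integrable \<mu> (indicator K' :: 'g \<Rightarrow> real)"
          using K'fin by (subst integrable_indicator_iff) (auto simp: sets_mu)
        have intK'\<psi>: "integrable \<mu> (\<lambda>x. indicator K' x * \<psi> k x)" for k
          by (rule Bochner_Integration.integrable_bound[OF intK']) (use bd' in \<open>auto simp: indicator_def\<close>)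
        have "(\<lambda>k. \<integral>x. indicator K' x * \<psi> k x \<partial>\<mu>) \<longlonglongrightarrow> (\<integral>x. 0 \<partial>\<mu>)"
        proof (rule integral_dominated_convergence[OF _ _ intK'])
          show "AE x in \<mu>. (\<lambda>k. indicator K' x * \<psi> k x) \<longlonglongrightarrow> 0"
            using \<psi>0 by eventually_elim (rule tendsto_mult_right_zero)
        qed (use bd' in \<open>auto simp: indicator_def\<close>)
        then have "(\<lambda>k. \<integral>x. indicator K' x * \<psi> k x \<partial>\<mu>) \<longlonglongrightarrow> 0" by simp
        then have "eventually (\<lambda>k. (\<integral>x. indicator K' x * \<psi> k x \<partial>\<mu>) < c * (e / 2)) sequentially"
          by (rule order_tendstoD) (use e c in simp)
        with ev show "eventually (\<lambda>k. dist (\<integral>x. \<psi> k (\<eta> k + x) \<partial>L) 0 < e) sequentially"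
        proof eventually_elim
          case (elim k)
          have "(\<integral>x. \<psi> k (\<eta> k + x) \<partial>L) \<le> (\<integral>x. indicator (- K) x + indicator K x * \<psi> k (\<eta> k + x) \<partial>L)"
            by (intro integral_mono Bochner_Integration.integrable_add intL)
               (use bd' in \<open>auto simp: indicator_def\<close>)
          also have "\<dots> = (\<integral>x. indicator (- K) x \<partial>L) + (\<integral>x. indicator K x * \<psi> k (\<eta> k + x) \<partial>L)"
            by (intro Bochner_Integration.integral_add intL) (use bd' in \<open>auto simp: indicator_def\<close>)
          also have "(\<integral>x. indicator (- K) x \<partial>L) = 1 - L.prob K"
            using L.prob_compl[of K] by (simp add: sets_L Compl_eq_Diff_UNIV)
          also have "(\<integral>x. indicator K x * \<psi> k (\<eta> k + x) \<partial>L) = (\<integral>x. w x * (indicator K x * \<psi> k (\<eta> k + x)) \<partial>\<mu>)"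
            unfolding L_def by (subst integral_density) (use w0 in \<open>auto intro: less_imp_le\<close>)
          also have "\<dots> \<le> (\<integral>x. 1 / c * (indicator K' (\<eta> k + x) * \<psi> k (\<eta> k + x)) \<partial>\<mu>)"
          proof (rule integral_mono_AE)
            have "integrable (distr \<mu> borel (\<lambda>x. \<eta> k + x)) (\<lambda>x. indicator K' x * \<psi> k x)"
              using intK'\<psi> by (simp only: distr_left)
            then have i: "integrable \<mu> (\<lambda>x. indicator K' (\<eta> k + x) * \<psi> k (\<eta> k + x))"
              by (subst (asm) integrable_distr_eq) auto
            then show "integrable \<mu> (\<lambda>x. 1 / c * (indicator K' (\<eta> k + x) * \<psi> k (\<eta> k + x)))"
              by (rule integrable_mult_right)
            have le: "w x * (indicator K x * \<psi> k (\<eta> k + x)) \<le> 1 / c * (indicator K' (\<eta> k + x) * \<psi> k (\<eta> k + x))" for x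
            proof (cases "x \<in> K")
              case True
              then have "\<eta> k + x \<in> K'" using elim(1) by (auto simp: K'_def)
              then show ?thesis using True mult_right_mono[OF w1[of x] bd'(1)[of k "\<eta> k + x"]] by simp
            next
              case False
              then show ?thesis using c bd'[of k "\<eta> k + x"] by simp
            qed
            show "AE x in \<mu>. w x * (indicator K x * \<psi> k (\<eta> k + x)) \<le> 1 / c * (indicator K' (\<eta> k + x) * \<psi> k (\<eta> k + x))"
              using le by simp
            show "integrable \<mu> (\<lambda>x. w x * (indicator K x * \<psi> k (\<eta> k + x)))"
            proof (rule Bochner_Integration.integrable_bound[OF \<open>integrable \<mu> w\<close>])
              show "AE x in \<mu>. norm (w x * (indicator K x * \<psi> k (\<eta> k + x))) \<le> norm (w x)"
                using bd' by (auto simp: indicator_def abs_mult intro!: AE_I2 mult_left_le)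
            qed simp
          qed
          also have "\<dots> = 1 / c * (\<integral>x. indicator K' (\<eta> k + x) * \<psi> k (\<eta> k + x) \<partial>\<mu>)"
            by simp
          also have "(\<integral>x. indicator K' (\<eta> k + x) * \<psi> k (\<eta> k + x) \<partial>\<mu>) = (\<integral>x. indicator K' x * \<psi> k x \<partial>distr \<mu> borel (\<lambda>x. \<eta> k + x))"
            by (subst integral_distr) auto
          also have "\<dots> = (\<integral>x. indicator K' x * \<psi> k x \<partial>\<mu>)" by (simp only: distr_left)
          finally have "(\<integral>x. \<psi> k (\<eta> k + x) \<partial>L) \<le> 1 - L.prob K + 1 / c * (\<integral>x. indicator K' x * \<psi> k x \<partial>\<mu>)" by simp
          also have "\<dots> < e / 2 + 1 / c * (c * (e / 2))"
            using n c elim(2) unfolding K_def[symmetric]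
            by (intro add_strict_mono mult_strict_left_mono) auto
          also have "\<dots> = e" using c by simp
          finally have "(\<integral>x. \<psi> k (\<eta> k + x) \<partial>L) < e" .
          moreover have "0 \<le> (\<integral>x. \<psi> k (\<eta> k + x) \<partial>L)" using bd' by (intro integral_nonneg_AE) auto
          ultimately show ?case by simp
        qed
      qed
      with s(1) show "\<exists>s::nat \<Rightarrow> nat. strict_mono s \<and> (\<lambda>k. \<integral>x. \<phi> (r (s k)) (\<gamma> (r (s k)) + x) \<partial>L) \<longlonglongrightarrow> 0"
        unfolding \<psi>_def \<eta>_def by blast
    qed
  qed
  then show ?thesis using wm w0 unfolding L_def by (rule that[rotated 2])
qed

text \<open>Over a finite index set the product of the densities is a density of the product
  measure; being positive everywhere, it does not change the null sets.\<close>

lemma AE_PiM_density: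
  fixes w :: "'g \<Rightarrow> real" and I :: "'i set"
  assumes [measurable]: "w \<in> borel_measurable borel" and w0: "\<And>x. 0 < w x"
    and L: "prob_space (density \<mu> (\<lambda>x. ennreal (w x)))" and I: "finite I"
  shows "(AE x in PiM I (\<lambda>_. density \<mu> (\<lambda>x. ennreal (w x))). Q x) \<longleftrightarrow> (AE x in PiM I (\<lambda>_. \<mu>). Q x)"
proof -
  let ?L = "density \<mu> (\<lambda>x. ennreal (w x))"
  interpret L: prob_space ?L by fact
  interpret pL: product_sigma_finite "\<lambda>_::'i. ?L" ..
  interpret pM: product_sigma_finite "\<lambda>_::'i. \<mu>" ..
  let ?d = "\<lambda>x. \<Prod>i\<in>I. ennreal (w (x i))"
  have [measurable]: "?d \<in> borel_measurable (PiM I (\<lambda>_. \<mu>))"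
  proof -
    have "(\<lambda>x. x i) \<in> borel_measurable (PiM I (\<lambda>_. \<mu>))" if "i \<in> I" for i
      using measurable_component_singleton[OF that, of "\<lambda>_. \<mu>"] by simp
    from measurable_compose[OF measurable_compose[OF this assms(1)] measurable_ennreal]
    show ?thesis by (rule borel_measurable_prod_ennreal)
  qed
  have "density (PiM I (\<lambda>_. \<mu>)) ?d = PiM I (\<lambda>_. ?L)"
  proof (rule pL.PiM_eqI[OF I])
    show "sets (density (PiM I (\<lambda>_. \<mu>)) ?d) = sets (PiM I (\<lambda>_. ?L))"
      by (simp, intro sets_PiM_cong) auto
    fix A assume A: "\<And>i. i \<in> I \<Longrightarrow> A i \<in> sets ?L"
    have "emeasure (density (PiM I (\<lambda>_. \<mu>)) ?d) (Pi\<^sub>E I A) = (\<integral>\<^sup>+x. ?d x * indicator (Pi\<^sub>E I A) x \<partial>PiM I (\<lambda>_. \<mu>))"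
      by (rule emeasure_density) (use A I in \<open>auto intro!: sets_PiM_I_finite\<close>)
    also have "\<dots> = (\<integral>\<^sup>+x. (\<Prod>i\<in>I. ennreal (w (x i)) * indicator (A i) (x i)) \<partial>PiM I (\<lambda>_. \<mu>))"
    proof (rule nn_integral_cong)
      fix x assume x: "x \<in> space (PiM I (\<lambda>_. \<mu>))"
      have "indicator (Pi\<^sub>E I A) x = (\<Prod>i\<in>I. indicator (A i) (x i) :: ennreal)"
      proof (cases "x \<in> Pi\<^sub>E I A")
        case False
        then obtain i where "i \<in> I" "x i \<notin> A i" using x by (auto simp: space_PiM PiE_iff)
        then have "(\<Prod>i\<in>I. indicator (A i) (x i) :: ennreal) = 0" using I by (intro prod_zero bexI[of _ i]) auto
        then show ?thesis using False by simp
      qed (auto simp: PiE_iff)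
      then show "?d x * indicator (Pi\<^sub>E I A) x = (\<Prod>i\<in>I. ennreal (w (x i)) * indicator (A i) (x i))"
        by (simp add: prod.distrib)
    qed
    also have "\<dots> = (\<Prod>i\<in>I. \<integral>\<^sup>+x. ennreal (w x) * indicator (A i) x \<partial>\<mu>)"
      by (rule pM.product_nn_integral_prod[OF I]) (use A in \<open>auto simp: sets_mu\<close>)
    also have "\<dots> = (\<Prod>i\<in>I. emeasure ?L (A i))"
      by (intro prod.cong refl emeasure_density[symmetric]) (use A in auto)
    finally show "emeasure (density (PiM I (\<lambda>_. \<mu>)) ?d) (Pi\<^sub>E I A) = (\<Prod>i\<in>I. emeasure ?L (A i))" .
  qed
  then have "(AE x in PiM I (\<lambda>_. ?L). Q x) \<longleftrightarrow> (AE x in density (PiM I (\<lambda>_. \<mu>)) ?d. Q x)" by (simp only:)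
  also have "\<dots> \<longleftrightarrow> (AE x in PiM I (\<lambda>_. \<mu>). Q x)"
  proof -
    have "0 < ?d x" for x
      using w0 I by (simp add: zero_less_iff_neq_zero prod_zero_iff ennreal_eq_0_iff not_le)
    then show ?thesis by (subst AE_density) auto
  qed
  finally show ?thesis .
qed

end

section \<open>Strictly equivariant representatives and continuity points\<close>

context polish_module
begin

text \<open>By Fubini, almost every \<open>x\<close> satisfies the equivariance identity for almost
  all group elements. Choosing the element that moves the first coordinate of \<open>x\<close> to a
  fixed generic \<open>y\<close> gives a formula that reads off \<open>f\<close> at a normalised
  translate of \<open>x\<close>, and such a formula is equivariant without exception.\<close>

lemma strict_cochain:
  assumes [measurable]: "f \<in> borel_measurable borel" and dep: "depends_upto n f" and n: "1 \<le> n"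
    and eqv: "\<And>g. AE x in P. f (translate g x) = \<alpha> g (f x)"
  obtains \<sigma> where "cochain n \<sigma>" "AE x in P. \<sigma> x = f x"
proof -
  let ?R = "\<lambda>\<gamma> x. \<alpha> (- \<gamma>) (f (translate \<gamma> x)) = f x"
  have pr: "Measurable.pred (L \<Otimes>\<^sub>M P) (\<lambda>z. ?R (h z) (snd z))" if [measurable]: "h \<in> borel_measurable (borel \<Otimes>\<^sub>M borel)" for h
    using measurable_equality_set[of "\<lambda>z. \<alpha> (- h z) (f (translate (h z) (snd z)))" "L \<Otimes>\<^sub>M P" "\<lambda>z. f (snd z)"]
    by (simp add: pred_def)
  have "AE \<gamma> in L. AE x in P. ?R \<gamma> x"
  proof (rule AE_I2)
    fix \<gamma>
    show "AE x in P. ?R \<gamma> x" using eqv[of \<gamma>] by eventually_elim (simp add: act_act)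
  qed
  then have "AE x in P. AE \<gamma> in L. ?R \<gamma> x"
    using LP.AE_commute[of ?R] predE[OF pr[of fst]] by simp
  \<comment> \<open>The substitution replaces the group element by \<open>y + - x 0\<close>, a right
    translation in \<open>y\<close>; here null sets have to be invariant on the right as
    well.\<close>
  then have "AE x in P. AE y in L. ?R (y + - x 0) x"
    by eventually_elim (rule AE_right_translate)
  moreover have "{z \<in> space (L \<Otimes>\<^sub>M P). ?R (fst z + - snd z 0) (snd z)} \<in> sets (L \<Otimes>\<^sub>M P)"
  proof (rule predE[OF pr])
    have [measurable]: "(\<lambda>z. snd z 0) \<in> borel_measurable (borel \<Otimes>\<^sub>M (borel :: (nat \<Rightarrow> 'g) measure))"
      by (rule measurable_product_then_coordinatewise) simp
    show "(\<lambda>z. fst z + - snd z 0) \<in> borel_measurable (borel \<Otimes>\<^sub>M (borel :: (nat \<Rightarrow> 'g) measure))"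
      by measurable
  qed
  ultimately have "AE y in L. AE x in P. ?R (y + - x 0) x"
    using LP.AE_commute[of "\<lambda>y x. ?R (y + - x 0) x"] by blast
  then obtain y where y: "AE x in P. ?R (y + - x 0) x" using AE_L_ex by blast
  define \<sigma> where "\<sigma> x = \<alpha> (- (y + - x 0)) (f (translate (y + - x 0) x))" for x
  have "cochain n \<sigma>"
    unfolding cochain_def
  proof (intro conjI allI)
    show "\<sigma> \<in> borel_measurable borel" unfolding \<sigma>_def[abs_def] by measurable
    show "depends_upto n \<sigma>"
      unfolding depends_upto_def
    proof (intro allI impI)
      fix x x' :: "nat \<Rightarrow> 'g" assume x: "\<forall>i<n. x i = x' i"
      then have "x 0 = x' 0" using n by auto
      moreover have "f (translate (y + - x' 0) x) = f (translate (y + - x' 0) x')"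
        by (rule depends_uptoD[OF dep]) (use x in \<open>simp add: translate_def\<close>)
      ultimately show "\<sigma> x = \<sigma> x'" by (simp add: \<sigma>_def)
    qed
    fix g x
    have "y + - translate g x 0 + g = y + - x 0" "- (y + - translate g x 0) = g + - (y + - x 0)"
      by (simp_all only: translate_def minus_add add.assoc minus_minus left_minus add_0_right)
    then show "\<sigma> (translate g x) = \<alpha> g (\<sigma> x)"
      by (simp only: \<sigma>_def translate_translate act_act)
  qed
  moreover have "AE x in P. \<sigma> x = f x" using y by (simp add: \<sigma>_def)
  ultimately show ?thesis by (rule that)
qed

text \<open>When the head comprises all variables, the functions of the tail are constants and
  convergence in measure is convergence of values.\<close>

lemma cont_head_full:
  assumes F: "cochain n F" and c: "cont_head n F x"
  shows "(F \<longlongrightarrow> F x) (at x within S)"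
  unfolding tendsto_at_iff_sequentially
proof (intro allI impI)
  fix X assume "X \<longlonglongrightarrow> x"
  have eq: "F (comb_seq n y h) = F y" for y h
    by (rule depends_uptoD[OF cochain_depends[OF F]]) (simp add: comb_seq_def)
  have "(\<lambda>k. meas_dist P (\<lambda>h. F (X k)) (\<lambda>h. F x)) \<longlonglongrightarrow> 0"
    using c \<open>X \<longlonglongrightarrow> x\<close> unfolding cont_head_def eq by blast
  then obtain "(\<lambda>k. min 1 (dist (F (X k)) (F x))) \<longlonglongrightarrow> 0"
    using seq.P.prob_space by (simp add: meas_dist_def)
  moreover from this have "eventually (\<lambda>k. min 1 (dist (F (X k)) (F x)) < 1) sequentially"
    by (rule order_tendstoD) simp
  then have "eventually (\<lambda>k. min 1 (dist (F (X k)) (F x)) = dist (F (X k)) (F x)) sequentially"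
    by eventually_elim auto
  ultimately have "(\<lambda>k. dist (F (X k)) (F x)) \<longlonglongrightarrow> 0"
    using tendsto_cong by fast
  then show "(F \<circ> X) \<longlonglongrightarrow> F x" by (simp add: tendsto_dist_iff[symmetric] o_def)
qed

end

text \<open>For each \<open>k\<close> the union \<open>W k\<close> of the open sets on which values
  differ by less than \<open>1 / (k + 1)\<close> is open, and continuity at a point means membership
  in all of them.\<close>

lemma gdelta_continuity_points:
  fixes F :: "'x::topological_space \<Rightarrow> 'b::metric_space"
  shows "gdelta_in euclidean {x. (F \<longlongrightarrow> F x) (at x)}" "{x. (F \<longlongrightarrow> F x) (at x)} \<in> sets borel"
proof -
  define W where "W k = \<Union>{V. open V \<and> (\<forall>a\<in>V. \<forall>b\<in>V. dist (F a) (F b) < 1 / real (Suc k))}" for k :: nat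
  have W: "open (W k)" for k unfolding W_def by blast
  have eq: "{x. (F \<longlongrightarrow> F x) (at x)} = (\<Inter>k. W k)"
  proof (intro equalityI subsetI)
    fix x assume "x \<in> {x. (F \<longlongrightarrow> F x) (at x)}"
    then have x: "(F \<longlongrightarrow> F x) (nhds x)" by (simp add: tendsto_at_iff_tendsto_nhds)
    show "x \<in> (\<Inter>k. W k)"
    proof
      fix k
      define r where "r = 1 / real (Suc k)"
      have r: "0 < r" by (simp add: r_def)
      then have "eventually (\<lambda>y. dist (F y) (F x) < r / 2) (nhds x)" using tendstoD[OF x, of "r / 2"] by simp
      then obtain V where V: "open V" "x \<in> V" "\<forall>y\<in>V. dist (F y) (F x) < r / 2"
        by (auto simp: eventually_nhds)
      have "dist (F a) (F b) < r" if "a \<in> V" "b \<in> V" for a b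
      proof -
        have "dist (F a) (F x) < r / 2" "dist (F b) (F x) < r / 2" using V(3) that by auto
        with dist_triangle2[of "F a" "F b" "F x"] show ?thesis by linarith
      qed
      with V show "x \<in> W k" unfolding W_def r_def by blast
    qed
  next
    fix x assume x: "x \<in> (\<Inter>k. W k)"
    have "(F \<longlongrightarrow> F x) (nhds x)"
    proof (rule tendstoI)
      fix e :: real assume "0 < e"
      then obtain k where k: "1 / real (Suc k) < e" using nat_approx_posE by blast
      from x have "x \<in> W k" by blast
      then obtain V where V: "open V" "x \<in> V" "\<forall>a\<in>V. \<forall>b\<in>V. dist (F a) (F b) < 1 / real (Suc k)"
        unfolding W_def by blast
      have "\<forall>y\<in>V. dist (F y) (F x) < e" using V(2,3) k by (meson less_trans)
      with V show "eventually (\<lambda>y. dist (F y) (F x) < e) (nhds x)" unfolding eventually_nhds by blast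
    qed
    then show "x \<in> {x. (F \<longlongrightarrow> F x) (at x)}" by (simp add: tendsto_at_iff_tendsto_nhds)
  qed
  show "gdelta_in euclidean {x. (F \<longlongrightarrow> F x) (at x)}"
    unfolding eq using W by (intro gdelta_in_Inter) (auto intro: open_imp_gdelta_in)
  show "{x. (F \<longlongrightarrow> F x) (at x)} \<in> sets borel"
    unfolding eq using W by (intro sets.countable_INT) auto
qed

lemma depends_upto_continuity:
  fixes F :: "(nat \<Rightarrow> 'g::topological_space) \<Rightarrow> 'b::topological_space"
  assumes F: "depends_upto n F"
  shows "depends_upto n (\<lambda>x. (F \<longlongrightarrow> F x) (at x))"
proof -
  have "(F \<longlongrightarrow> F y) (at y)" if x: "(F \<longlongrightarrow> F x) (at x)" and xy: "\<forall>i<n. x i = y i" for x y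
  proof -
    define T where "T z i = (if i < n then z i else x i)" for z :: "nat \<Rightarrow> 'g" and i
    have "((\<lambda>z. T z i) \<longlongrightarrow> x i) (at y)" for i
      using xy tendsto_fun_iff[of "\<lambda>z. z" y "at y"] by (cases "i < n") (auto simp: T_def)
    then have "(T \<longlongrightarrow> x) (at y)" by (simp add: tendsto_fun_iff)
    \<comment> \<open>The full neighbourhood filter replaces the punctured one because
      \<open>T\<close> may send points other than \<open>y\<close> to \<open>x\<close>
      itself.\<close>
    moreover have "(F \<longlongrightarrow> F x) (nhds x)" using x by (simp add: tendsto_at_iff_tendsto_nhds)
    ultimately have "((\<lambda>z. F (T z)) \<longlongrightarrow> F x) (at y)" by (rule filterlim_compose[rotated])
    moreover have "F (T z) = F z" for z by (rule depends_uptoD[OF F]) (simp add: T_def)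
    moreover have "F x = F y" by (rule depends_uptoD[OF F]) (use xy in simp)
    ultimately show ?thesis by simp
  qed
  then show ?thesis unfolding depends_upto_def by metis
qed

text \<open>The differential counts its signs from the last variable, partial coboundaries from the
  first; the two conventions differ by the global sign \<open>alt n\<close>.\<close>

lemma cobd_eq_pcobd:
  assumes "depends_upto n f"
  shows "cobd n f x = alt n (pcobd 0 (Suc n) f x)"
proof -
  have "f (omit n i x) = f (face i x)" for i
    by (rule depends_uptoD[OF assms]) (auto simp: omit_def face_def)
  then show ?thesis
    unfolding cobd_def pcobd_def alt_sum atLeast0LessThan
    by (intro sum.cong refl) (auto simp: alt_def even_diff_nat)
qed

section \<open>Transfer between finite powers with Haar measure and the sequence space\<close>

locale haar_module = haar \<mu>
  for \<mu> :: "'g::{topological_group_add, t2_space, second_countable_topology} measure" +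
  fixes w :: "'g \<Rightarrow> real" and \<alpha> :: "'g \<Rightarrow> 'a::{topological_ab_group_add, polish_space} \<Rightarrow> 'a"
  assumes w: "w \<in> borel_measurable borel" "\<And>x. 0 < w x"
    and qi: "quasi_invariant (density \<mu> (\<lambda>x. ennreal (w x)))"
    and mod: "G_module_action \<alpha>"
begin

abbreviation "L \<equiv> density \<mu> (\<lambda>x. ennreal (w x))"

sublocale M: polish_module L \<alpha>
  using qi mod by (intro polish_module.intro polish_module_axioms.intro)

lemma measurable_Mpow_id: "(\<lambda>x. x) \<in> borel_measurable (Mpow \<mu> n)"
proof (rule measurable_coordinatewise_then_product)
  fix i
  show "(\<lambda>x. x i) \<in> borel_measurable (Mpow \<mu> n)"
  proof (cases "i < n")
    case True
    then show ?thesis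
      unfolding Mpow_def using measurable_component_singleton[of i "{..<n}" "\<lambda>_. \<mu>"] by simp
  next
    case False
    have "(\<lambda>x. undefined) \<in> borel_measurable (Mpow \<mu> n)" by simp
    then show ?thesis
      by (rule measurable_cong[THEN iffD1, rotated])
         (use False in \<open>auto simp: Mpow_def space_PiM PiE_def extensional_def\<close>)
  qed
qed

lemma measurable_restrict_Mpow: "(\<lambda>x. restrict x {..<n}) \<in> measurable borel (Mpow \<mu> n)"
  unfolding Mpow_def by (rule measurable_restrict) simp

lemma space_Mpow: "space (Mpow \<mu> n) = Gpow n"
  by (simp add: Mpow_def Gpow_def space_PiM)

lemma AE_Mpow: "(AE x in Mpow \<mu> n. Q x) \<longleftrightarrow> (AE x in PiM {..<n} (\<lambda>_. L). Q x)"
  unfolding Mpow_def by (rule AE_PiM_density[symmetric, OF w M.prob_space_axioms]) simp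

lemma distr_restrict: "distr M.P (PiM {..<n} (\<lambda>_. L)) (\<lambda>x. restrict x {..<n}) = PiM {..<n} (\<lambda>_. L)"
  by (rule M.seq.distr_PiM_restrict_finite) auto

lemma measurable_restrict_L: "(\<lambda>x. restrict x {..<n}) \<in> measurable M.P (PiM {..<n} (\<lambda>_. L))"
  by (rule measurable_restrict) (auto intro: measurable_component_singleton)

lemma AE_MpowD:
  assumes "AE x in Mpow \<mu> n. Q x"
  shows "AE x in M.P. Q (restrict x {..<n})"
proof -
  have "AE x in distr M.P (PiM {..<n} (\<lambda>_. L)) (\<lambda>x. restrict x {..<n}). Q x"
    using assms by (simp only: distr_restrict AE_Mpow)
  then show ?thesis by (rule AE_distrD[OF measurable_restrict_L])
qed

text \<open>Restriction to the first \<open>n\<close> coordinates maps \<open>M.P\<close> to the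
  finite product of \<open>L\<close>, which has the null sets of \<open>Mpow \<mu> n\<close>; a
  property of \<open>n\<close> variables is unchanged by restriction.\<close>

lemma AE_MpowI:
  assumes Q: "{x. Q x} \<in> sets borel" and "AE x in M.P. Q x" and dep: "depends_upto n Q"
  shows "AE x in Mpow \<mu> n. Q x"
proof -
  have "{x \<in> space (Mpow \<mu> n). Q x} = (\<lambda>x. x) -` {x. Q x} \<inter> space (Mpow \<mu> n)" by auto
  then have "{x \<in> space (Mpow \<mu> n). Q x} \<in> sets (Mpow \<mu> n)"
    using measurable_sets[OF measurable_Mpow_id Q] by simp
  moreover have "sets (Mpow \<mu> n) = sets (PiM {..<n} (\<lambda>_. L))"
    unfolding Mpow_def by (rule sets_PiM_cong) auto
  ultimately have m: "{x \<in> space (PiM {..<n} (\<lambda>_. L)). Q x} \<in> sets (PiM {..<n} (\<lambda>_. L))"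
    using sets_eq_imp_space_eq by metis
  have "AE x in M.P. Q (restrict x {..<n})"
    using assms(2)
  proof eventually_elim
    case (elim x)
    have "Q (restrict x {..<n}) = Q x" by (rule depends_uptoD[OF dep]) simp
    with elim show ?case by simp
  qed
  then have "AE x in distr M.P (PiM {..<n} (\<lambda>_. L)) (\<lambda>x. restrict x {..<n}). Q x"
    by (subst AE_distr_iff[OF measurable_restrict_L m])
  then show ?thesis by (simp only: distr_restrict AE_Mpow)
qed

lemma cochain_equiv_cochain:
  assumes F: "M.cochain n F"
  shows "equiv_cochain \<mu> \<alpha> n F"
  unfolding equiv_cochain_def
proof (intro conjI allI AE_I2)
  show "F \<in> borel_measurable (Mpow \<mu> n)"
    using measurable_compose[OF measurable_Mpow_id M.cochain_measurable[OF F]] .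
  fix g x
  have "F (\<lambda>j\<in>{..<n}. - g + x j) = F (translate (- g) x)"
    by (rule depends_uptoD[OF M.cochain_depends[OF F]]) (simp add: translate_def)
  then show "cochain_act \<alpha> n g F x = F x"
    by (simp add: cochain_act_def M.cochain_equiv[OF F] M.act_act)
qed

end

theorem theoremB:
  fixes \<mu> :: "'g::{topological_group_add, t2_space, second_countable_topology} measure"
    and \<alpha> :: "'g \<Rightarrow> 'a::{topological_ab_group_add, polish_space} \<Rightarrow> 'a"
    and \<phi> :: "(nat \<Rightarrow> 'g) \<Rightarrow> 'a"
    and p :: nat
  assumes "locally_compact_space (euclidean :: 'g topology)"
    and "haar_measure \<mu>"
    and "G_module_action \<alpha>"
    and "equiv_cocycle \<mu> \<alpha> p \<phi>"
  shows "\<exists>\<sigma> S. equiv_cocycle \<mu> \<alpha> p \<sigma> \<and> cohomologous \<mu> \<alpha> p \<sigma> \<phi> \<and>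
           S \<subseteq> Gpow (Suc p) \<and>
           gdelta_in (top_of_set (Gpow (Suc p))) S \<and>
           Gpow (Suc p) \<subseteq> closure S \<and>
           (AE x in Mpow \<mu> (Suc p). x \<in> S) \<and>
           (\<lambda>i\<in>{..<Suc p}. 0) \<in> S \<and>
           (\<forall>x\<in>S. (\<sigma> \<longlongrightarrow> \<sigma> x) (at x within Gpow (Suc p)))"
proof -
  interpret H: haar \<mu> using assms(1,2) by unfold_locales
  obtain w :: "'g \<Rightarrow> real" where w: "w \<in> borel_measurable borel" "\<And>x. 0 < w x"
    "quasi_invariant (density \<mu> (\<lambda>x. ennreal (w x)))"
    using H.equivalent_probability by blast
  interpret haar_module \<mu> w \<alpha>
    by (intro haar_module.intro haar_module_axioms.intro H.haar_axioms w assms(3))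
  define n where "n = Suc p"
  define f where "f x = \<phi> (restrict x {..<n})" for x
  have fm [measurable]: "f \<in> borel_measurable borel"
    using measurable_compose[OF measurable_restrict_Mpow[of n], of \<phi> borel] assms(4)
    unfolding f_def[abs_def] n_def equiv_cocycle_def equiv_cochain_def by simp
  have fd: "depends_upto n f"
    unfolding depends_upto_def
  proof (intro allI impI)
    fix x y :: "nat \<Rightarrow> 'g" assume "\<forall>i<n. x i = y i"
    then have "restrict x {..<n} = restrict y {..<n}" by (auto simp: restrict_def)
    then show "f x = f y" by (simp add: f_def)
  qed
  have feq: "f x = \<phi> x" if "x \<in> Gpow n" for x
    using that by (simp add: f_def Gpow_def PiE_def extensional_restrict)
  have "cobd n \<phi> x = cobd n f x" for x
    unfolding cobd_def by (intro sum.cong refl) (simp add: f_def omit_def restrict_def cong: if_cong)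
  then have cobd_f: "cobd n \<phi> x = alt n (pcobd 0 (Suc n) f x)" for x
    by (simp add: cobd_eq_pcobd[OF fd])
  have f_equiv: "AE x in M.P. f (translate g x) = \<alpha> g (f x)" for g
  proof -
    \<comment> \<open>The action evaluates a cochain at the inverse translate, so it is applied to
      \<open>- g\<close> to reach \<open>translate g x\<close>.\<close>
    have "AE x in Mpow \<mu> n. cochain_act \<alpha> n (- g) \<phi> x = \<phi> x"
      using assms(4) unfolding equiv_cocycle_def equiv_cochain_def n_def by blast
    from AE_MpowD[OF this] show ?thesis
    proof eventually_elim
      case (elim x)
      have "(\<lambda>j\<in>{..<n}. - (- g) + restrict x {..<n} j) = restrict (translate g x) {..<n}"
        by (auto simp: translate_def)
      with elim have "\<alpha> (- g) (f (translate g x)) = f x"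
        by (simp add: cochain_act_def f_def)
      then have "\<alpha> g (\<alpha> (- g) (f (translate g x))) = \<alpha> g (f x)" by simp
      then show ?case by (simp add: M.act_act)
    qed
  qed
  obtain \<sigma>0 where s0: "M.cochain n \<sigma>0" "AE x in M.P. \<sigma>0 x = f x"
    by (rule M.strict_cochain[OF fm fd _ f_equiv]) (auto simp: n_def)
  have "AE x in Mpow \<mu> (Suc n). alt n (pcobd 0 (Suc n) f x) = 0"
    using assms(4) unfolding equiv_cocycle_def n_def[symmetric] cobd_f by blast
  from AE_MpowD[OF this] have "AE x in M.P. pcobd 0 (Suc n) f x = 0"
  proof eventually_elim
    case (elim x)
    have "pcobd 0 (Suc n) f (restrict x {..<Suc n}) = pcobd 0 (Suc n) f x"
    proof -
      have "f (face i (restrict x {..<Suc n})) = f (face i x)" for i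
        by (rule depends_uptoD[OF fd]) (auto simp: face_def)
      then show ?thesis by (simp add: pcobd_def)
    qed
    with elim have "alt n (alt n (pcobd 0 (Suc n) f x)) = alt n 0" by simp
    then show ?case by simp
  qed
  with M.AE_pcobd_cong[OF s0(2), of 0 "Suc n"] have s0_cocycle: "AE x in M.P. pcobd 0 (Suc n) \<sigma>0 x = 0"
    by eventually_elim simp
  \<comment> \<open>Degree 0 stands apart: there are no coboundaries to correct by, but a strictly
    equivariant function of one variable is already continuous, so \<open>F\<close> is
    \<open>\<sigma>0\<close> itself.\<close>
  obtain F u where F: "M.cochain n F" "M.almost_cont_head n F"
    and u: "if p = 0 then (AE x in M.P. F x = \<sigma>0 x)
      else M.cochain p u \<and> (AE x in M.P. F x = \<sigma>0 x + pcobd 0 n u x)"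
  proof (cases "p = 0")
    case True
    then have "n = 1" by (simp add: n_def)
    then have "M.almost_cont_head n \<sigma>0"
      using M.cont_head_1[OF s0(1)] by (simp add: M.almost_cont_head_def)
    then show ?thesis using that[of \<sigma>0] s0(1) True by simp
  next
    case False
    then have n2: "2 \<le> n" by (simp add: n_def)
    obtain F u where "M.cochain n F" "M.almost_cont_head n F" "M.cochain (n - 1) u"
      "AE x in M.P. F x = \<sigma>0 x + pcobd 0 n u x"
      by (rule M.almost_cont_cocycle[OF s0(1) s0_cocycle n2])
    then show ?thesis using that[of F u] False by (simp add: n_def)
  qed
  note Fm [measurable] = M.cochain_measurable[OF F(1)]
  note Fd = M.cochain_depends[OF F(1)]
  have "AE x in M.P. pcobd 0 (Suc n) F x = 0"
  proof (cases "p = 0")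
    case True
    with u have "AE x in M.P. F x = \<sigma>0 x" by simp
    from s0_cocycle M.AE_pcobd_cong[OF this, of 0 "Suc n"] show ?thesis by eventually_elim simp
  next
    case False
    with u have "AE x in M.P. F x = \<sigma>0 x + pcobd 0 n u x" by simp
    from s0_cocycle M.AE_pcobd_cong[OF this, of 0 "Suc n"] show ?thesis
      by eventually_elim (simp add: pcobd_add pcobd_pcobd)
  qed
  then have "AE x in M.P. cobd n F x = 0"
    by eventually_elim (simp add: cobd_eq_pcobd[OF Fd])
  then have "AE x in Mpow \<mu> (Suc n). cobd n F x = 0"
  proof (rule AE_MpowI[rotated])
    have cF: "M.cochain (Suc n) (pcobd 0 (Suc n) F)" by (rule M.cochain_pcobd[OF F(1)])
    show "depends_upto (Suc n) (\<lambda>x. cobd n F x = 0)"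
      using M.cochain_depends[OF cF] unfolding cobd_eq_pcobd[OF Fd] depends_upto_def by metis
    show "{x. cobd n F x = 0} \<in> sets borel"
      using measurable_equality_set[of "\<lambda>x. alt n (pcobd 0 (Suc n) F x)" borel "\<lambda>x. 0"]
      unfolding cobd_eq_pcobd[OF Fd] by simp
  qed
  then have "equiv_cocycle \<mu> \<alpha> p F"
    using cochain_equiv_cochain[OF F(1)] unfolding equiv_cocycle_def n_def by blast
  moreover have "cohomologous \<mu> \<alpha> p F \<phi>"
  proof (cases "p = 0")
    case True
    with u s0(2) have "AE x in M.P. F x = f x" by auto
    then have "AE x in Mpow \<mu> n. F x = f x"
    proof (rule AE_MpowI[rotated])
      show "depends_upto n (\<lambda>x. F x = f x)" by (rule depends_upto_compose2[OF Fd fd])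
      show "{x. F x = f x} \<in> sets borel" using measurable_equality_set[OF Fm fm] by simp
    qed
    then have "AE x in Mpow \<mu> n. F x = \<phi> x"
      using AE_space by eventually_elim (simp add: feq space_Mpow)
    then show ?thesis unfolding cohomologous_def n_def True by simp
  next
    case False
    with u have cu: "M.cochain p u" and Fu: "AE x in M.P. F x = \<sigma>0 x + pcobd 0 n u x" by auto
    \<comment> \<open>The factor compensates the sign between \<open>cobd\<close> and
      \<open>pcobd\<close> in this degree.\<close>
    define \<psi> where "\<psi> x = alt p (u x)" for x
    have c\<psi>: "M.cochain p \<psi>"
      unfolding \<psi>_def using cu M.cochain_minus[OF cu] by (cases "even p") (simp_all add: alt_def)
    have "pcobd 0 n \<psi> x = alt p (pcobd 0 n u x)" for x
      by (simp add: pcobd_def \<psi>_def alt_sum alt_comm[of p])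
    then have cob: "cobd p \<psi> x = pcobd 0 n u x" for x
      by (simp add: cobd_eq_pcobd[OF M.cochain_depends[OF c\<psi>]] n_def)
    have cpu: "M.cochain n (pcobd 0 n u)" using M.cochain_pcobd[OF cu] by (simp add: n_def)
    note [measurable] = M.cochain_measurable[OF cpu]
    from Fu s0(2) have "AE x in M.P. F x - f x = pcobd 0 n u x" by eventually_elim simp
    then have "AE x in Mpow \<mu> n. F x - f x = pcobd 0 n u x"
    proof (rule AE_MpowI[rotated])
      show "depends_upto n (\<lambda>x. F x - f x = pcobd 0 n u x)"
        by (rule depends_upto_compose2[OF depends_upto_compose2[OF Fd fd] M.cochain_depends[OF cpu]])
      show "{x. F x - f x = pcobd 0 n u x} \<in> sets borel"
        using measurable_equality_set[of "\<lambda>x. F x - f x" borel "pcobd 0 n u"] by simp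
    qed
    then have "AE x in Mpow \<mu> n. F x - \<phi> x = cobd p \<psi> x"
      using AE_space by eventually_elim (simp add: feq space_Mpow cob)
    then show ?thesis
      using False cochain_equiv_cochain[OF c\<psi>] unfolding cohomologous_def n_def by auto
  qed
  moreover define S where "S = Gpow n \<inter> {x. (F \<longlongrightarrow> F x) (at x)}"
  have CS: "(F \<longlongrightarrow> F x) (at x)" if "M.cont_head n F y" "\<And>i. i < n \<Longrightarrow> y i = x i" for x y
    by (rule M.cont_head_full[OF F(1) M.cont_head_cong[OF that]])
  moreover have "S \<subseteq> Gpow (Suc p)" by (simp add: S_def n_def)
  moreover have "gdelta_in (top_of_set (Gpow (Suc p))) S"
    unfolding gdelta_in_subtopology S_def n_def using gdelta_continuity_points(1)[of F] by blast
  moreover have "Gpow (Suc p) \<subseteq> closure S"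
  proof
    fix x :: "nat \<Rightarrow> 'g" assume x: "x \<in> Gpow (Suc p)"
    obtain X where X: "X \<longlonglongrightarrow> x" "\<And>k::nat. M.cont_head n F (X k)"
      using M.AE_P_seq F(2) unfolding M.almost_cont_head_def by blast
    \<comment> \<open>Only the first \<open>n\<close> coordinates of the good sequences are kept;
      the rest are those of \<open>x\<close>, so that \<open>Y k\<close> lies in
      \<open>Gpow n\<close> and still tends to \<open>x\<close>.\<close>
    define Y where "Y k i = (if i < n then X k i else x i)" for k i
    have "(\<lambda>k. Y k i) \<longlonglongrightarrow> x i" for i using X(1) by (cases "i < n") (simp_all add: Y_def tendsto_fun_iff)
    then have "Y \<longlonglongrightarrow> x" by (simp add: tendsto_fun_iff)
    moreover have "Y k \<in> S" for k
      unfolding S_def using x CS[OF X(2)[of k], of "Y k"]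
      by (auto simp: Gpow_def Y_def n_def PiE_def extensional_def)
    ultimately show "x \<in> closure S"
      unfolding closure_iff_nhds_not_empty
    proof (intro allI impI)
      fix A V assume "V \<subseteq> A" "open V" "x \<in> V" and Y: "Y \<longlonglongrightarrow> x" "\<And>k. Y k \<in> S"
      then have "eventually (\<lambda>k. Y k \<in> V) sequentially" by (simp add: topological_tendstoD)
      then obtain k where "Y k \<in> V" by (auto simp: eventually_sequentially)
      with Y \<open>V \<subseteq> A\<close> show "S \<inter> A \<noteq> {}" by blast
    qed
  qed
  moreover have "AE x in Mpow \<mu> (Suc p). x \<in> S"
  proof -
    have "AE x in M.P. (F \<longlongrightarrow> F x) (at x)"
      using F(2)[unfolded M.almost_cont_head_def, THEN conjunct1] by eventually_elim (rule CS; simp)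
    then have "AE x in Mpow \<mu> n. (F \<longlongrightarrow> F x) (at x)"
      by (rule AE_MpowI[OF gdelta_continuity_points(2)]) (rule depends_upto_continuity[OF Fd])
    then show ?thesis
      using AE_space unfolding n_def[symmetric] by eventually_elim (simp add: S_def space_Mpow)
  qed
  moreover have "(\<lambda>i\<in>{..<Suc p}. 0) \<in> S"
    using CS[of "\<lambda>_. 0" "\<lambda>i\<in>{..<Suc p}. 0"] F(2)
    by (auto simp: S_def M.almost_cont_head_def n_def Gpow_def)
  moreover have "\<forall>x\<in>S. (F \<longlongrightarrow> F x) (at x within Gpow (Suc p))"
    by (auto simp: S_def intro: tendsto_within_subset)
  ultimately show ?thesis by blast
qed

end
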